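(* Let $F:U\times\mathbb T^d\times\Lambda\to\mathbb R^2\times\mathbb T^d$ be an analytic map in the reduced form described in the context, i.e. $$F(x,y,\theta,\lambda)=\begin{pmatrix} x+c(\theta,\lambda)y\\ y+a_k(\theta,\lambda)x^k+A(x,y,\theta,\lambda)\\ \theta+\omega+d_p(\theta,\lambda)x^p+B(x,y,\theta,\lambda)\end{pmatrix}.$$ Assume that $2p>k-1$, that $\bar a_k(\lambda)>0$ for $\lambda\in\Lambda$, and that $\omega$ is Diophantine (in the map setting). Then the stable manifold of the invariant torus $\mathcal T=\{(0,0,\theta):\theta\in\mathbb T^d\}$ (in the sense of the context) is unique: for each $\lambda\in\Lambda$, any two stable manifolds of $\mathcal T$ coincide, as subsets of $\mathbb R^2\times\mathbb T^d$, in a neighbourhood of $\mathcal T$.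
   Context: $\mathbb T^d=(\mathbb R/\mathbb Z)^d$; $U\subset\mathbb R^2$ is a neighbourhood of $(0,0)$; $\Lambda\subset\mathbb R^m$ is a parameter set; $\omega\in\mathbb R^d$. For a function of $\theta\in\mathbb T^d$, a bar denotes the average $\frac1{\mathrm{vol}(\mathbb T^d)}\int_{\mathbb T^d}h\,d\theta$; a bar over a coefficient (as in $\bar K^y_{k+1}$) also indicates that it does not depend on $\theta$. Reduced form: $k\ge2$, $p\ge1$ are integers, $F$ is as displayed with $c,a_k,d_p,A,B$ analytic, $\bar c(\lambda)>0$, and $$A=y\,O(\|(x,y)\|^{k-1})+O(\|(x,y)\|^{k+1}),\qquad B=y\,O(\|(x,y)\|^{p-1})+O(\|(x,y)\|^{p+1}).$$ It is assumed throughout that $\bar d_p(\lambda)\neq0$. $\omega\in\mathbb R^d$ is Diophantine (map setting) if there exist $C>0$ and $\tau\ge d$ with $|\omega\cdot q-l|\ge C|q|^{-\tau}$ for all $q\in\mathbb Z^d\setminus\{0\}$, $l\in\mathbb Z$, where $|q|=|q_1|+\dots+|q_d|$. Stable manifold: for fixed $\lambda$, the image of a map $K(\cdot,\cdot,\lambda):[0,\rho)\times\mathbb T^d\to\mathbb R^2\times\mathbb T^d$ (for some $\rho>0$), $C^1$, analytic for $u\in(0,\rho)$, of the form $$K(u,\theta,\lambda)=\big(u^2,\ \bar K^y_{k+1}(\lambda)u^{k+1},\ \theta+\bar K^\theta_{2p-k+1}(\lambda)u^{2p-k+1}\big)+\big(O(u^3),O(u^{k+2}),O(u^{2p-k+2})\big),$$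 for which there is an analytic map $R(u,\theta,\lambda)=(u+\bar R^x_k(\lambda)u^k+O(u^{k+1}),\ \theta+\omega)$ with $\bar R^x_k(\lambda)<0$ satisfying $F(K(u,\theta,\lambda),\lambda)=K(R(u,\theta,\lambda),\lambda)$ for $(u,\theta)\in[0,\rho)\times\mathbb T^d$.
   Formalization: Coincidence near the torus is claimed for the images of K restricted to [0,r) for all sufficiently small r, not for the full images on [0,ρ): with large ρ, K may follow a homoclinic loop back to the torus, and then the literal claim fails. *)

theory Defs
  imports "HOL-Analysis.Analysis"
begin

quotient_type (overloaded) 'd torus =
  "real ^ 'd" / "\<lambda>s t :: real ^ 'd. \<forall>i. s $ i - t $ i \<in> \<int>"
proof (rule equivpI)
  show "reflp (\<lambda>s t :: real ^ 'd. \<forall>i. s $ i - t $ i \<in> \<int>)"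
    by (simp add: reflp_def)
  show "symp (\<lambda>s t :: real ^ 'd. \<forall>i. s $ i - t $ i \<in> \<int>)"
    unfolding symp_def by (metis Ints_minus minus_diff_eq)
  show "transp (\<lambda>s t :: real ^ 'd. \<forall>i. s $ i - t $ i \<in> \<int>)"
  proof (rule transpI)
    fix x y z :: "real ^ 'd"
    assume xy: "\<forall>i. x $ i - y $ i \<in> \<int>" and yz: "\<forall>i. y $ i - z $ i \<in> \<int>"
    show "\<forall>i. x $ i - z $ i \<in> \<int>"
    proof
      fix i
      have "(x $ i - y $ i) + (y $ i - z $ i) \<in> \<int>"
        using xy yz by (intro Ints_add) auto
      then show "x $ i - z $ i \<in> \<int>" by simp
    qed
  qed
qed

lift_definition torus_proj :: "real ^ 'd \<Rightarrow> ('d::finite) torus" is "\<lambda>t. t" .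

instantiation torus :: (finite) ab_group_add
begin

lift_definition zero_torus :: "'a torus" is "0" .

lift_definition plus_torus :: "'a torus \<Rightarrow> 'a torus \<Rightarrow> 'a torus" is "(+)"
  by (simp add: add_diff_add)

lift_definition uminus_torus :: "'a torus \<Rightarrow> 'a torus" is "uminus"
  by (simp, metis Ints_minus minus_diff_eq minus_diff_commute)

definition minus_torus :: "'a torus \<Rightarrow> 'a torus \<Rightarrow> 'a torus"
  where "minus_torus s t = s + - t"

instance
proof
  fix a b c :: "'a torus"
  show "a + b + c = a + (b + c)" by transfer (simp add: algebra_simps)
  show "a + b = b + a" by transfer (simp add: algebra_simps)
  show "0 + a = a" by transfer simp
  show "- a + a = 0" by transfer simp
  show "a - b = a + - b" by (simp add: minus_torus_def)
qed

end

instantiation torus :: (finite) topological_space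
begin

definition open_torus :: "'a torus set \<Rightarrow> bool"
  where "open_torus S \<longleftrightarrow> open (torus_proj -` S)"

instance
  by standard (auto simp: open_torus_def vimage_Union open_Int)

end

text \<open>Since the torus has volume one, the average is the integral over a fundamental domain.\<close>

definition torus_average :: "(('d::finite) torus \<Rightarrow> 'b::real_normed_vector) \<Rightarrow> 'b"
  where "torus_average h = integral (cbox 0 One) (\<lambda>t. h (torus_proj t))"

text \<open>
  Real analyticity on an arbitrary set \<open>S\<close>: near each point of \<open>S\<close> the function agrees on \<open>S\<close> with
  the sum of a multivariate power series converging (absolutely) on a full neighbourhood of the
  point.  Multi-indices are functions on the standard basis, extended by zero.
\<close>

definition real_analytic_on ::
    "('a::euclidean_space \<Rightarrow> 'b::real_normed_vector) \<Rightarrow> 'a set \<Rightarrow> bool"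
  where "real_analytic_on f S \<longleftrightarrow>
    (\<forall>z\<in>S. \<exists>r>0. \<exists>coef g.
      (\<forall>w\<in>ball z r.
        ((\<lambda>\<alpha>. (\<Prod>b\<in>Basis. ((w - z) \<bullet> b) ^ \<alpha> b) *\<^sub>R coef \<alpha>) has_sum g w)
          {\<alpha> :: 'a \<Rightarrow> nat. \<forall>b. b \<notin> Basis \<longrightarrow> \<alpha> b = 0}) \<and>
      (\<forall>w\<in>S \<inter> ball z r. f w = g w))"

text \<open>\<open>C\<^sup>1\<close> up to those boundary points that belong to \<open>S\<close>.\<close>

definition C1_on ::
    "('a::real_normed_vector \<Rightarrow> 'b::real_normed_vector) \<Rightarrow> 'a set \<Rightarrow> bool"
  where "C1_on f S \<longleftrightarrow>
    (\<exists>f'. continuous_on S f' \<and>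
      (\<forall>z\<in>S. (f has_derivative blinfun_apply (f' z)) (at z within S)))"

text \<open>\<open>f u \<theta> = O(u ^ n)\<close> as \<open>u\<close> decreases to \<open>0\<close>, uniformly in \<open>\<theta>\<close>.\<close>

definition unif_bigo :: "(real \<Rightarrow> 't \<Rightarrow> 'b::real_normed_vector) \<Rightarrow> nat \<Rightarrow> bool"
  where "unif_bigo f n \<longleftrightarrow>
    (\<exists>C. eventually (\<lambda>u. \<forall>\<theta>. norm (f u \<theta>) \<le> C * u ^ n) (at_right 0))"

text \<open>
  \<open>f x y \<theta> = y O(\<parallel>(x,y)\<parallel>^m) + O(\<parallel>(x,y)\<parallel>^n)\<close> as \<open>(x,y)\<close> tends to the origin, uniformly in \<open>\<theta>\<close>.
\<close>

definition mixed_bigo :: "(real \<Rightarrow> real \<Rightarrow> 't \<Rightarrow> 'b::real_normed_vector) \<Rightarrow> nat \<Rightarrow> nat \<Rightarrow> bool"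
  where "mixed_bigo f m n \<longleftrightarrow>
    (\<exists>f1 f2 C.
      eventually (\<lambda>(x, y). \<forall>\<theta>. f x y \<theta> = y *\<^sub>R f1 x y \<theta> + f2 x y \<theta> \<and>
          norm (f1 x y \<theta>) \<le> C * norm (x, y) ^ m \<and>
          norm (f2 x y \<theta>) \<le> C * norm (x, y) ^ n)
        (nhds (0, 0)))"

definition diophantine :: "real ^ 'd \<Rightarrow> bool"
  where "diophantine \<omega> \<longleftrightarrow>
    (\<exists>C>0. \<exists>\<tau>\<ge>real CARD('d). \<forall>(q :: int ^ 'd) (l :: int). q \<noteq> 0 \<longrightarrow>
      \<bar>(\<Sum>i\<in>UNIV. \<omega> $ i * of_int (q $ i)) - of_int l\<bar>
        \<ge> C * of_int (\<Sum>i\<in>UNIV. \<bar>q $ i\<bar>) powr (- \<tau>))"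

text \<open>
  Analyticity in the angles is analyticity of the lift along the covering map.  The order
  conditions on \<open>A\<close> and \<open>B\<close> are required for each parameter value separately.
\<close>

definition reduced_form ::
    "(real \<times> real) set \<Rightarrow> (real ^ 'm) set \<Rightarrow> real ^ 'd \<Rightarrow> nat \<Rightarrow> nat \<Rightarrow>
     (('d::finite) torus \<Rightarrow> real ^ ('m::finite) \<Rightarrow> real) \<Rightarrow>
     ('d torus \<Rightarrow> real ^ 'm \<Rightarrow> real) \<Rightarrow>
     ('d torus \<Rightarrow> real ^ 'm \<Rightarrow> real ^ 'd) \<Rightarrow>
     (real \<Rightarrow> real \<Rightarrow> 'd torus \<Rightarrow> real ^ 'm \<Rightarrow> real) \<Rightarrow>
     (real \<Rightarrow> real \<Rightarrow> 'd torus \<Rightarrow> real ^ 'm \<Rightarrow> real ^ 'd) \<Rightarrow>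
     (real \<times> real \<times> 'd torus \<Rightarrow> real ^ 'm \<Rightarrow> real \<times> real \<times> 'd torus) \<Rightarrow> bool"
  where "reduced_form U \<Lambda> \<omega> k p c a d A B F \<longleftrightarrow>
    (\<forall>x y \<theta> \<mu>. (x, y) \<in> U \<longrightarrow> \<mu> \<in> \<Lambda> \<longrightarrow>
      F (x, y, \<theta>) \<mu> =
        (x + c \<theta> \<mu> * y,
         y + a \<theta> \<mu> * x ^ k + A x y \<theta> \<mu>,
         \<theta> + torus_proj (\<omega> + x ^ p *\<^sub>R d \<theta> \<mu> + B x y \<theta> \<mu>))) \<and>
    real_analytic_on (\<lambda>(t, \<mu>). c (torus_proj t) \<mu>) (UNIV \<times> \<Lambda>) \<and>
    real_analytic_on (\<lambda>(t, \<mu>). a (torus_proj t) \<mu>) (UNIV \<times> \<Lambda>) \<and>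
    real_analytic_on (\<lambda>(t, \<mu>). d (torus_proj t) \<mu>) (UNIV \<times> \<Lambda>) \<and>
    real_analytic_on (\<lambda>((x, y), t, \<mu>). A x y (torus_proj t) \<mu>) (U \<times> UNIV \<times> \<Lambda>) \<and>
    real_analytic_on (\<lambda>((x, y), t, \<mu>). B x y (torus_proj t) \<mu>) (U \<times> UNIV \<times> \<Lambda>) \<and>
    (\<forall>\<mu>\<in>\<Lambda>. torus_average (\<lambda>\<theta>. c \<theta> \<mu>) > 0) \<and>
    (\<forall>\<mu>\<in>\<Lambda>. torus_average (\<lambda>\<theta>. d \<theta> \<mu>) \<noteq> 0) \<and>
    (\<forall>\<mu>\<in>\<Lambda>. mixed_bigo (\<lambda>x y \<theta>. A x y \<theta> \<mu>) (k - 1) (k + 1)) \<and>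
    (\<forall>\<mu>\<in>\<Lambda>. mixed_bigo (\<lambda>x y \<theta>. B x y \<theta> \<mu>) (p - 1) (p + 1))"

text \<open>
  \<open>K\<close>, restricted to \<open>[0,\<rho>) \<times> T\<^sup>d\<close>, parametrizes a stable manifold of the torus \<open>x = y = 0\<close> for the
  map \<open>G\<close> with domain \<open>U \<times> T\<^sup>d\<close> (below \<open>G\<close> is \<open>F\<close> at a fixed parameter value).  The angular
  component of \<open>K\<close> is the identity plus the projection of a vector-valued displacement \<open>S\<close>, so
  regularity and expansion of \<open>K\<close> are those of \<open>X\<close>, \<open>Y\<close> and \<open>S\<close>.  For both sides of the
  invariance equation to be meaningful, \<open>K\<close> has to take values in the domain of \<open>G\<close>, and the inner
  dynamics \<open>(u,\<theta>) \<mapsto> (Rx u \<theta>, \<theta> + \<omega>)\<close> has to preserve the domain of \<open>K\<close>.  The exponents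
  \<open>2 * p + 1 - k\<close> and \<open>2 * p + 2 - k\<close> are only used for \<open>2 * p > k - 1\<close>, so they are not truncated.
\<close>

definition stable_parametrization ::
    "(real \<times> real) set \<Rightarrow> real ^ 'd \<Rightarrow> nat \<Rightarrow> nat \<Rightarrow>
     (real \<times> real \<times> ('d::finite) torus \<Rightarrow> real \<times> real \<times> 'd torus) \<Rightarrow>
     real \<Rightarrow> (real \<times> 'd torus \<Rightarrow> real \<times> real \<times> 'd torus) \<Rightarrow> bool"
  where "stable_parametrization U \<omega> k p G \<rho> K \<longleftrightarrow>
    \<rho> > 0 \<and>
    (\<exists>X Y S Rx. \<exists>Ky :: real. \<exists>K\<theta> :: real ^ 'd. \<exists>Rk :: real.
      (\<forall>u\<in>{0..<\<rho>}. \<forall>\<theta>.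
        K (u, \<theta>) = (X u \<theta>, Y u \<theta>, \<theta> + torus_proj (S u \<theta>)) \<and>
        (X u \<theta>, Y u \<theta>) \<in> U) \<and>
      C1_on (\<lambda>(u, t). (X u (torus_proj t), Y u (torus_proj t), S u (torus_proj t)))
        ({0..<\<rho>} \<times> UNIV) \<and>
      real_analytic_on
        (\<lambda>(u, t). (X u (torus_proj t), Y u (torus_proj t), S u (torus_proj t)))
        ({0<..<\<rho>} \<times> UNIV) \<and>
      unif_bigo (\<lambda>u \<theta>. X u \<theta> - u\<^sup>2) 3 \<and>
      unif_bigo (\<lambda>u \<theta>. Y u \<theta> - Ky * u ^ (k + 1)) (k + 2) \<and>
      unif_bigo (\<lambda>u \<theta>. S u \<theta> - u ^ (2 * p + 1 - k) *\<^sub>R K\<theta>) (2 * p + 2 - k) \<and>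
      real_analytic_on (\<lambda>(u, t). Rx u (torus_proj t)) ({0..<\<rho>} \<times> UNIV) \<and>
      unif_bigo (\<lambda>u \<theta>. Rx u \<theta> - (u + Rk * u ^ k)) (k + 1) \<and>
      Rk < 0 \<and>
      (\<forall>u\<in>{0..<\<rho>}. \<forall>\<theta>.
        Rx u \<theta> \<in> {0..<\<rho>} \<and>
        G (K (u, \<theta>)) = K (Rx u \<theta>, \<theta> + torus_proj \<omega>)))"

text \<open>
  Equality of two stable manifolds in a neighbourhood of the torus.  A stable manifold is a local
  object, with \<open>\<rho>\<close> understood to be small: without this, the image of \<open>[0,\<rho>) \<times> T\<^sup>d\<close> may follow
  the manifold globally and come back close to the torus, e.g. along a homoclinic loop, and
  then differs near the torus from its own restrictions.
\<close>

definition coincide_near_torus ::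
    "real \<Rightarrow> (real \<times> ('d::finite) torus \<Rightarrow> real \<times> real \<times> 'd torus) \<Rightarrow>
     real \<Rightarrow> (real \<times> 'd torus \<Rightarrow> real \<times> real \<times> 'd torus) \<Rightarrow> bool"
  where "coincide_near_torus \<rho>1 K1 \<rho>2 K2 \<longleftrightarrow>
    (\<exists>\<delta>>0. \<forall>r1 r2. 0 < r1 \<and> r1 \<le> min \<delta> \<rho>1 \<longrightarrow> 0 < r2 \<and> r2 \<le> min \<delta> \<rho>2 \<longrightarrow>
      (\<exists>V. open V \<and> {(0, 0, \<theta>) | \<theta>. True} \<subseteq> V \<and>
        K1 ` ({0..<r1} \<times> UNIV) \<inter> V = K2 ` ({0..<r2} \<times> UNIV) \<inter> V))"

end

theory Submission
  imports Defs "HOL-Library.Landau_Symbols"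
begin


text \<open>
  Every point \<open>K1 (u, \<theta>)\<close> of the first manifold starts an orbit \<open>(x, y, \<theta>)\<close> with
  \<open>x = u\<^sup>2 + O(u ^ 3)\<close> and \<open>y = \<kappa> u ^ (k + 1) + O(u ^ (k + 2))\<close>, where \<open>u\<close> evolves by
  \<open>u1 = u - r u ^ k + O(u ^ (k + 1))\<close>.  By Brouwer's theorem (\<open>parametrization_surjective\<close>) the second
  manifold has a point \<open>(x', y', \<theta>')\<close> with the same \<open>x\<close> and the same angle and with a parameter
  of comparable size.  The theorem says that then also \<open>y' = y\<close>.

  To see this, follow both orbits and measure their distance by \<open>\<xi> = x' / x - 1\<close>,
  \<open>\<eta> = y' / y - 1\<close> and \<open>\<delta> = norm (\<theta>' - \<theta>)\<close>.  Subtracting the equations of the map gives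
  \<open>\<xi>1 - \<xi> = (x1 - x) / x1 (\<eta> - \<xi>)\<close> and \<open>\<eta>1 - \<eta> = (y1 - y) / y1 ((1 + \<xi>) ^ k - 1 - \<eta>)\<close> up to
  \<open>O(u ^ (k - 1) \<delta> + u ^ k (\<bar>\<xi>\<bar> + \<bar>\<eta>\<bar> + \<delta>))\<close>, while \<open>\<delta>\<close> changes by \<open>O(u ^ k (\<bar>\<xi>\<bar> + \<bar>\<eta>\<bar> + \<delta>))\<close>,
  which is where \<open>2 p > k - 1\<close> enters.
  The coefficients \<open>c\<close> and \<open>a\<close>, which may change sign with the angle, occur here only through the
  relative increments of the first orbit, and these are known from the expansion of the manifold:
  \<open>(x1 - x) / x1\<close> is \<open>- 2 h + O(u ^ k)\<close> with \<open>h = r u ^ (k - 1)\<close>, plus the increment of the quantity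
  \<open>x / u\<^sup>2 - 1 = O(u)\<close>; similarly \<open>(y1 - y) / y1\<close>, with \<open>k + 1\<close> instead of \<open>2\<close>.  The increments of
  quantities of size \<open>O(u)\<close> are removed by a change of variables close to the identity
  (\<open>relative_increment\<close>, \<open>adjusted_increment\<close>).  So the expansion of the manifold does the work of
  averaging over the angles, and what remains is, in the time that advances by \<open>h\<close> at each step,
  a small perturbation of
  \<open>d\<xi> = 2 (\<xi> - \<eta>)\<close>, \<open>d\<eta> = (k + 1) (\<eta> - ((1 + \<xi>) ^ k - 1))\<close>.

  The linear part of this system has the eigenvalues \<open>2 k + 2\<close> and \<open>1 - k\<close>.  Let
  \<open>P = (k + 1) \<xi> - 2 \<eta>\<close> and \<open>Q = k \<xi> + \<eta>\<close> be the corresponding components.  By Bernoulli's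
  inequality the nonlinear term \<open>(1 + \<xi>) ^ k - 1 - k \<xi>\<close> is nonnegative, and it acts on \<open>P\<close> with a
  positive sign.  Therefore a cone \<open>0 < P\<close>, \<open>\<bar>Q\<bar> \<le> P\<close>, \<open>\<delta> \<le> c P\<close> is invariant, without any
  smallness of \<open>\<xi>\<close>, and in it \<open>P u\<close> does not decrease (\<open>cone_step\<close>).  Initially
  \<open>\<xi> = \<delta> = 0\<close>, so \<open>P\<close> is about \<open>- 2 \<eta>\<close>.  If \<open>y' / y < 1\<close>, the pair of orbits starts in the cone, and \<open>P u\<close> stays
  above a positive constant; but \<open>P\<close> is bounded, because both orbits decay at the same rate, and
  \<open>u\<close> tends to \<open>0\<close>.  Hence \<open>y' / y \<ge> 1\<close>, and exchanging the two manifolds \<open>y / y' \<ge> 1\<close>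
  (\<open>orbits_ordered\<close>, \<open>stable_lifts_coincide\<close>).  The argument divides by the leading coefficient
  \<open>\<kappa>\<close> of \<open>y\<close>; it cannot vanish, since otherwise \<open>x\<close> could not decrease to \<open>0\<close> along the orbit
  (\<open>stable_orbit_leading_coefficient\<close>).

  The error terms require Lipschitz estimates of \<open>A\<close> and \<open>B\<close> at the scale \<open>x \<approx> u\<^sup>2\<close>,
  \<open>y \<approx> u ^ (k + 1)\<close>, whereas the hypotheses only bound the size of \<open>A\<close> and \<open>B\<close>.  Analyticity
  bridges the gap: giving \<open>x\<close> the weight \<open>2\<close> and \<open>y\<close> the weight \<open>k + 1\<close>, a function of size
  \<open>O(u ^ m)\<close> at this scale is a combination of monomials of weight at least \<open>m\<close> with analytic
  coefficients (\<open>weighted_ideal_order\<close>), and such a combination has the expected Lipschitz constant.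
\<close>

section \<open>Germs of real analytic functions\<close>

definition multi_indices :: "('a::euclidean_space \<Rightarrow> nat) set"
  where "multi_indices = {\<alpha>. \<forall>b. b \<notin> Basis \<longrightarrow> \<alpha> b = 0}"

definition monomial :: "('a::euclidean_space \<Rightarrow> nat) \<Rightarrow> 'a \<Rightarrow> real"
  where "monomial \<alpha> v = (\<Prod>b\<in>Basis. (v \<bullet> b) ^ \<alpha> b)"

definition total_degree :: "('a::euclidean_space \<Rightarrow> nat) \<Rightarrow> nat"
  where "total_degree \<alpha> = (\<Sum>b\<in>Basis. \<alpha> b)"

definition cube :: "'a::euclidean_space \<Rightarrow> real \<Rightarrow> 'a set"
  where "cube z \<rho> = {w. \<forall>b\<in>Basis. \<bar>(w - z) \<bullet> b\<bar> \<le> \<rho>}"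

text \<open>
  The majorant at the corner of the cube belongs to the definition because everything below is
  proved by comparison with it: convergence of the series after removing terms or lowering
  exponents, and the Lipschitz estimate.
\<close>

definition analytic_germ :: "'a::euclidean_space \<Rightarrow> ('a \<Rightarrow> real) \<Rightarrow> bool"
  where "analytic_germ z f \<longleftrightarrow>
    (\<exists>\<rho>>0. \<exists>coef.
      (\<lambda>\<alpha>. \<rho> ^ total_degree \<alpha> * \<bar>coef \<alpha>\<bar>) summable_on multi_indices \<and>
      (\<forall>w\<in>cube z \<rho>. ((\<lambda>\<alpha>. monomial \<alpha> (w - z) * coef \<alpha>) has_sum f w) multi_indices))"

lemma eventually_cube:
  assumes "\<rho> > 0"
  shows "eventually (\<lambda>w. w \<in> cube z \<rho>) (nhds z)"
proof -
  have "w \<in> cube z \<rho>" if "dist w z < \<rho>" for w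
    unfolding cube_def
    using that Basis_le_norm[of _ "w - z"] by (fastforce simp: dist_norm)
  then show ?thesis
    unfolding eventually_nhds_metric using assms by blast
qed

lemma monomial_bound:
  assumes "\<And>b. b \<in> Basis \<Longrightarrow> \<bar>v \<bullet> b\<bar> \<le> \<rho>"
  shows "\<bar>monomial \<alpha> v\<bar> \<le> \<rho> ^ total_degree \<alpha>"
proof -
  have "\<bar>monomial \<alpha> v\<bar> = (\<Prod>b\<in>Basis. \<bar>v \<bullet> b\<bar> ^ \<alpha> b)"
    by (simp add: monomial_def abs_prod power_abs)
  also have "\<dots> \<le> (\<Prod>b\<in>Basis. \<rho> ^ \<alpha> b)"
    using assms by (intro prod_mono conjI power_mono) auto
  also have "\<dots> = \<rho> ^ total_degree \<alpha>"
    by (simp add: power_sum total_degree_def)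
  finally show ?thesis .
qed

lemma monomial_series_summable:
  assumes "(\<lambda>\<alpha>. \<rho> ^ total_degree \<alpha> * \<bar>coef \<alpha>\<bar>) summable_on multi_indices"
    and "w \<in> cube z \<rho>"
  shows "(\<lambda>\<alpha>. monomial \<alpha> (w - z) * coef \<alpha>) summable_on multi_indices"
proof (rule abs_summable_summable, rule Infinite_Sum.abs_summable_on_comparison_test'[OF assms(1)])
  fix \<alpha> :: "'a \<Rightarrow> nat"
  show "norm (monomial \<alpha> (w - z) * coef \<alpha>) \<le> \<rho> ^ total_degree \<alpha> * \<bar>coef \<alpha>\<bar>"
    using monomial_bound[of "w - z" \<rho> \<alpha>] assms(2)
    by (auto simp: cube_def abs_mult intro!: mult_right_mono)
qed

lemma cube_subset_ball:
  fixes z :: "'a::euclidean_space"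
  assumes "r > 0"
  obtains \<rho> where "\<rho> > 0" "cube z \<rho> \<subseteq> ball z r"
proof -
  define \<rho> where "\<rho> = r / (2 * real DIM('a))"
  have \<rho>: "\<rho> > 0" using assms by (simp add: \<rho>_def)
  have "w \<in> ball z r" if "w \<in> cube z \<rho>" for w
  proof -
    have "norm (w - z) \<le> (\<Sum>b\<in>Basis. \<bar>(w - z) \<bullet> b\<bar>)" by (rule norm_le_l1)
    also have "\<dots> \<le> (\<Sum>b\<in>(Basis::'a set). \<rho>)" using that by (intro sum_mono) (auto simp: cube_def)
    also have "\<dots> = r / 2" by (simp add: \<rho>_def)
    finally show ?thesis using assms by (simp add: dist_norm norm_minus_commute)
  qed
  with \<rho> show ?thesis by (intro that) auto
qed

text \<open>
  Convergence on a ball yields the majorant: at the corner of a cube inside the ball each monomial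
  equals \<open>\<rho> ^ total_degree \<alpha>\<close>, and unconditionally convergent series of reals converge absolutely.
\<close>

lemma analytic_germI:
  assumes "r > 0"
    and "\<And>w. w \<in> ball z r \<Longrightarrow>
      ((\<lambda>\<alpha>. monomial \<alpha> (w - z) * coef \<alpha>) has_sum f w) multi_indices"
  shows "analytic_germ z f"
proof -
  obtain \<rho> where \<rho>: "\<rho> > 0" and sub: "cube z \<rho> \<subseteq> ball z r"
    using cube_subset_ball[OF assms(1)] .
  note cube = subsetD[OF sub]
  define w0 where "w0 = z + \<rho> *\<^sub>R One"
  have w0: "(w0 - z) \<bullet> b = \<rho>" if "b \<in> Basis" for b
    using that by (simp add: w0_def)
  have "w0 \<in> cube z \<rho>" using w0 \<rho> by (simp add: cube_def)
  then have "(\<lambda>\<alpha>. monomial \<alpha> (w0 - z) * coef \<alpha>) summable_on multi_indices"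
    using has_sum_imp_summable[OF assms(2)[OF cube]] by blast
  then have "(\<lambda>\<alpha>. norm (monomial \<alpha> (w0 - z) * coef \<alpha>)) summable_on multi_indices"
    by (rule iffD1[OF summable_on_iff_abs_summable_on_real])
  moreover have "norm (monomial \<alpha> (w0 - z) * coef \<alpha>) = \<rho> ^ total_degree \<alpha> * \<bar>coef \<alpha>\<bar>" for \<alpha>
    using w0 \<rho> by (simp add: monomial_def abs_mult abs_prod power_abs power_sum total_degree_def)
  ultimately have "(\<lambda>\<alpha>. \<rho> ^ total_degree \<alpha> * \<bar>coef \<alpha>\<bar>) summable_on multi_indices" by simp
  then show ?thesis
    unfolding analytic_germ_def using \<rho> assms(2)[OF cube] by blast
qed

text \<open>
  The functional \<open>l\<close> reduces vector-valued functions to their components.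
\<close>

lemma real_analytic_on_germ:
  fixes f :: "'a::euclidean_space \<Rightarrow> 'b::real_normed_vector"
  assumes f: "real_analytic_on f S" and z: "z \<in> S" and l: "bounded_linear (l :: 'b \<Rightarrow> real)"
  obtains g where "analytic_germ z g" "eventually (\<lambda>w. w \<in> S \<longrightarrow> l (f w) = g w) (nhds z)"
proof -
  have "\<exists>r>0. \<exists>coef g.
      (\<forall>w\<in>ball z r. ((\<lambda>\<alpha>. monomial \<alpha> (w - z) *\<^sub>R coef \<alpha>) has_sum g w) multi_indices) \<and>
      (\<forall>w\<in>S \<inter> ball z r. f w = g w)"
    using f z unfolding real_analytic_on_def monomial_def multi_indices_def by (rule bspec)
  then obtain r coef g where r: "r > 0"
    and g: "\<forall>w\<in>ball z r. ((\<lambda>\<alpha>. monomial \<alpha> (w - z) *\<^sub>R coef \<alpha>) has_sum g w) multi_indices"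
    and fg: "\<forall>w\<in>S \<inter> ball z r. f w = g w"
    by blast
  have "((\<lambda>\<alpha>. monomial \<alpha> (w - z) * l (coef \<alpha>)) has_sum l (g w)) multi_indices"
    if "w \<in> ball z r" for w
    using has_sum_bounded_linear[OF l bspec[OF g that]]
    by (simp add: linear_cmul[OF bounded_linear.linear[OF l]])
  then have "analytic_germ z (\<lambda>w. l (g w))"
    by (rule analytic_germI[OF r])
  moreover have "eventually (\<lambda>w. w \<in> S \<longrightarrow> l (f w) = l (g w)) (nhds z)"
    unfolding eventually_nhds_metric using r fg by (auto simp: dist_commute)
  ultimately show ?thesis by (rule that)
qed

text \<open>
  After rescaling to the unit cube, differences of products and of powers are bounded by sums of
  differences, each exponent contributing as a factor.
\<close>

lemma monomial_lipschitz:
  assumes s: "s > 0" and v: "\<And>b. b \<in> Basis \<Longrightarrow> \<bar>v \<bullet> b\<bar> \<le> s" "\<And>b. b \<in> Basis \<Longrightarrow> \<bar>v' \<bullet> b\<bar> \<le> s"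
  shows "\<bar>monomial \<alpha> v' - monomial \<alpha> v\<bar> \<le> s ^ total_degree \<alpha> * (real (total_degree \<alpha>) * (norm (v' - v) / s))"
proof -
  have scale: "monomial \<alpha> v = s ^ total_degree \<alpha> * (\<Prod>b\<in>Basis. (v \<bullet> b / s) ^ \<alpha> b)" for v :: 'a
  proof -
    have "(\<Prod>b\<in>Basis. (v \<bullet> b) ^ \<alpha> b) = (\<Prod>b\<in>Basis. s ^ \<alpha> b * (v \<bullet> b / s) ^ \<alpha> b)"
      using s by (intro prod.cong) (auto simp: power_divide)
    then show ?thesis
      by (simp add: monomial_def prod.distrib power_sum total_degree_def)
  qed
  have le1: "\<bar>v \<bullet> b / s\<bar> \<le> 1" "\<bar>v' \<bullet> b / s\<bar> \<le> 1" if "b \<in> Basis" for b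
    using v that s by (auto simp: divide_le_eq)
  have "norm ((\<Prod>b\<in>Basis. (v' \<bullet> b / s) ^ \<alpha> b) - (\<Prod>b\<in>Basis. (v \<bullet> b / s) ^ \<alpha> b))
      \<le> (\<Sum>b\<in>Basis. norm ((v' \<bullet> b / s) ^ \<alpha> b - (v \<bullet> b / s) ^ \<alpha> b))"
    using le1 by (intro norm_prod_diff) (auto simp: power_abs intro!: power_le_one)
  also have "\<dots> \<le> (\<Sum>b\<in>Basis. real (\<alpha> b) * (norm (v' - v) / s))"
  proof (rule sum_mono)
    fix b :: 'a assume b: "b \<in> Basis"
    have "norm ((v' \<bullet> b / s) ^ \<alpha> b - (v \<bullet> b / s) ^ \<alpha> b) \<le> real (\<alpha> b) * norm (v' \<bullet> b / s - v \<bullet> b / s)"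
      using le1[OF b] by (intro norm_power_diff) auto
    also have "norm (v' \<bullet> b / s - v \<bullet> b / s) = \<bar>(v' - v) \<bullet> b\<bar> / s"
      using s by (metis abs_divide abs_of_pos diff_divide_distrib inner_diff_left real_norm_def)
    also have "real (\<alpha> b) * (\<bar>(v' - v) \<bullet> b\<bar> / s) \<le> real (\<alpha> b) * (norm (v' - v) / s)"
      using s Basis_le_norm[OF b] by (intro mult_left_mono divide_right_mono) auto
    finally show "norm ((v' \<bullet> b / s) ^ \<alpha> b - (v \<bullet> b / s) ^ \<alpha> b) \<le> real (\<alpha> b) * (norm (v' - v) / s)" .
  qed
  also have "\<dots> = real (total_degree \<alpha>) * (norm (v' - v) / s)"
    by (simp add: total_degree_def sum_distrib_right sum_divide_distrib)
  finally have "\<bar>(\<Prod>b\<in>Basis. (v' \<bullet> b / s) ^ \<alpha> b) - (\<Prod>b\<in>Basis. (v \<bullet> b / s) ^ \<alpha> b)\<bar>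
      \<le> real (total_degree \<alpha>) * (norm (v' - v) / s)" by simp
  then have "s ^ total_degree \<alpha> * \<bar>(\<Prod>b\<in>Basis. (v' \<bullet> b / s) ^ \<alpha> b) - (\<Prod>b\<in>Basis. (v \<bullet> b / s) ^ \<alpha> b)\<bar>
      \<le> s ^ total_degree \<alpha> * (real (total_degree \<alpha>) * (norm (v' - v) / s))"
    using s by (intro mult_left_mono) auto
  then show ?thesis
    using s by (simp add: scale right_diff_distrib[symmetric] abs_mult)
qed

text \<open>
  On the cube of half the radius the factor \<open>2 ^ total_degree \<alpha>\<close> that is gained absorbs the factor
  \<open>total_degree \<alpha>\<close> lost to differentiation.
\<close>

lemma analytic_germ_lipschitz:
  assumes "analytic_germ z f"
  obtains L \<epsilon> where "L \<ge> 0" "\<epsilon> > 0"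
    "\<And>w w'. w \<in> ball z \<epsilon> \<Longrightarrow> w' \<in> ball z \<epsilon> \<Longrightarrow> \<bar>f w' - f w\<bar> \<le> L * norm (w' - w)"
    "\<And>w. w \<in> ball z \<epsilon> \<Longrightarrow> \<bar>f w\<bar> \<le> L"
proof -
  obtain \<rho> coef where \<rho>: "\<rho> > 0"
    and sm: "(\<lambda>\<alpha>. \<rho> ^ total_degree \<alpha> * \<bar>coef \<alpha>\<bar>) summable_on multi_indices"
    and hs: "\<And>w. w \<in> cube z \<rho> \<Longrightarrow> ((\<lambda>\<alpha>. monomial \<alpha> (w - z) * coef \<alpha>) has_sum f w) multi_indices"
    using assms unfolding analytic_germ_def by blast
  define L0 where "L0 = (\<Sum>\<^sub>\<infinity>\<alpha>\<in>multi_indices. \<rho> ^ total_degree \<alpha> * \<bar>coef \<alpha>\<bar>)"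
  have L0: "((\<lambda>\<alpha>. \<rho> ^ total_degree \<alpha> * \<bar>coef \<alpha>\<bar>) has_sum L0) multi_indices"
    unfolding L0_def using sm by (rule has_sum_infsum)
  have L0nn: "L0 \<ge> 0" unfolding L0_def using \<rho> by (intro infsum_nonneg) auto
  obtain \<epsilon> where \<epsilon>: "\<epsilon> > 0" "\<And>w. w \<in> ball z \<epsilon> \<Longrightarrow> w \<in> cube z (\<rho> / 2)"
    using eventually_cube[of "\<rho>/2" z] \<rho> unfolding eventually_nhds_metric
    by (metis half_gt_zero mem_ball dist_commute)
  have cube: "w \<in> cube z \<rho>" if "w \<in> cube z (\<rho>/2)" for w
    using that \<rho> by (force simp: cube_def)
  have lip: "\<bar>f w' - f w\<bar> \<le> L0 * (2 / \<rho>) * norm (w' - w)" if w: "w \<in> ball z \<epsilon>" "w' \<in> ball z \<epsilon>" for w w'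
  proof -
    have "((\<lambda>\<alpha>. monomial \<alpha> (w' - z) * coef \<alpha> - monomial \<alpha> (w - z) * coef \<alpha>) has_sum (f w' - f w)) multi_indices"
      using has_sum_add[OF hs[OF cube[OF \<epsilon>(2)[OF w(2)]]] has_sum_uminusI[OF hs[OF cube[OF \<epsilon>(2)[OF w(1)]]]]]
      by simp
    moreover have "((\<lambda>\<alpha>. (\<rho> ^ total_degree \<alpha> * \<bar>coef \<alpha>\<bar>) * (2 / \<rho> * norm (w' - w))) has_sum
        (L0 * (2 / \<rho> * norm (w' - w)))) multi_indices"
      by (rule has_sum_cmult_left[OF L0])
    moreover have "norm (monomial \<alpha> (w' - z) * coef \<alpha> - monomial \<alpha> (w - z) * coef \<alpha>)
        \<le> (\<rho> ^ total_degree \<alpha> * \<bar>coef \<alpha>\<bar>) * (2 / \<rho> * norm (w' - w))" for \<alpha>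
    proof -
      let ?n = "total_degree \<alpha>"
      have "\<bar>monomial \<alpha> (w' - z) - monomial \<alpha> (w - z)\<bar>
          \<le> (\<rho>/2) ^ ?n * (real ?n * (norm ((w' - z) - (w - z)) / (\<rho>/2)))"
        using \<epsilon>(2)[OF w(1)] \<epsilon>(2)[OF w(2)] \<rho> by (intro monomial_lipschitz) (auto simp: cube_def)
      also have "\<dots> = \<rho> ^ ?n * (real ?n / 2 ^ ?n) * (2 / \<rho> * norm (w' - w))"
        by (simp add: power_divide)
      also have "\<dots> \<le> \<rho> ^ ?n * 1 * (2 / \<rho> * norm (w' - w))"
        using \<rho> of_nat_less_two_power[of ?n, where 'a = real]
        by (intro mult_right_mono mult_left_mono) (auto simp: divide_le_eq)
      finally have "\<bar>monomial \<alpha> (w' - z) - monomial \<alpha> (w - z)\<bar> * \<bar>coef \<alpha>\<bar>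
          \<le> \<rho> ^ ?n * 1 * (2 / \<rho> * norm (w' - w)) * \<bar>coef \<alpha>\<bar>"
        by (rule mult_right_mono) auto
      moreover have "norm (monomial \<alpha> (w' - z) * coef \<alpha> - monomial \<alpha> (w - z) * coef \<alpha>)
          = \<bar>monomial \<alpha> (w' - z) - monomial \<alpha> (w - z)\<bar> * \<bar>coef \<alpha>\<bar>"
        by (simp only: real_norm_def abs_mult[symmetric] left_diff_distrib)
      ultimately show ?thesis by (simp add: mult_ac)
    qed
    ultimately have "norm (f w' - f w) \<le> L0 * (2 / \<rho> * norm (w' - w))"
      using norm_infsum_le by blast
    then show ?thesis by (simp add: mult.assoc)
  qed
  have bd: "\<bar>f w\<bar> \<le> L0" if "w \<in> ball z \<epsilon>" for w
  proof -
    have c: "w \<in> cube z \<rho>" using cube \<epsilon> that by blast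
    have "norm (monomial \<alpha> (w - z) * coef \<alpha>) \<le> \<rho> ^ total_degree \<alpha> * \<bar>coef \<alpha>\<bar>" for \<alpha> :: "'a \<Rightarrow> nat"
      using monomial_bound[of "w - z" \<rho> \<alpha>] c
      by (auto simp: cube_def abs_mult intro!: mult_right_mono)
    then have "norm (f w) \<le> L0" using norm_infsum_le[OF hs[OF c] L0] by blast
    then show ?thesis by simp
  qed
  show ?thesis
  proof (rule that[of "max L0 (L0 * (2/\<rho>))" \<epsilon>])
    fix w w' assume "w \<in> ball z \<epsilon>" "w' \<in> ball z \<epsilon>"
    then show "\<bar>f w' - f w\<bar> \<le> max L0 (L0 * (2/\<rho>)) * norm (w' - w)"
      using lip[of w w'] by (meson max.cobounded2 mult_right_mono norm_ge_zero order_trans)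
  qed (use L0nn \<epsilon> bd in \<open>auto intro: le_max_iff_disj[THEN iffD2]\<close>)
qed

text \<open>
  The point whose coordinates in \<open>S\<close> are those of the centre \<open>z\<close> and whose other coordinates are
  those of \<open>w\<close>.
\<close>

definition reset :: "'a::euclidean_space set \<Rightarrow> 'a \<Rightarrow> 'a \<Rightarrow> 'a"
  where "reset S z w = w - (\<Sum>b\<in>S. ((w - z) \<bullet> b) *\<^sub>R b)"

lemma reset_inner:
  assumes "S \<subseteq> Basis" "b \<in> Basis"
  shows "(reset S z w - z) \<bullet> b = (if b \<in> S then 0 else (w - z) \<bullet> b)"
proof -
  have fin: "finite S" using assms finite_Basis finite_subset by blast
  have "(\<Sum>b'\<in>S. ((w - z) \<bullet> b') *\<^sub>R b') \<bullet> b = (\<Sum>b'\<in>S. if b' = b then (w - z) \<bullet> b else 0)"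
    unfolding inner_sum_left using assms by (intro sum.cong) (auto simp: inner_Basis subset_iff)
  also have "\<dots> = (if b \<in> S then (w - z) \<bullet> b else 0)"
    using fin by simp
  finally show ?thesis by (simp add: reset_def inner_diff_left)
qed

lemma reset_in_cube:
  assumes "S \<subseteq> Basis" "w \<in> cube z \<rho>" "\<rho> > 0"
  shows "reset S z w \<in> cube z \<rho>"
  using assms by (auto simp: cube_def reset_inner)

lemma monomial_reset:
  assumes "S \<subseteq> Basis"
  shows "monomial \<alpha> (reset S z w - z) = (if \<forall>b\<in>S. \<alpha> b = 0 then monomial \<alpha> (w - z) else 0)"
proof (cases "\<forall>b\<in>S. \<alpha> b = 0")
  case True
  then show ?thesis unfolding monomial_def using assms
    by (auto intro!: prod.cong simp: reset_inner)
next
  case False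
  then obtain b where b: "b \<in> S" "\<alpha> b \<noteq> 0" by blast
  then have "\<exists>b\<in>Basis. ((reset S z w - z) \<bullet> b) ^ \<alpha> b = 0"
    using assms subsetD[OF assms b(1)] by (intro bexI[of _ b]) (auto simp: reset_inner)
  then show ?thesis using False by (auto simp: monomial_def)
qed

lemma analytic_germ_reset:
  assumes "analytic_germ z f" "S \<subseteq> Basis"
  shows "analytic_germ z (\<lambda>w. f (reset S z w))"
proof -
  obtain \<rho> coef where \<rho>: "\<rho> > 0"
    and sm: "(\<lambda>\<alpha>. \<rho> ^ total_degree \<alpha> * \<bar>coef \<alpha>\<bar>) summable_on multi_indices"
    and hs: "\<And>w. w \<in> cube z \<rho> \<Longrightarrow> ((\<lambda>\<alpha>. monomial \<alpha> (w - z) * coef \<alpha>) has_sum f w) multi_indices"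
    using assms unfolding analytic_germ_def by blast
  define coef' where "coef' \<alpha> = (if \<forall>b\<in>S. \<alpha> b = 0 then coef \<alpha> else 0)" for \<alpha>
  have "(\<lambda>\<alpha>. \<rho> ^ total_degree \<alpha> * \<bar>coef' \<alpha>\<bar>) summable_on multi_indices"
    by (rule summable_on_comparison_test[OF sm]) (use \<rho> in \<open>auto simp: coef'_def\<close>)
  moreover have "((\<lambda>\<alpha>. monomial \<alpha> (w - z) * coef' \<alpha>) has_sum f (reset S z w)) multi_indices"
    if "w \<in> cube z \<rho>" for w
  proof -
    have eq: "monomial \<alpha> (w - z) * coef' \<alpha> = monomial \<alpha> (reset S z w - z) * coef \<alpha>" for \<alpha>
      by (simp add: coef'_def monomial_reset[OF assms(2)])
    show ?thesis unfolding eq by (rule hs[OF reset_in_cube[OF assms(2) that \<rho>]])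
  qed
  ultimately show ?thesis unfolding analytic_germ_def using \<rho> by blast
qed

text \<open>
  The terms of the power series that vanish under \<open>reset\<close> are those containing the chosen
  coordinate; lowering its exponent by one in each of them gives the quotient, and costs a factor
  \<open>1 / \<rho>\<close> in the majorant.
\<close>

lemma analytic_germ_divide:
  assumes "analytic_germ z f" and b: "b \<in> Basis"
  obtains h where "analytic_germ z h"
    "eventually (\<lambda>w. f w = f (reset {b} z w) + ((w - z) \<bullet> b) * h w) (nhds z)"
proof -
  obtain \<rho> coef where \<rho>: "\<rho> > 0"
    and sm: "(\<lambda>\<alpha>. \<rho> ^ total_degree \<alpha> * \<bar>coef \<alpha>\<bar>) summable_on multi_indices"
    and hs: "\<And>w. w \<in> cube z \<rho> \<Longrightarrow> ((\<lambda>\<alpha>. monomial \<alpha> (w - z) * coef \<alpha>) has_sum f w) multi_indices"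
    using assms unfolding analytic_germ_def by blast
  define sh where "sh \<alpha> = \<alpha>(b := Suc (\<alpha> b))" for \<alpha> :: "'a \<Rightarrow> nat"
  define Z where "Z = multi_indices \<inter> {\<alpha>. \<alpha> b = 0}"
  define Pos where "Pos = multi_indices \<inter> {\<alpha> :: 'a \<Rightarrow> nat. \<alpha> b \<noteq> 0}"
  have inj: "inj_on sh multi_indices"
    by (rule inj_onI) (metis sh_def fun_upd_eqD fun_upd_triv fun_upd_upd nat.inject)
  have img: "sh ` multi_indices = Pos"
  proof (intro set_eqI iffI)
    fix \<alpha> assume "\<alpha> \<in> Pos"
    then have "\<alpha> = sh (\<alpha>(b := \<alpha> b - 1))" "\<alpha>(b := \<alpha> b - 1) \<in> multi_indices"
      by (auto simp: sh_def Pos_def multi_indices_def)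
    then show "\<alpha> \<in> sh ` multi_indices" by blast
  qed (use b in \<open>auto simp: sh_def Pos_def multi_indices_def\<close>)
  have deg: "total_degree (sh \<alpha>) = Suc (total_degree \<alpha>)" for \<alpha>
  proof -
    have "total_degree (sh \<alpha>) = (\<Sum>b'\<in>Basis. \<alpha> b' + (if b' = b then 1 else 0))"
      unfolding total_degree_def by (intro sum.cong) (auto simp: sh_def)
    also have "\<dots> = Suc (total_degree \<alpha>)" using b by (simp add: sum.distrib total_degree_def)
    finally show ?thesis .
  qed
  have mon: "monomial (sh \<alpha>) v = (v \<bullet> b) * monomial \<alpha> v" for \<alpha> v
  proof -
    have "monomial (sh \<alpha>) v = (\<Prod>b'\<in>Basis. (if b' = b then v \<bullet> b else 1) * (v \<bullet> b') ^ \<alpha> b')"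
      unfolding monomial_def by (intro prod.cong) (auto simp: sh_def)
    also have "\<dots> = (v \<bullet> b) * monomial \<alpha> v" using b by (simp add: prod.distrib monomial_def)
    finally show ?thesis .
  qed
  define coef' where "coef' = coef \<circ> sh"
  have sm': "(\<lambda>\<alpha>. \<rho> ^ total_degree \<alpha> * \<bar>coef' \<alpha>\<bar>) summable_on multi_indices"
  proof -
    have "(\<lambda>\<alpha>. \<rho> ^ total_degree \<alpha> * \<bar>coef \<alpha>\<bar>) summable_on sh ` multi_indices"
      unfolding img Pos_def by (rule summable_on_subset_banach[OF sm]) auto
    then have "((\<lambda>\<alpha>. \<rho> ^ total_degree \<alpha> * \<bar>coef \<alpha>\<bar>) \<circ> sh) summable_on multi_indices"
      using summable_on_reindex[OF inj] by blast
    then have "(\<lambda>\<alpha>. (1 / \<rho>) * (\<rho> ^ total_degree (sh \<alpha>) * \<bar>coef (sh \<alpha>)\<bar>)) summable_on multi_indices"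
      unfolding o_def by (rule summable_on_cmult_right)
    then show ?thesis using \<rho> by (simp add: deg coef'_def)
  qed
  define h where "h w = (\<Sum>\<^sub>\<infinity>\<alpha>\<in>multi_indices. monomial \<alpha> (w - z) * coef' \<alpha>)" for w
  have hh: "((\<lambda>\<alpha>. monomial \<alpha> (w - z) * coef' \<alpha>) has_sum h w) multi_indices" if "w \<in> cube z \<rho>" for w
    unfolding h_def using monomial_series_summable[OF sm' that] by (rule has_sum_infsum)
  have "analytic_germ z h" unfolding analytic_germ_def using \<rho> sm' hh by blast
  moreover have "f w = f (reset {b} z w) + ((w - z) \<bullet> b) * h w" if w: "w \<in> cube z \<rho>" for w
  proof -
    have r: "reset {b} z w \<in> cube z \<rho>" using reset_in_cube[of "{b}"] w \<rho> b by auto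
    have 1: "((\<lambda>\<alpha>. monomial \<alpha> (w - z) * coef \<alpha>) has_sum f (reset {b} z w)) Z"
    proof -
      have "((\<lambda>\<alpha>. monomial \<alpha> (reset {b} z w - z) * coef \<alpha>) has_sum f (reset {b} z w)) multi_indices"
        using hs[OF r] .
      then show ?thesis
        by (subst has_sum_cong_neutral[where T = multi_indices and
              g = "\<lambda>\<alpha>. monomial \<alpha> (reset {b} z w - z) * coef \<alpha>"])
           (use b in \<open>auto simp: Z_def monomial_reset\<close>)
    qed
    have 2: "((\<lambda>\<alpha>. monomial \<alpha> (w - z) * coef \<alpha>) has_sum ((w - z) \<bullet> b) * h w) Pos"
    proof -
      have "((\<lambda>\<alpha>. ((w - z) \<bullet> b) * (monomial \<alpha> (w - z) * coef' \<alpha>)) has_sum ((w - z) \<bullet> b) * h w) multi_indices"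
        by (rule has_sum_cmult_right[OF hh[OF w]])
      then have "((\<lambda>\<alpha>. monomial \<alpha> (w - z) * coef \<alpha>) \<circ> sh has_sum ((w - z) \<bullet> b) * h w) multi_indices"
        by (simp add: o_def mon coef'_def mult_ac)
      then show ?thesis using has_sum_reindex[OF inj] img by metis
    qed
    have "((\<lambda>\<alpha>. monomial \<alpha> (w - z) * coef \<alpha>) has_sum (f (reset {b} z w) + ((w - z) \<bullet> b) * h w)) (Z \<union> Pos)"
      using 1 2 by (rule has_sum_Un_disjoint) (auto simp: Z_def Pos_def)
    moreover have "Z \<union> Pos = multi_indices" by (auto simp: Z_def Pos_def)
    ultimately show ?thesis using hs[OF w] has_sum_unique by metis
  qed
  ultimately show ?thesis
    using that eventually_mono[OF eventually_cube[OF \<rho>]] by (metis (mono_tags, lifting))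
qed


section \<open>Weighted orders of vanishing\<close>

text \<open>
  Two of the coordinates carry positive weights \<open>p1\<close> and \<open>p2\<close>; the remaining ones have weight
  zero.  In the application these two are \<open>x\<close> and \<open>y\<close>.
\<close>

locale weighted_coordinates =
  fixes z b1 b2 :: "'a::euclidean_space" and p1 p2 :: nat
  assumes b1: "b1 \<in> Basis" and b2: "b2 \<in> Basis" and b12: "b1 \<noteq> b2"
    and p1: "p1 > 0" and p2: "p2 > 0"
begin

definition X :: "'a \<Rightarrow> real" where "X w = (w - z) \<bullet> b1"

definition Y :: "'a \<Rightarrow> real" where "Y w = (w - z) \<bullet> b2"

definition dilate :: "real \<Rightarrow> 'a \<Rightarrow> 'a"
  where "dilate u w = w + ((u ^ p1 - 1) * X w) *\<^sub>R b1 + ((u ^ p2 - 1) * Y w) *\<^sub>R b2"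

lemma dilate_inner:
  assumes "b \<in> Basis"
  shows "(dilate u w - z) \<bullet> b =
    (if b = b1 then u ^ p1 else if b = b2 then u ^ p2 else 1) * ((w - z) \<bullet> b)"
  using assms b1 b2 b12
  by (auto simp: dilate_def X_def Y_def inner_diff_left inner_add_left inner_Basis algebra_simps)

lemma X_dilate: "X (dilate u w) = u ^ p1 * X w"
  using dilate_inner[OF b1] by (simp add: X_def)

lemma Y_dilate: "Y (dilate u w) = u ^ p2 * Y w"
  using dilate_inner[OF b2] b12 by (simp add: Y_def)

lemma eventually_dilate:
  assumes "eventually \<Phi> (nhds z)"
  shows "eventually (\<lambda>w. \<forall>u\<in>{0<..1}. \<Phi> (dilate u w)) (nhds z)"
proof -
  obtain r where r: "r > 0" "\<And>w. dist w z < r \<Longrightarrow> \<Phi> w"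
    using assms unfolding eventually_nhds_metric by blast
  obtain \<rho> where \<rho>: "\<rho> > 0" "cube z \<rho> \<subseteq> ball z r"
    using cube_subset_ball[OF r(1)] .
  show ?thesis
  proof (rule eventually_mono[OF eventually_cube[OF \<rho>(1)]], intro ballI)
    fix w u assume w: "w \<in> cube z \<rho>" and u: "u \<in> {0<..1::real}"
    have "\<bar>(dilate u w - z) \<bullet> b\<bar> \<le> \<rho>" if b: "b \<in> Basis" for b
    proof -
      have "\<bar>(if b = b1 then u ^ p1 else if b = b2 then u ^ p2 else 1)\<bar> * \<bar>(w - z) \<bullet> b\<bar> \<le> 1 * \<bar>(w - z) \<bullet> b\<bar>"
        using u by (intro mult_right_mono) (auto intro: power_le_one)
      then show ?thesis using w b by (fastforce simp: dilate_inner[OF b] cube_def abs_mult)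
    qed
    then have "dilate u w \<in> cube z \<rho>" by (simp add: cube_def)
    then have "dilate u w \<in> ball z r" using \<rho>(2) by blast
    then show "\<Phi> (dilate u w)" using r(2) by (simp add: dist_commute)
  qed
qed

text \<open>
  Combinations of monomials in the two coordinates of weight at least \<open>m\<close>, with germs as
  coefficients.  The subtraction is truncated on purpose: once a single factor exceeds the required
  weight, the cofactor is an arbitrary germ.
\<close>

inductive weighted_ideal :: "nat \<Rightarrow> ('a \<Rightarrow> real) \<Rightarrow> bool" where
  germ: "analytic_germ z f \<Longrightarrow> weighted_ideal 0 f"
| combine: "weighted_ideal (m - p1) g \<Longrightarrow> weighted_ideal (m - p2) h \<Longrightarrow>
    eventually (\<lambda>w. f w = X w * g w + Y w * h w) (nhds z) \<Longrightarrow> weighted_ideal m f"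

definition quasi_homogeneous :: "nat \<Rightarrow> ('a \<Rightarrow> real) \<Rightarrow> bool"
  where "quasi_homogeneous m P \<longleftrightarrow>
    eventually (\<lambda>w. \<forall>u\<in>{0<..1}. P (dilate u w) = u ^ m * P w) (nhds z)"

lemma quasi_homogeneous_times_coordinate:
  assumes "p \<le> m \<Longrightarrow> quasi_homogeneous (m - p) P"
    and "\<And>u w. c (dilate u w) = u ^ p * c w"
  shows "quasi_homogeneous m (\<lambda>w. if p \<le> m then c w * P w else 0)"
proof (cases "p \<le> m")
  case True
  show ?thesis
    using assms(1)[OF True] unfolding quasi_homogeneous_def
  proof (rule eventually_mono, intro ballI)
    fix w u assume "\<forall>u\<in>{0<..1}. P (dilate u w) = u ^ (m - p) * P w" and "u \<in> {0<..1::real}"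
    then have "c (dilate u w) * P (dilate u w) = (u ^ p * u ^ (m - p)) * (c w * P w)"
      using assms(2) by simp
    then show "(if p \<le> m then c (dilate u w) * P (dilate u w) else 0) = u ^ m * (if p \<le> m then c w * P w else 0)"
      using True by (simp add: power_add[symmetric])
  qed
qed (simp add: quasi_homogeneous_def)

text \<open>
  The beginning of the Taylor expansion by weight.  For a germ the leading part is its restriction
  to the set where both coordinates vanish, and the rest is divisible; in general one expands the
  cofactors.
\<close>

lemma weighted_ideal_split:
  assumes "weighted_ideal m f"
  shows "\<exists>P q. eventually (\<lambda>w. f w = P w + q w) (nhds z) \<and> quasi_homogeneous m P \<and>
    weighted_ideal (Suc m) q"
  using assms
proof induction
  case (germ f)
  obtain h1 where h1: "analytic_germ z h1"
    and e1: "eventually (\<lambda>w. f w = f (reset {b1} z w) + X w * h1 w) (nhds z)"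
    by (rule analytic_germ_divide[OF germ b1, folded X_def])
  have g1: "analytic_germ z (\<lambda>w. f (reset {b1} z w))"
    using analytic_germ_reset[OF germ] b1 by simp
  obtain h2 where h2: "analytic_germ z h2"
    and e2: "eventually (\<lambda>w. f (reset {b1} z w) = f (reset {b1} z (reset {b2} z w)) + Y w * h2 w) (nhds z)"
    by (rule analytic_germ_divide[OF g1 b2, folded Y_def])
  have "reset {b1} z (reset {b2} z (dilate u w)) = reset {b1} z (reset {b2} z w)" for u w
  proof -
    have "reset {b1} z (reset {b2} z (dilate u w)) - z = reset {b1} z (reset {b2} z w) - z"
      by (rule euclidean_eqI) (use b1 b2 in \<open>auto simp: reset_inner dilate_inner\<close>)
    then show ?thesis by simp
  qed
  then have "quasi_homogeneous 0 (\<lambda>w. f (reset {b1} z (reset {b2} z w)))"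
    by (simp add: quasi_homogeneous_def)
  moreover have "weighted_ideal (Suc 0) (\<lambda>w. X w * h1 w + Y w * h2 w)"
    by (rule combine[of _ h1 h2]) (use p1 p2 h1 h2 weighted_ideal.germ in \<open>auto simp: Suc_leI\<close>)
  moreover have "eventually (\<lambda>w. f w = f (reset {b1} z (reset {b2} z w)) + (X w * h1 w + Y w * h2 w)) (nhds z)"
    using e1 e2 by eventually_elim simp
  ultimately show ?case
    by (intro exI[of _ "\<lambda>w. f (reset {b1} z (reset {b2} z w))"] exI[of _ "\<lambda>w. X w * h1 w + Y w * h2 w"]) simp
next
  case (combine m g h f)
  obtain Pg qg where g: "eventually (\<lambda>w. g w = Pg w + qg w) (nhds z)"
    "quasi_homogeneous (m - p1) Pg" "weighted_ideal (Suc (m - p1)) qg"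
    using combine.IH(1) by blast
  obtain Ph qh where h: "eventually (\<lambda>w. h w = Ph w + qh w) (nhds z)"
    "quasi_homogeneous (m - p2) Ph" "weighted_ideal (Suc (m - p2)) qh"
    using combine.IH(2) by blast
  define g' where "g' = (if p1 \<le> m then qg else g)"
  define h' where "h' = (if p2 \<le> m then qh else h)"
  define P1 where "P1 w = (if p1 \<le> m then X w * Pg w else 0)" for w
  define P2 where "P2 w = (if p2 \<le> m then Y w * Ph w else 0)" for w
  have "quasi_homogeneous m P1" "quasi_homogeneous m P2"
    unfolding P1_def[abs_def] P2_def[abs_def]
    using g(2) h(2) X_dilate Y_dilate by (auto intro: quasi_homogeneous_times_coordinate)
  then have "quasi_homogeneous m (\<lambda>w. P1 w + P2 w)"
    unfolding quasi_homogeneous_def by eventually_elim (simp add: distrib_left)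
  moreover have "weighted_ideal (Suc m) (\<lambda>w. X w * g' w + Y w * h' w)"
  proof (rule weighted_ideal.combine[of _ g' h'])
    show "weighted_ideal (Suc m - p1) g'"
      using g(3) combine.hyps(1) by (auto simp: g'_def Suc_diff_le not_le Suc_leI)
    show "weighted_ideal (Suc m - p2) h'"
      using h(3) combine.hyps(2) by (auto simp: h'_def Suc_diff_le not_le Suc_leI)
  qed simp
  moreover have "eventually (\<lambda>w. f w = (P1 w + P2 w) + (X w * g' w + Y w * h' w)) (nhds z)"
    using combine.hyps(3) g(1) h(1)
    by eventually_elim (auto simp: P1_def P2_def g'_def h'_def algebra_simps)
  ultimately show ?case
    by (intro exI[of _ "\<lambda>w. P1 w + P2 w"] exI[of _ "\<lambda>w. X w * g' w + Y w * h' w"]) simp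
qed

lemma power_diff_mult_le:
  fixes u :: real
  assumes "0 < u" "u \<le> 1"
  shows "u ^ p * u ^ (m - p) \<le> u ^ m"
  using assms by (subst power_add[symmetric], intro power_decreasing) auto

lemma weighted_ideal_dilate_bound:
  assumes "weighted_ideal m f"
  shows "eventually (\<lambda>w. \<exists>C. eventually (\<lambda>u. \<bar>f (dilate u w)\<bar> \<le> C * u ^ m) (at_right 0)) (nhds z)"
  using assms
proof induction
  case (germ f)
  obtain L \<epsilon> where L: "\<epsilon> > 0" "\<And>w. w \<in> ball z \<epsilon> \<Longrightarrow> \<bar>f w\<bar> \<le> L"
    by (rule analytic_germ_lipschitz[OF germ], rule that)
  have "eventually (\<lambda>w. \<bar>f w\<bar> \<le> L) (nhds z)"
    unfolding eventually_nhds_metric using L by (auto simp: dist_commute)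
  from eventually_dilate[OF this] show ?case
  proof (rule eventually_mono)
    fix w assume "\<forall>u\<in>{0<..1}. \<bar>f (dilate u w)\<bar> \<le> L"
    then have "eventually (\<lambda>u. \<bar>f (dilate u w)\<bar> \<le> L * u ^ 0) (at_right 0)"
      unfolding eventually_at_right_field by (intro exI[of _ 1]) auto
    then show "\<exists>C. eventually (\<lambda>u. \<bar>f (dilate u w)\<bar> \<le> C * u ^ 0) (at_right 0)" by blast
  qed
next
  case (combine m g h f)
  from eventually_dilate[OF combine.hyps(3)] combine.IH show ?case
  proof eventually_elim
    case (elim w)
    then obtain C1 C2 where C: "eventually (\<lambda>u. \<bar>g (dilate u w)\<bar> \<le> C1 * u ^ (m - p1)) (at_right 0)"
      "eventually (\<lambda>u. \<bar>h (dilate u w)\<bar> \<le> C2 * u ^ (m - p2)) (at_right 0)" by blast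
    have u01: "eventually (\<lambda>u::real. u \<in> {0<..1}) (at_right 0)"
      unfolding eventually_at_right_field by (intro exI[of _ 1]) auto
    have "eventually (\<lambda>u. \<bar>f (dilate u w)\<bar> \<le> (\<bar>X w\<bar> * \<bar>C1\<bar> + \<bar>Y w\<bar> * \<bar>C2\<bar>) * u ^ m) (at_right 0)"
      using C u01
    proof eventually_elim
      case (elim u)
      have f: "f (dilate u w) = u ^ p1 * X w * g (dilate u w) + u ^ p2 * Y w * h (dilate u w)"
        using \<open>\<forall>u\<in>{0<..1}. _\<close> elim(3) by (simp add: X_dilate Y_dilate)
      have *: "\<bar>u ^ p * c * k\<bar> \<le> \<bar>c\<bar> * \<bar>C\<bar> * u ^ m" if "\<bar>k\<bar> \<le> C * u ^ (m - p)" for p c k C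
      proof -
        have "\<bar>k\<bar> \<le> \<bar>C\<bar> * u ^ (m - p)"
          using that elim(3) by (smt (verit) greaterThanAtMost_iff mult_right_mono zero_le_power)
        then have "u ^ p * \<bar>c\<bar> * \<bar>k\<bar> \<le> u ^ p * \<bar>c\<bar> * (\<bar>C\<bar> * u ^ (m - p))"
          using elim(3) by (intro mult_left_mono) auto
        also have "\<dots> = \<bar>c\<bar> * \<bar>C\<bar> * (u ^ p * u ^ (m - p))" by simp
        also have "\<dots> \<le> \<bar>c\<bar> * \<bar>C\<bar> * u ^ m"
          using elim(3) by (intro mult_left_mono power_diff_mult_le) auto
        finally show ?thesis using elim(3) by (simp add: abs_mult)
      qed
      show ?case unfolding f distrib_right
        using *[OF elim(1), of "X w"] *[OF elim(2), of "Y w"] by linarith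
    qed
    then show ?case by blast
  qed
qed

text \<open>
  Along a dilation orbit the leading part is exactly a multiple of \<open>u ^ m\<close>, so it must vanish if
  the function is smaller than that.
\<close>

lemma weighted_ideal_raise:
  assumes f: "weighted_ideal m f"
    and bd: "eventually (\<lambda>w. \<exists>C. eventually (\<lambda>u. \<bar>f (dilate u w)\<bar> \<le> C * u ^ Suc m) (at_right 0)) (nhds z)"
  shows "weighted_ideal (Suc m) f"
proof -
  obtain P q where Pq: "eventually (\<lambda>w. f w = P w + q w) (nhds z)" "quasi_homogeneous m P"
    and q: "weighted_ideal (Suc m) q"
    using weighted_ideal_split[OF f] by blast
  have "eventually (\<lambda>w. P w = 0) (nhds z)"
    using Pq(2)[unfolded quasi_homogeneous_def] bd weighted_ideal_dilate_bound[OF q]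
      eventually_dilate[OF Pq(1)]
  proof eventually_elim
    case (elim w)
    from elim(2,3) obtain C1 C2 where C: "eventually (\<lambda>u. \<bar>f (dilate u w)\<bar> \<le> C1 * u ^ Suc m) (at_right 0)"
      "eventually (\<lambda>u. \<bar>q (dilate u w)\<bar> \<le> C2 * u ^ Suc m) (at_right 0)" by blast
    have u01: "eventually (\<lambda>u::real. u \<in> {0<..1}) (at_right 0)"
      unfolding eventually_at_right_field by (intro exI[of _ 1]) auto
    have "eventually (\<lambda>u. \<bar>P w\<bar> \<le> (C1 + C2) * u) (at_right 0)"
      using C u01
    proof eventually_elim
      case (elim u)
      have "u ^ m * P w = f (dilate u w) - q (dilate u w)"
        using \<open>\<forall>u\<in>{0<..1}. P (dilate u w) = _\<close> \<open>\<forall>u\<in>{0<..1}. f (dilate u w) = _\<close> elim(3)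
        by simp
      then have "\<bar>u ^ m * P w\<bar> \<le> C1 * u ^ Suc m + C2 * u ^ Suc m"
        using elim(1,2) by linarith
      then have "u ^ m * \<bar>P w\<bar> \<le> u ^ m * ((C1 + C2) * u)"
        using elim(3) by (simp add: abs_mult algebra_simps)
      then show ?case using elim(3) by simp
    qed
    moreover have "((\<lambda>u. (C1 + C2) * u) \<longlongrightarrow> (C1 + C2) * 0) (at_right 0)"
      by (intro tendsto_intros)
    ultimately have "\<bar>P w\<bar> \<le> (C1 + C2) * 0"
      by (intro tendsto_le[OF _ _ tendsto_const]) auto
    then show ?case by simp
  qed
  with Pq(1) have eq: "eventually (\<lambda>w. f w = q w) (nhds z)"
    by eventually_elim simp
  from q show ?thesis
  proof cases
    case (combine g h)
    have "eventually (\<lambda>w. f w = X w * g w + Y w * h w) (nhds z)"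
      using eq combine(3) by eventually_elim simp
    then show ?thesis using weighted_ideal.combine combine(1,2) by blast
  qed
qed

text \<open>
  This is how a bound on the size of an analytic function becomes information on its structure, and
  thereby on its Lipschitz constants.
\<close>

lemma weighted_ideal_order:
  assumes f: "analytic_germ z f"
    and bd: "eventually (\<lambda>w. \<exists>C. eventually (\<lambda>u. \<bar>f (dilate u w)\<bar> \<le> C * u ^ m) (at_right 0)) (nhds z)"
  shows "weighted_ideal m f"
proof -
  have "weighted_ideal i f" if "i \<le> m" for i
    using that
  proof (induction i)
    case (Suc i)
    have "eventually (\<lambda>w. \<exists>C. eventually (\<lambda>u. \<bar>f (dilate u w)\<bar> \<le> C * u ^ Suc i) (at_right 0)) (nhds z)"
      using bd
    proof (rule eventually_mono)
      fix w assume "\<exists>C. eventually (\<lambda>u. \<bar>f (dilate u w)\<bar> \<le> C * u ^ m) (at_right 0)"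
      then obtain C where C: "eventually (\<lambda>u. \<bar>f (dilate u w)\<bar> \<le> C * u ^ m) (at_right 0)" by blast
      have u01: "eventually (\<lambda>u::real. u \<in> {0<..1}) (at_right 0)"
        unfolding eventually_at_right_field by (intro exI[of _ 1]) auto
      have "eventually (\<lambda>u. \<bar>f (dilate u w)\<bar> \<le> \<bar>C\<bar> * u ^ Suc i) (at_right 0)"
        using C u01
      proof eventually_elim
        case (elim u)
        have "C * u ^ m \<le> \<bar>C\<bar> * u ^ Suc i"
          using elim Suc.prems by (intro mult_mono power_decreasing) auto
        then show ?case using elim by linarith
      qed
      then show "\<exists>C. eventually (\<lambda>u. \<bar>f (dilate u w)\<bar> \<le> C * u ^ Suc i) (at_right 0)" by blast
    qed
    then show ?case using Suc by (intro weighted_ideal_raise) auto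
  qed (use f germ in auto)
  then show ?thesis by simp
qed

text \<open>
  Germs are Lipschitz, and a coordinate of weight \<open>p\<close> contributes the factor \<open>u ^ p\<close>, either through
  its size or through its difference.
\<close>

lemma weighted_ideal_lipschitz:
  assumes "weighted_ideal m f" and M: "M \<ge> 0"
  shows "\<exists>\<epsilon>>0. \<exists>C\<ge>0. \<forall>u w w' D.
      0 < u \<and> u < \<epsilon> \<and> w \<in> ball z \<epsilon> \<and> w' \<in> ball z \<epsilon> \<and>
      \<bar>X w\<bar> \<le> M * u ^ p1 \<and> \<bar>X w'\<bar> \<le> M * u ^ p1 \<and> \<bar>X w' - X w\<bar> \<le> u ^ p1 * D \<and>
      \<bar>Y w\<bar> \<le> M * u ^ p2 \<and> \<bar>Y w'\<bar> \<le> M * u ^ p2 \<and> \<bar>Y w' - Y w\<bar> \<le> u ^ p2 * D \<and>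
      norm (w' - w) \<le> M * D \<longrightarrow>
      \<bar>f w\<bar> \<le> C * u ^ m \<and> \<bar>f w'\<bar> \<le> C * u ^ m \<and> \<bar>f w' - f w\<bar> \<le> C * u ^ m * D"
  using assms(1)
proof induction
  case (germ f)
  obtain L \<epsilon> where L: "L \<ge> 0" "\<epsilon> > 0"
    "\<And>w w'. w \<in> ball z \<epsilon> \<Longrightarrow> w' \<in> ball z \<epsilon> \<Longrightarrow> \<bar>f w' - f w\<bar> \<le> L * norm (w' - w)"
    "\<And>w. w \<in> ball z \<epsilon> \<Longrightarrow> \<bar>f w\<bar> \<le> L"
    by (rule analytic_germ_lipschitz[OF germ], rule that)
  have C: "L \<le> L + L * M" using L(1) M by simp
  have "\<bar>f w' - f w\<bar> \<le> (L + L * M) * D"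
    if "w \<in> ball z \<epsilon>" "w' \<in> ball z \<epsilon>" "norm (w' - w) \<le> M * D" "0 \<le> D" for w w' D
  proof -
    have "\<bar>f w' - f w\<bar> \<le> L * norm (w' - w)" using L(3) that by blast
    also have "\<dots> \<le> L * (M * D)" using L(1) that by (intro mult_left_mono) auto
    also have "\<dots> \<le> (L + L * M) * D" using L(1) that by (simp add: algebra_simps)
    finally show ?thesis .
  qed
  note lip = this
  have nonneg: "L + L * M \<ge> 0" using L(1) M by simp
  show ?case
  proof (rule exI[of _ \<epsilon>], rule conjI[OF L(2)], rule exI[of _ "L + L * M"], rule conjI[OF nonneg],
      intro conjI allI impI)
    fix u w w' D
    assume H: "0 < u \<and> u < \<epsilon> \<and> w \<in> ball z \<epsilon> \<and> w' \<in> ball z \<epsilon> \<and>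
      \<bar>X w\<bar> \<le> M * u ^ p1 \<and> \<bar>X w'\<bar> \<le> M * u ^ p1 \<and> \<bar>X w' - X w\<bar> \<le> u ^ p1 * D \<and>
      \<bar>Y w\<bar> \<le> M * u ^ p2 \<and> \<bar>Y w'\<bar> \<le> M * u ^ p2 \<and> \<bar>Y w' - Y w\<bar> \<le> u ^ p2 * D \<and>
      norm (w' - w) \<le> M * D"
    then have "D \<ge> 0" by (smt (verit) zero_less_power zero_le_mult_iff)
    then show "\<bar>f w' - f w\<bar> \<le> (L + L * M) * u ^ 0 * D" using lip H by simp
    have "\<bar>f w\<bar> \<le> L" "\<bar>f w'\<bar> \<le> L" using L(4) H by blast+
    then show "\<bar>f w\<bar> \<le> (L + L * M) * u ^ 0" "\<bar>f w'\<bar> \<le> (L + L * M) * u ^ 0" using C by auto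
  qed
next
  case (combine m g h f)
  obtain \<epsilon>1 C1 where \<epsilon>1: "\<epsilon>1 > 0" "C1 \<ge> 0" and g: "\<And>u w w' D.
      0 < u \<and> u < \<epsilon>1 \<and> w \<in> ball z \<epsilon>1 \<and> w' \<in> ball z \<epsilon>1 \<and>
      \<bar>X w\<bar> \<le> M * u ^ p1 \<and> \<bar>X w'\<bar> \<le> M * u ^ p1 \<and> \<bar>X w' - X w\<bar> \<le> u ^ p1 * D \<and>
      \<bar>Y w\<bar> \<le> M * u ^ p2 \<and> \<bar>Y w'\<bar> \<le> M * u ^ p2 \<and> \<bar>Y w' - Y w\<bar> \<le> u ^ p2 * D \<and>
      norm (w' - w) \<le> M * D \<Longrightarrow>
      \<bar>g w\<bar> \<le> C1 * u ^ (m - p1) \<and> \<bar>g w'\<bar> \<le> C1 * u ^ (m - p1) \<and> \<bar>g w' - g w\<bar> \<le> C1 * u ^ (m - p1) * D"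
    using combine.IH(1) by blast
  obtain \<epsilon>2 C2 where \<epsilon>2: "\<epsilon>2 > 0" "C2 \<ge> 0" and h: "\<And>u w w' D.
      0 < u \<and> u < \<epsilon>2 \<and> w \<in> ball z \<epsilon>2 \<and> w' \<in> ball z \<epsilon>2 \<and>
      \<bar>X w\<bar> \<le> M * u ^ p1 \<and> \<bar>X w'\<bar> \<le> M * u ^ p1 \<and> \<bar>X w' - X w\<bar> \<le> u ^ p1 * D \<and>
      \<bar>Y w\<bar> \<le> M * u ^ p2 \<and> \<bar>Y w'\<bar> \<le> M * u ^ p2 \<and> \<bar>Y w' - Y w\<bar> \<le> u ^ p2 * D \<and>
      norm (w' - w) \<le> M * D \<Longrightarrow>
      \<bar>h w\<bar> \<le> C2 * u ^ (m - p2) \<and> \<bar>h w'\<bar> \<le> C2 * u ^ (m - p2) \<and> \<bar>h w' - h w\<bar> \<le> C2 * u ^ (m - p2) * D"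
    using combine.IH(2) by blast
  obtain \<epsilon>3 where \<epsilon>3: "\<epsilon>3 > 0" "\<And>w. w \<in> ball z \<epsilon>3 \<Longrightarrow> f w = X w * g w + Y w * h w"
    using combine.hyps(3) unfolding eventually_nhds_metric by (metis mem_ball dist_commute)
  define \<epsilon> where "\<epsilon> = min (min \<epsilon>1 \<epsilon>2) (min \<epsilon>3 1)"
  define C where "C = (1 + M) * (C1 + C2)"
  have prod: "\<bar>c * e\<bar> \<le> (1 + M) * K * u ^ m \<and> \<bar>c' * e'\<bar> \<le> (1 + M) * K * u ^ m \<and>
      \<bar>c' * e' - c * e\<bar> \<le> (1 + M) * K * u ^ m * D"
    if u: "0 < u" "u \<le> 1" and K: "K \<ge> 0" and D: "D \<ge> 0"
      and c: "\<bar>c\<bar> \<le> M * u ^ p" "\<bar>c'\<bar> \<le> M * u ^ p" "\<bar>c' - c\<bar> \<le> u ^ p * D"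
      and e: "\<bar>e\<bar> \<le> K * u ^ (m - p)" "\<bar>e'\<bar> \<le> K * u ^ (m - p)" "\<bar>e' - e\<bar> \<le> K * u ^ (m - p) * D"
    for u K D c c' e e' :: real and p
  proof -
    note le = power_diff_mult_le[OF u, of p m]
    have 1: "\<bar>x * y\<bar> \<le> (1 + M) * K * u ^ m" if "\<bar>x\<bar> \<le> M * u ^ p" "\<bar>y\<bar> \<le> K * u ^ (m - p)" for x y
    proof -
      have "\<bar>x\<bar> * \<bar>y\<bar> \<le> (M * u ^ p) * (K * u ^ (m - p))"
        using that M u by (intro mult_mono) auto
      also have "\<dots> = (M * K) * (u ^ p * u ^ (m - p))" by simp
      also have "\<dots> \<le> (M * K) * u ^ m" using le M K by (intro mult_left_mono) auto
      also have "\<dots> \<le> (1 + M) * K * u ^ m" using K u by (simp add: distrib_right)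
      finally show ?thesis by (simp add: abs_mult)
    qed
    have "c' * e' - c * e = (c' - c) * e' + c * (e' - e)" by (simp add: algebra_simps)
    then have "\<bar>c' * e' - c * e\<bar> \<le> \<bar>c' - c\<bar> * \<bar>e'\<bar> + \<bar>c\<bar> * \<bar>e' - e\<bar>"
      by (metis abs_mult abs_triangle_ineq)
    also have "\<dots> \<le> (u ^ p * D) * (K * u ^ (m - p)) + (M * u ^ p) * (K * u ^ (m - p) * D)"
      using c e u D M by (intro add_mono mult_mono) auto
    also have "\<dots> = ((1 + M) * K * D) * (u ^ p * u ^ (m - p))" by (simp add: algebra_simps)
    also have "\<dots> \<le> ((1 + M) * K * D) * u ^ m" using le M K D by (intro mult_left_mono) auto
    finally have "\<bar>c' * e' - c * e\<bar> \<le> (1 + M) * K * u ^ m * D" by (simp add: mult_ac)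
    then show ?thesis using 1 c e by blast
  qed
  have pos: "\<epsilon> > 0" and nonneg: "C \<ge> 0" using \<epsilon>1 \<epsilon>2 \<epsilon>3 M by (auto simp: \<epsilon>_def C_def)
  show ?case
  proof (rule exI[of _ \<epsilon>], rule conjI[OF pos], rule exI[of _ C], rule conjI[OF nonneg],
      intro conjI allI impI)
    fix u w w' D
    assume H: "0 < u \<and> u < \<epsilon> \<and> w \<in> ball z \<epsilon> \<and> w' \<in> ball z \<epsilon> \<and>
      \<bar>X w\<bar> \<le> M * u ^ p1 \<and> \<bar>X w'\<bar> \<le> M * u ^ p1 \<and> \<bar>X w' - X w\<bar> \<le> u ^ p1 * D \<and>
      \<bar>Y w\<bar> \<le> M * u ^ p2 \<and> \<bar>Y w'\<bar> \<le> M * u ^ p2 \<and> \<bar>Y w' - Y w\<bar> \<le> u ^ p2 * D \<and>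
      norm (w' - w) \<le> M * D"
    then have D: "D \<ge> 0" by (smt (verit) zero_less_power zero_le_mult_iff)
    have H1: "0 < u" "u \<le> 1" using H by (auto simp: \<epsilon>_def)
    have G: "\<bar>g w\<bar> \<le> C1 * u ^ (m - p1) \<and> \<bar>g w'\<bar> \<le> C1 * u ^ (m - p1) \<and> \<bar>g w' - g w\<bar> \<le> C1 * u ^ (m - p1) * D"
      using H by (intro g) (auto simp: \<epsilon>_def)
    have Hh: "\<bar>h w\<bar> \<le> C2 * u ^ (m - p2) \<and> \<bar>h w'\<bar> \<le> C2 * u ^ (m - p2) \<and> \<bar>h w' - h w\<bar> \<le> C2 * u ^ (m - p2) * D"
      using H by (intro h) (auto simp: \<epsilon>_def)
    have f: "f w = X w * g w + Y w * h w" "f w' = X w' * g w' + Y w' * h w'"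
      using H by (auto intro!: \<epsilon>3(2) simp: \<epsilon>_def)
    have 1: "\<bar>X w * g w\<bar> \<le> (1 + M) * C1 * u ^ m \<and> \<bar>X w' * g w'\<bar> \<le> (1 + M) * C1 * u ^ m \<and>
      \<bar>X w' * g w' - X w * g w\<bar> \<le> (1 + M) * C1 * u ^ m * D"
      by (rule prod[where p = p1]) (use H H1 D G \<epsilon>1 in auto)
    have 2: "\<bar>Y w * h w\<bar> \<le> (1 + M) * C2 * u ^ m \<and> \<bar>Y w' * h w'\<bar> \<le> (1 + M) * C2 * u ^ m \<and>
      \<bar>Y w' * h w' - Y w * h w\<bar> \<le> (1 + M) * C2 * u ^ m * D"
      by (rule prod[where p = p2]) (use H H1 D Hh \<epsilon>2 in auto)
    have C: "C * v = (1 + M) * C1 * v + (1 + M) * C2 * v" for v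
      by (simp add: C_def algebra_simps)
    show "\<bar>f w\<bar> \<le> C * u ^ m" "\<bar>f w'\<bar> \<le> C * u ^ m" "\<bar>f w' - f w\<bar> \<le> C * u ^ m * D"
      using 1 2 unfolding f C distrib_right mult.assoc by linarith+
  qed
qed

end


section \<open>Lipschitz estimates at the scale of a stable manifold\<close>

text \<open>
  Two points at the scale of a stable manifold with parameter \<open>u\<close>: \<open>D\<close> bounds their distance
  after \<open>x\<close> is divided by \<open>u\<^sup>2\<close> and \<open>y\<close> by \<open>u ^ q\<close>.  The exponent will be \<open>q = k + 1\<close>.
\<close>

definition weighted_close ::
    "nat \<Rightarrow> real \<Rightarrow> real \<Rightarrow> real \<Rightarrow> real \<Rightarrow> real \<Rightarrow> 'v::real_normed_vector \<Rightarrow> real \<Rightarrow> real \<Rightarrow> 'v \<Rightarrow> bool"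
  where "weighted_close q M u D x y t x' y' t' \<longleftrightarrow>
    \<bar>x\<bar> \<le> M * u\<^sup>2 \<and> \<bar>x'\<bar> \<le> M * u\<^sup>2 \<and> \<bar>x' - x\<bar> \<le> u\<^sup>2 * D \<and>
    \<bar>y\<bar> \<le> M * u ^ q \<and> \<bar>y'\<bar> \<le> M * u ^ q \<and> \<bar>y' - y\<bar> \<le> u ^ q * D \<and> norm (t' - t) \<le> D"

definition weighted_lipschitz_on ::
    "nat \<Rightarrow> nat \<Rightarrow> (real \<Rightarrow> real \<Rightarrow> 'v::real_normed_vector \<Rightarrow> real) \<Rightarrow> 'v set \<Rightarrow> real \<Rightarrow> bool"
  where "weighted_lipschitz_on q m f T M \<longleftrightarrow>
    (\<exists>\<epsilon>>0. \<exists>C\<ge>0. \<forall>u x y t x' y' t' D. 0 < u \<longrightarrow> u < \<epsilon> \<longrightarrow> t \<in> T \<longrightarrow> t' \<in> T \<longrightarrow>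
      weighted_close q M u D x y t x' y' t' \<longrightarrow>
      \<bar>f x y t\<bar> \<le> C * u ^ m \<and> \<bar>f x' y' t' - f x y t\<bar> \<le> C * u ^ m * D)"

definition weighted_lipschitz ::
    "nat \<Rightarrow> nat \<Rightarrow> (real \<Rightarrow> real \<Rightarrow> 'v::real_normed_vector \<Rightarrow> real) \<Rightarrow> bool"
  where "weighted_lipschitz q m f \<longleftrightarrow> (\<forall>M\<ge>0. weighted_lipschitz_on q m f UNIV M)"

lemma weighted_close_nonneg:
  "weighted_close q M u D x y t x' y' t' \<Longrightarrow> 0 \<le> D"
  unfolding weighted_close_def using norm_ge_zero order_trans by blast

lemma weighted_lipschitz_onE:
  assumes "weighted_lipschitz_on q m f T M"
  obtains \<epsilon> C where "\<epsilon> > 0" "C \<ge> 0"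
    "\<And>u x y t x' y' t' D. 0 < u \<Longrightarrow> u < \<epsilon> \<Longrightarrow> t \<in> T \<Longrightarrow> t' \<in> T \<Longrightarrow>
      weighted_close q M u D x y t x' y' t' \<Longrightarrow>
      \<bar>f x y t\<bar> \<le> C * u ^ m \<and> \<bar>f x' y' t' - f x y t\<bar> \<le> C * u ^ m * D"
proof -
  from assms[unfolded weighted_lipschitz_on_def] obtain \<epsilon> C where "\<epsilon> > 0" "C \<ge> 0" and
    *: "\<forall>u x y t x' y' t' D. 0 < u \<longrightarrow> u < \<epsilon> \<longrightarrow> t \<in> T \<longrightarrow> t' \<in> T \<longrightarrow>
      weighted_close q M u D x y t x' y' t' \<longrightarrow>
      \<bar>f x y t\<bar> \<le> C * u ^ m \<and> \<bar>f x' y' t' - f x y t\<bar> \<le> C * u ^ m * D"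
    by (elim exE conjE) (rule that)
  then show ?thesis by (intro that[of \<epsilon> C]) (assumption | rule *[rule_format])+
qed

lemma weighted_lipschitzE:
  assumes "weighted_lipschitz q m f" "M \<ge> 0"
  obtains \<epsilon> C where "\<epsilon> > 0" "C \<ge> 0"
    "\<And>u x y t x' y' t' D. 0 < u \<Longrightarrow> u < \<epsilon> \<Longrightarrow> weighted_close q M u D x y t x' y' t' \<Longrightarrow>
      \<bar>f x y t\<bar> \<le> C * u ^ m \<and> \<bar>f x' y' t' - f x y t\<bar> \<le> C * u ^ m * D"
  by (rule weighted_lipschitz_onE[OF assms(1)[unfolded weighted_lipschitz_def, rule_format, OF assms(2)]])
     (rule that, auto)

lemma weighted_lipschitz_onI:
  assumes "\<epsilon> > 0" "C \<ge> 0"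
    and "\<And>u x y t x' y' t' D. 0 < u \<Longrightarrow> u < \<epsilon> \<Longrightarrow> t \<in> T \<Longrightarrow> t' \<in> T \<Longrightarrow>
      weighted_close q M u D x y t x' y' t' \<Longrightarrow>
      \<bar>f x y t\<bar> \<le> C * u ^ m \<and> \<bar>f x' y' t' - f x y t\<bar> \<le> C * u ^ m * D"
  shows "weighted_lipschitz_on q m f T M"
  unfolding weighted_lipschitz_on_def
  by (rule exI[of _ \<epsilon>], rule conjI[OF assms(1)], rule exI[of _ C], rule conjI[OF assms(2)],
      intro allI impI, rule assms(3))

lemma torus_proj_add: "torus_proj (s + t) = torus_proj s + torus_proj t"
  by transfer simp

lemma torus_proj_eq_iff: "torus_proj s = torus_proj t \<longleftrightarrow> (\<forall>i. s $ i - t $ i \<in> \<int>)"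
  by transfer simp

lemma torus_proj_surj: obtains t where "\<theta> = torus_proj t"
proof -
  have "\<exists>t. \<theta> = torus_proj t"
    by transfer (metis Ints_0 cancel_comm_monoid_add_class.diff_cancel)
  then show ?thesis using that by blast
qed

lemma torus_fundamental_domain:
  fixes t :: "real ^ 'd"
  obtains s where "t + s \<in> cbox 0 One" "\<And>t'. torus_proj (t' + s) = torus_proj t'"
proof
  let ?s = "(\<chi> i. - of_int \<lfloor>t $ i\<rfloor>) :: real ^ 'd"
  show "t + ?s \<in> cbox 0 One"
    unfolding mem_box
  proof
    fix b :: "real ^ 'd" assume b: "b \<in> Basis"
    then obtain i where i: "b = axis i 1" by (auto simp: Basis_vec_def)
    have "One \<bullet> b = 1" using b by simp
    moreover have "(t + ?s) \<bullet> b = t $ i - of_int \<lfloor>t $ i\<rfloor>" by (simp add: i inner_axis)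
    ultimately show "0 \<bullet> b \<le> (t + ?s) \<bullet> b \<and> (t + ?s) \<bullet> b \<le> One \<bullet> b" by simp linarith
  qed
  show "torus_proj (t' + ?s) = torus_proj t'" for t' by (simp add: torus_proj_eq_iff)
qed

text \<open>
  For periodic functions the constants can be made uniform in the angle by compactness of a
  fundamental domain.  Local estimates only compare nearby angles; for angles at a distance of at
  least \<open>l\<close> one has \<open>D \<ge> l\<close>, and the estimate follows from the bound on the size.
\<close>

lemma weighted_lipschitz_periodic:
  fixes f :: "real \<Rightarrow> real \<Rightarrow> ('d::finite) torus \<Rightarrow> real"
  assumes "\<And>M t0. M \<ge> 0 \<Longrightarrow> \<exists>r>0. weighted_lipschitz_on q m (\<lambda>x y t. f x y (torus_proj t)) (ball t0 r) M"
  shows "weighted_lipschitz q m (\<lambda>x y t. f x y (torus_proj t))"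
  unfolding weighted_lipschitz_def
proof (intro allI impI)
  fix M :: real assume M: "M \<ge> 0"
  define Q where "Q = (cbox 0 One :: (real ^ 'd) set)"
  let ?F = "\<lambda>x y t. f x y (torus_proj t)"
  from assms[OF M] obtain r where r: "\<And>t0. r t0 > 0"
    "\<And>t0. weighted_lipschitz_on q m ?F (ball t0 (r t0)) M" by metis
  have "\<exists>\<epsilon> C. \<epsilon> > 0 \<and> C \<ge> 0 \<and> (\<forall>u x y t x' y' t' D. 0 < u \<longrightarrow> u < \<epsilon> \<longrightarrow>
      t \<in> ball t0 (r t0) \<longrightarrow> t' \<in> ball t0 (r t0) \<longrightarrow>
      weighted_close q M u D x y t x' y' t' \<longrightarrow>
      \<bar>?F x y t\<bar> \<le> C * u ^ m \<and> \<bar>?F x' y' t' - ?F x y t\<bar> \<le> C * u ^ m * D)" for t0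
    using r(2)[of t0] unfolding weighted_lipschitz_on_def by blast
  then obtain \<epsilon> C where \<epsilon>: "\<And>t0. \<epsilon> t0 > 0" and C: "\<And>t0. C t0 \<ge> 0"
    and L: "\<And>t0 u x y t x' y' t' D. 0 < u \<Longrightarrow> u < \<epsilon> t0 \<Longrightarrow>
      t \<in> ball t0 (r t0) \<Longrightarrow> t' \<in> ball t0 (r t0) \<Longrightarrow>
      weighted_close q M u D x y t x' y' t' \<Longrightarrow>
      \<bar>?F x y t\<bar> \<le> C t0 * u ^ m \<and> \<bar>?F x' y' t' - ?F x y t\<bar> \<le> C t0 * u ^ m * D"
    by metis
  have "compact Q" by (simp add: Q_def)
  moreover have "Q \<subseteq> (\<Union>t0\<in>Q. ball t0 (r t0 / 2))" using r(1) by force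
  ultimately obtain N where N: "N \<subseteq> Q" "finite N" "Q \<subseteq> (\<Union>t0\<in>N. ball t0 (r t0 / 2))"
    using compactE_image[of Q Q "\<lambda>t0. ball t0 (r t0 / 2)"] by auto
  have N0: "N \<noteq> {}" using N(3) torus_fundamental_domain[of 0] unfolding Q_def by blast
  define C' where "C' = (\<Sum>t0\<in>N. C t0)"
  define l where "l = Min ((\<lambda>t0. r t0 / 2) ` N)"
  define e where "e = Min (\<epsilon> ` N)"
  have l: "l > 0" "\<And>t0. t0 \<in> N \<Longrightarrow> l \<le> r t0 / 2"
    unfolding l_def using N N0 r(1) by (simp add: Min_gr_iff, intro Min_le finite_imageI imageI)
  have e: "e > 0" "\<And>t0. t0 \<in> N \<Longrightarrow> e \<le> \<epsilon> t0"
    unfolding e_def using N N0 \<epsilon> by (simp_all add: Min_gr_iff)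
  have C': "C' \<ge> 0" "\<And>t0. t0 \<in> N \<Longrightarrow> C t0 \<le> C'"
    unfolding C'_def using N C by (auto intro: sum_nonneg member_le_sum)
  show "weighted_lipschitz_on q m ?F UNIV M"
  proof (rule weighted_lipschitz_onI[of e "C' + 2 * C' / l"])
    fix u x y t x' y' t' D
    assume u: "0 < u" "u < e" and cl: "weighted_close q M u D x y t x' y' (t' :: real ^ 'd)"
    note D = weighted_close_nonneg[OF cl]
    have near: "\<bar>?F x y t\<bar> \<le> C' * u ^ m \<and> (norm (t' - t) < l \<longrightarrow> \<bar>?F x' y' t' - ?F x y t\<bar> \<le> C' * u ^ m * D)"
      if cl: "weighted_close q M u D x y t x' y' t'" for x y t x' y' t' D
    proof -
      obtain s where s: "t + s \<in> cbox 0 One" "\<And>t'. torus_proj (t' + s) = torus_proj t'"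
        by (rule torus_fundamental_domain[of t], rule that)
      obtain t0 where t0: "t0 \<in> N" "t + s \<in> ball t0 (r t0 / 2)" using s(1) N(3) unfolding Q_def by blast
      have in1: "t + s \<in> ball t0 (r t0)" using t0 r(1)[of t0] by simp
      have le: "C t0 * u ^ m \<le> C' * u ^ m" using C'(2)[OF t0(1)] u by (intro mult_right_mono) auto
      have u': "u < \<epsilon> t0" using u e(2)[OF t0(1)] by simp
      have "weighted_close q M u 0 x y (t + s) x y (t + s)" using cl by (simp add: weighted_close_def)
      then have 1: "\<bar>?F x y (t + s)\<bar> \<le> C t0 * u ^ m"
        using L[OF u(1) u' in1 in1] by blast
      have 2: "\<bar>?F x' y' (t' + s) - ?F x y (t + s)\<bar> \<le> C t0 * u ^ m * D" if "norm (t' - t) < l"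
      proof -
        have "dist t0 (t' + s) \<le> dist t0 (t + s) + dist (t + s) (t' + s)" by (rule dist_triangle)
        also have "dist (t + s) (t' + s) = norm (t' - t)" by (simp add: dist_norm norm_minus_commute)
        finally have in2: "t' + s \<in> ball t0 (r t0)" using that t0 l(2)[OF t0(1)] by simp
        have "weighted_close q M u D x y (t + s) x' y' (t' + s)" using cl by (simp add: weighted_close_def)
        then show ?thesis using L[OF u(1) u' in1 in2] by blast
      qed
      have "C t0 * u ^ m * D \<le> C' * u ^ m * D" using le weighted_close_nonneg[OF cl] by (rule mult_right_mono)
      then show ?thesis using 1 2 le unfolding s(2) by (meson order_trans)
    qed
    have cl': "weighted_close q M u 0 x' y' t' x' y' t'" using cl by (simp add: weighted_close_def)
    have K: "C' * u ^ m \<le> (C' + 2 * C' / l) * u ^ m" using C' l u by (intro mult_right_mono) auto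
    have "\<bar>?F x' y' t' - ?F x y t\<bar> \<le> (C' + 2 * C' / l) * u ^ m * D"
    proof (cases "norm (t' - t) < l")
      case True
      then have "\<bar>?F x' y' t' - ?F x y t\<bar> \<le> C' * u ^ m * D" using near[OF cl] by blast
      also have "\<dots> \<le> (C' + 2 * C' / l) * u ^ m * D" using K D by (rule mult_right_mono)
      finally show ?thesis .
    next
      case False
      then have "1 \<le> D / l" using cl l by (simp add: weighted_close_def)
      have "\<bar>?F x' y' t' - ?F x y t\<bar> \<le> 2 * C' * u ^ m * 1"
        using near[OF cl] near[OF cl'] by linarith
      also have "\<dots> \<le> 2 * C' * u ^ m * (D / l)"
        using \<open>1 \<le> D / l\<close> C' u by (intro mult_left_mono) auto
      also have "\<dots> \<le> (C' + 2 * C' / l) * u ^ m * D"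
        using C' u D by (simp add: distrib_right)
      finally show ?thesis .
    qed
    then show "\<bar>?F x y t\<bar> \<le> (C' + 2 * C' / l) * u ^ m \<and> \<bar>?F x' y' t' - ?F x y t\<bar> \<le> (C' + 2 * C' / l) * u ^ m * D"
      using near[OF cl] K by linarith
  qed (use e C' l in auto)
qed

lemma weighted_lipschitz_mult:
  assumes "weighted_lipschitz q m f" "weighted_lipschitz q n g"
  shows "weighted_lipschitz q (m + n) (\<lambda>x y t. f x y t * g x y t)"
  unfolding weighted_lipschitz_def
proof (intro allI impI)
  fix M :: real assume M: "M \<ge> 0"
  obtain e1 C1 where 1: "e1 > 0" "C1 \<ge> 0" and f: "\<And>u x y t x' y' t' D. 0 < u \<Longrightarrow> u < e1 \<Longrightarrow>
      weighted_close q M u D x y t x' y' t' \<Longrightarrow>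
      \<bar>f x y t\<bar> \<le> C1 * u ^ m \<and> \<bar>f x' y' t' - f x y t\<bar> \<le> C1 * u ^ m * D"
    by (rule weighted_lipschitzE[OF assms(1) M], rule that)
  obtain e2 C2 where 2: "e2 > 0" "C2 \<ge> 0" and g: "\<And>u x y t x' y' t' D. 0 < u \<Longrightarrow> u < e2 \<Longrightarrow>
      weighted_close q M u D x y t x' y' t' \<Longrightarrow>
      \<bar>g x y t\<bar> \<le> C2 * u ^ n \<and> \<bar>g x' y' t' - g x y t\<bar> \<le> C2 * u ^ n * D"
    by (rule weighted_lipschitzE[OF assms(2) M], rule that)
  show "weighted_lipschitz_on q (m + n) (\<lambda>x y t. f x y t * g x y t) UNIV M"
  proof (rule weighted_lipschitz_onI[of "min e1 e2" "2 * C1 * C2"])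
    fix u x y t x' y' t' D
    assume u: "0 < u" "u < min e1 e2" and cl: "weighted_close q M u D x y t x' y' (t' :: 'a)"
    note D = weighted_close_nonneg[OF cl]
    have cl': "weighted_close q M u 0 x' y' t' x' y' t'" using cl by (simp add: weighted_close_def)
    have f1: "\<bar>f x y t\<bar> \<le> C1 * u ^ m" "\<bar>f x' y' t' - f x y t\<bar> \<le> C1 * u ^ m * D"
      using f[OF u(1) _ cl] u by auto
    have g1: "\<bar>g x y t\<bar> \<le> C2 * u ^ n" "\<bar>g x' y' t' - g x y t\<bar> \<le> C2 * u ^ n * D"
      using g[OF u(1) _ cl] u by auto
    have g2: "\<bar>g x' y' t'\<bar> \<le> C2 * u ^ n" using g[OF u(1) _ cl'] u by auto
    have a: "\<bar>f x y t * g x y t\<bar> \<le> (C1 * u ^ m) * (C2 * u ^ n)"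
      unfolding abs_mult using f1 g1 u 1 2 by (intro mult_mono) auto
    also have "\<dots> \<le> 2 * C1 * C2 * u ^ (m + n)" using 1 2 u by (simp add: power_add)
    finally have A: "\<bar>f x y t * g x y t\<bar> \<le> 2 * C1 * C2 * u ^ (m + n)" .
    have "f x' y' t' * g x' y' t' - f x y t * g x y t
        = (f x' y' t' - f x y t) * g x' y' t' + f x y t * (g x' y' t' - g x y t)"
      by (simp add: algebra_simps)
    then have "\<bar>f x' y' t' * g x' y' t' - f x y t * g x y t\<bar>
        \<le> \<bar>f x' y' t' - f x y t\<bar> * \<bar>g x' y' t'\<bar> + \<bar>f x y t\<bar> * \<bar>g x' y' t' - g x y t\<bar>"
      by (metis abs_mult abs_triangle_ineq)
    also have "\<dots> \<le> (C1 * u ^ m * D) * (C2 * u ^ n) + (C1 * u ^ m) * (C2 * u ^ n * D)"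
      using f1 g1 g2 u 1 2 D by (intro add_mono mult_mono) auto
    also have "\<dots> = 2 * C1 * C2 * u ^ (m + n) * D" by (simp add: power_add)
    finally show "\<bar>f x y t * g x y t\<bar> \<le> 2 * C1 * C2 * u ^ (m + n) \<and>
        \<bar>f x' y' t' * g x' y' t' - f x y t * g x y t\<bar> \<le> 2 * C1 * C2 * u ^ (m + n) * D"
      using A by blast
  qed (use 1 2 in auto)
qed

lemma weighted_lipschitz_add:
  assumes "weighted_lipschitz q m f" "weighted_lipschitz q m g"
  shows "weighted_lipschitz q m (\<lambda>x y t. f x y t + g x y t)"
  unfolding weighted_lipschitz_def
proof (intro allI impI)
  fix M :: real assume M: "M \<ge> 0"
  obtain e1 C1 where 1: "e1 > 0" "C1 \<ge> 0" and f: "\<And>u x y t x' y' t' D. 0 < u \<Longrightarrow> u < e1 \<Longrightarrow>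
      weighted_close q M u D x y t x' y' t' \<Longrightarrow>
      \<bar>f x y t\<bar> \<le> C1 * u ^ m \<and> \<bar>f x' y' t' - f x y t\<bar> \<le> C1 * u ^ m * D"
    by (rule weighted_lipschitzE[OF assms(1) M], rule that)
  obtain e2 C2 where 2: "e2 > 0" "C2 \<ge> 0" and g: "\<And>u x y t x' y' t' D. 0 < u \<Longrightarrow> u < e2 \<Longrightarrow>
      weighted_close q M u D x y t x' y' t' \<Longrightarrow>
      \<bar>g x y t\<bar> \<le> C2 * u ^ m \<and> \<bar>g x' y' t' - g x y t\<bar> \<le> C2 * u ^ m * D"
    by (rule weighted_lipschitzE[OF assms(2) M], rule that)
  show "weighted_lipschitz_on q m (\<lambda>x y t. f x y t + g x y t) UNIV M"
  proof (rule weighted_lipschitz_onI[of "min e1 e2" "C1 + C2"])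
    fix u x y t x' y' t' D
    assume u: "0 < u" "u < min e1 e2" and cl: "weighted_close q M u D x y t x' y' (t' :: 'a)"
    show "\<bar>f x y t + g x y t\<bar> \<le> (C1 + C2) * u ^ m \<and>
        \<bar>f x' y' t' + g x' y' t' - (f x y t + g x y t)\<bar> \<le> (C1 + C2) * u ^ m * D"
      using f[OF u(1) _ cl] g[OF u(1) _ cl] u unfolding distrib_right by auto
  qed (use 1 2 in auto)
qed

lemma weighted_lipschitz_lower:
  assumes "weighted_lipschitz q m f" "n \<le> m"
  shows "weighted_lipschitz q n f"
  unfolding weighted_lipschitz_def
proof (intro allI impI)
  fix M :: real assume M: "M \<ge> 0"
  obtain e C where e: "e > 0" "C \<ge> 0" and f: "\<And>u x y t x' y' t' D. 0 < u \<Longrightarrow> u < e \<Longrightarrow>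
      weighted_close q M u D x y t x' y' t' \<Longrightarrow>
      \<bar>f x y t\<bar> \<le> C * u ^ m \<and> \<bar>f x' y' t' - f x y t\<bar> \<le> C * u ^ m * D"
    by (rule weighted_lipschitzE[OF assms(1) M], rule that)
  show "weighted_lipschitz_on q n f UNIV M"
  proof (rule weighted_lipschitz_onI[of "min e 1" C])
    fix u x y t x' y' t' D
    assume u: "0 < u" "u < min e 1" and cl: "weighted_close q M u D x y t x' y' (t' :: 'a)"
    have le: "C * u ^ m \<le> C * u ^ n" using u e assms(2) by (intro mult_left_mono power_decreasing) auto
    have "C * u ^ m * D \<le> C * u ^ n * D" using le weighted_close_nonneg[OF cl] by (rule mult_right_mono)
    then show "\<bar>f x y t\<bar> \<le> C * u ^ n \<and> \<bar>f x' y' t' - f x y t\<bar> \<le> C * u ^ n * D"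
      using f[OF u(1) _ cl] u le by (meson min_less_iff_conj order_trans)
  qed (use e in auto)
qed

lemma weighted_lipschitz_power_x: "weighted_lipschitz q (2 * p) (\<lambda>x y (t :: 'a::real_normed_vector). x ^ p)"
proof (induction p)
  case 0
  show ?case
    unfolding weighted_lipschitz_def
    by (intro allI impI, rule weighted_lipschitz_onI[of 1 1]) (auto dest: weighted_close_nonneg)
next
  case (Suc p)
  have "weighted_lipschitz q 2 (\<lambda>x y (t :: 'a). x)"
    unfolding weighted_lipschitz_def
  proof (intro allI impI)
    fix M :: real assume M: "M \<ge> 0"
    show "weighted_lipschitz_on q 2 (\<lambda>x y (t :: 'a). x) UNIV M"
    proof (rule weighted_lipschitz_onI[of 1 "M + 1"])
      fix u x y t x' y' t' D
      assume cl: "weighted_close q M u D x y t x' y' (t' :: 'a)"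
      have "0 \<le> M * (u\<^sup>2 * D)" using weighted_close_nonneg[OF cl] M by simp
      then show "\<bar>x\<bar> \<le> (M + 1) * u\<^sup>2 \<and> \<bar>x' - x\<bar> \<le> (M + 1) * u\<^sup>2 * D"
        using cl by (auto simp: weighted_close_def algebra_simps add_increasing)
    qed (use M in auto)
  qed
  from weighted_lipschitz_mult[OF this Suc] show ?case by simp
qed

lemma weighted_lipschitz_angle:
  fixes c :: "('d::finite) torus \<Rightarrow> real ^ 'm \<Rightarrow> 'b::real_normed_vector"
  assumes c: "real_analytic_on (\<lambda>(t, \<mu>). c (torus_proj t) \<mu>) (UNIV \<times> \<Lambda>)"
    and \<mu>: "\<mu> \<in> \<Lambda>" and l: "bounded_linear l"
  shows "weighted_lipschitz q 0 (\<lambda>x y t. l (c (torus_proj t) \<mu>))"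
proof (rule weighted_lipschitz_periodic)
  fix M :: real and t0 :: "real ^ 'd" assume "M \<ge> 0"
  have "(t0, \<mu>) \<in> UNIV \<times> \<Lambda>" using \<mu> by simp
  from real_analytic_on_germ[OF c this l] obtain g where g: "analytic_germ (t0, \<mu>) g"
    and cg: "eventually (\<lambda>w. w \<in> UNIV \<times> \<Lambda> \<longrightarrow> l ((\<lambda>(t, \<mu>). c (torus_proj t) \<mu>) w) = g w) (nhds (t0, \<mu>))"
    by blast
  obtain L \<epsilon> where L: "L \<ge> 0" "\<epsilon> > 0"
    "\<And>w w'. w \<in> ball (t0, \<mu>) \<epsilon> \<Longrightarrow> w' \<in> ball (t0, \<mu>) \<epsilon> \<Longrightarrow> \<bar>g w' - g w\<bar> \<le> L * norm (w' - w)"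
    "\<And>w. w \<in> ball (t0, \<mu>) \<epsilon> \<Longrightarrow> \<bar>g w\<bar> \<le> L"
    by (rule analytic_germ_lipschitz[OF g], rule that)
  obtain \<epsilon>' where \<epsilon>': "\<epsilon>' > 0" "\<And>w. dist w (t0, \<mu>) < \<epsilon>' \<Longrightarrow> w \<in> UNIV \<times> \<Lambda> \<longrightarrow> l ((\<lambda>(t, \<mu>). c (torus_proj t) \<mu>) w) = g w"
    using cg unfolding eventually_nhds_metric by blast
  have eq: "l (c (torus_proj t) \<mu>) = g (t, \<mu>)" if "t \<in> ball t0 (min \<epsilon> \<epsilon>')" for t
    using \<epsilon>'(2)[of "(t, \<mu>)"] \<mu> that by (auto simp: dist_Pair_Pair dist_commute)
  have "weighted_lipschitz_on q 0 (\<lambda>x y t. l (c (torus_proj t) \<mu>)) (ball t0 (min \<epsilon> \<epsilon>')) M"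
  proof (rule weighted_lipschitz_onI[of 1 L])
    fix u x y t x' y' t' D
    assume t: "t \<in> ball t0 (min \<epsilon> \<epsilon>')" "t' \<in> ball t0 (min \<epsilon> \<epsilon>')"
      and cl: "weighted_close q M u D x y t x' y' t'"
    have b: "(t, \<mu>) \<in> ball (t0, \<mu>) \<epsilon>" "(t', \<mu>) \<in> ball (t0, \<mu>) \<epsilon>" using t by (auto simp: dist_Pair_Pair)
    have "\<bar>g (t', \<mu>) - g (t, \<mu>)\<bar> \<le> L * norm ((t', \<mu>) - (t, \<mu>))" using L(3) b by blast
    also have "\<dots> \<le> L * D" using cl L(1) by (intro mult_left_mono) (auto simp: weighted_close_def norm_Pair)
    finally show "\<bar>l (c (torus_proj t) \<mu>)\<bar> \<le> L * u ^ 0 \<and>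
        \<bar>l (c (torus_proj t') \<mu>) - l (c (torus_proj t) \<mu>)\<bar> \<le> L * u ^ 0 * D"
      using eq t L(4)[OF b(1)] by simp
  qed (use L in auto)
  then show "\<exists>r>0. weighted_lipschitz_on q 0 (\<lambda>x y t. l (c (torus_proj t) \<mu>)) (ball t0 r) M"
    using L(2) \<epsilon>'(1) by (intro exI[of _ "min \<epsilon> \<epsilon>'"]) auto
qed

lemma mixed_bigo_dilate:
  assumes f: "mixed_bigo f a b" and q: "q \<ge> 2" and m: "m \<le> q + 2 * a" "m \<le> 2 * b"
  shows "\<exists>C. eventually (\<lambda>u. norm (f (u\<^sup>2 * x) (u ^ q * y) \<theta>) \<le> C * u ^ m) (at_right 0)"
proof -
  obtain f1 f2 C where bg: "eventually (\<lambda>(x, y). \<forall>\<theta>. f x y \<theta> = y *\<^sub>R f1 x y \<theta> + f2 x y \<theta> \<and>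
          norm (f1 x y \<theta>) \<le> C * norm (x, y) ^ a \<and> norm (f2 x y \<theta>) \<le> C * norm (x, y) ^ b) (nhds (0, 0))"
    using f unfolding mixed_bigo_def by blast
  have "((\<lambda>u. (u\<^sup>2 * x, u ^ q * y)) \<longlongrightarrow> (0\<^sup>2 * x, 0 ^ q * y)) (at_right 0)"
    by (intro tendsto_intros)
  then have lim: "filterlim (\<lambda>u. (u\<^sup>2 * x, u ^ q * y)) (nhds (0, 0)) (at_right 0)"
    using q by (simp add: zero_power)
  have ev: "eventually (\<lambda>u. f (u\<^sup>2 * x) (u ^ q * y) \<theta>
        = (u ^ q * y) *\<^sub>R f1 (u\<^sup>2 * x) (u ^ q * y) \<theta> + f2 (u\<^sup>2 * x) (u ^ q * y) \<theta> \<and>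
      norm (f1 (u\<^sup>2 * x) (u ^ q * y) \<theta>) \<le> C * norm (u\<^sup>2 * x, u ^ q * y) ^ a \<and>
      norm (f2 (u\<^sup>2 * x) (u ^ q * y) \<theta>) \<le> C * norm (u\<^sup>2 * x, u ^ q * y) ^ b) (at_right 0)"
    using eventually_compose_filterlim[OF bg lim] by (rule eventually_mono) simp
  define s where "s = \<bar>x\<bar> + \<bar>y\<bar>"
  have u01: "eventually (\<lambda>u::real. u \<in> {0<..1}) (at_right 0)"
    unfolding eventually_at_right_field by (intro exI[of _ 1]) auto
  have "eventually (\<lambda>u. norm (f (u\<^sup>2 * x) (u ^ q * y) \<theta>) \<le> (\<bar>y\<bar> * \<bar>C\<bar> * s ^ a + \<bar>C\<bar> * s ^ b) * u ^ m) (at_right 0)"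
    using ev u01
  proof eventually_elim
    case (elim u)
    let ?f1 = "f1 (u\<^sup>2 * x) (u ^ q * y) \<theta>" and ?f2 = "f2 (u\<^sup>2 * x) (u ^ q * y) \<theta>"
    let ?r = "norm (u\<^sup>2 * x, u ^ q * y)"
    have u: "0 < u" "u \<le> 1" using elim by auto
    have "?r \<le> \<bar>u\<^sup>2 * x\<bar> + \<bar>u ^ q * y\<bar>" using norm_Pair_le[of "u\<^sup>2 * x" "u ^ q * y"] by simp
    also have "\<dots> \<le> u\<^sup>2 * \<bar>x\<bar> + u\<^sup>2 * \<bar>y\<bar>"
      unfolding abs_mult using u q by (intro add_mono mult_right_mono) (auto intro: power_decreasing)
    finally have r: "?r \<le> u\<^sup>2 * s" by (simp add: s_def distrib_left)
    have pw: "C * ?r ^ n \<le> \<bar>C\<bar> * (u ^ (2 * n) * s ^ n)" for n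
    proof -
      have "C * ?r ^ n \<le> \<bar>C\<bar> * (u\<^sup>2 * s) ^ n" using r by (intro mult_mono power_mono) auto
      then show ?thesis by (simp add: power_mult_distrib power_mult)
    qed
    have s: "s \<ge> 0" by (simp add: s_def)
    have "norm (f (u\<^sup>2 * x) (u ^ q * y) \<theta>) \<le> norm ((u ^ q * y) *\<^sub>R ?f1) + norm ?f2"
      using elim norm_triangle_ineq by metis
    also have "\<dots> = u ^ q * \<bar>y\<bar> * norm ?f1 + norm ?f2" using u by (simp add: abs_mult)
    also have "\<dots> \<le> u ^ q * \<bar>y\<bar> * (\<bar>C\<bar> * (u ^ (2 * a) * s ^ a)) + \<bar>C\<bar> * (u ^ (2 * b) * s ^ b)"
      using elim pw[of a] pw[of b] u by (intro add_mono mult_left_mono) auto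
    also have "\<dots> = (\<bar>y\<bar> * \<bar>C\<bar> * s ^ a) * u ^ (q + 2 * a) + (\<bar>C\<bar> * s ^ b) * u ^ (2 * b)"
      by (simp add: power_add algebra_simps)
    also have "\<dots> \<le> (\<bar>y\<bar> * \<bar>C\<bar> * s ^ a) * u ^ m + (\<bar>C\<bar> * s ^ b) * u ^ m"
      using u m s by (intro add_mono mult_left_mono power_decreasing) auto
    finally show ?case by (simp add: distrib_right)
  qed
  then show ?thesis by blast
qed

text \<open>
  The order condition determines the weighted order of the power series at each point of the torus,
  hence the Lipschitz estimate near that point.
\<close>

lemma weighted_lipschitz_mixed_bigo:
  fixes A :: "real \<Rightarrow> real \<Rightarrow> ('d::finite) torus \<Rightarrow> real ^ ('m::finite) \<Rightarrow> 'b::real_normed_vector"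
  assumes U: "(0, 0) \<in> interior U" and \<mu>: "\<mu> \<in> \<Lambda>"
    and A: "real_analytic_on (\<lambda>((x, y), t, \<mu>). A x y (torus_proj t) \<mu>) (U \<times> UNIV \<times> \<Lambda>)"
    and l: "bounded_linear l"
    and bigo: "mixed_bigo (\<lambda>x y \<theta>. A x y \<theta> \<mu>) a b"
    and q: "q \<ge> 2" and m: "m \<le> q + 2 * a" "m \<le> 2 * b"
  shows "weighted_lipschitz q m (\<lambda>x y t. l (A x y (torus_proj t) \<mu>))"
proof (rule weighted_lipschitz_periodic)
  fix M :: real and t0 :: "real ^ 'd" assume M: "M \<ge> 0"
  let ?f = "\<lambda>x y t. l (A x y (torus_proj t) \<mu>)"
  define z where "z = ((0::real, 0::real), t0, \<mu>)"
  have "z \<in> U \<times> UNIV \<times> \<Lambda>" using U \<mu> interior_subset by (auto simp: z_def)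
  from real_analytic_on_germ[OF A this l] obtain g where g: "analytic_germ z g"
    and Ag: "eventually (\<lambda>w. w \<in> U \<times> UNIV \<times> \<Lambda> \<longrightarrow>
      l ((\<lambda>((x, y), t, \<mu>). A x y (torus_proj t) \<mu>) w) = g w) (nhds z)"
    by blast
  \<comment> \<open>The order condition holds at the given parameter value only, so the dependence on the parameter is frozen.\<close>
  define S where "S = (\<lambda>b. (0 :: real \<times> real, 0 :: real ^ 'd, b :: real ^ 'm)) ` Basis"
  have S: "S \<subseteq> Basis" by (auto simp: S_def Basis_prod_def)
  define g' where "g' w = g (reset S z w)" for w
  have g': "analytic_germ z g'" unfolding g'_def using analytic_germ_reset[OF g S] .
  have reset: "reset S z w = (fst w, fst (snd w), \<mu>)" for w
  proof -
    have "reset S z w - z = (fst w, fst (snd w), \<mu>) - z"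
    proof (rule euclidean_eqI)
      fix i :: "(real \<times> real) \<times> (real ^ 'd) \<times> (real ^ 'm)" assume i: "i \<in> Basis"
      have "((fst w, fst (snd w), \<mu>) - z) \<bullet> i = (if i \<in> S then 0 else (w - z) \<bullet> i)"
        using i by (auto simp: S_def Basis_prod_def z_def inner_prod_def zero_prod_def)
      then show "(reset S z w - z) \<bullet> i = ((fst w, fst (snd w), \<mu>) - z) \<bullet> i"
        by (simp add: reset_inner[OF S i])
    qed
    then show ?thesis by simp
  qed
  have "((\<lambda>w. (fst w, fst (snd w), \<mu>)) \<longlongrightarrow> (fst z, fst (snd z), \<mu>)) (nhds z)"
    by (intro tendsto_intros) (auto simp: filterlim_ident)
  then have lim: "filterlim (\<lambda>w. (fst w, fst (snd w), \<mu>)) (nhds z) (nhds z)" by (simp add: z_def)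
  have "eventually (\<lambda>v. v \<in> interior U) (nhds (0, 0))"
    using U by (intro eventually_nhds_in_open) auto
  moreover have "filterlim fst (nhds (0, 0)) (nhds z)"
    using tendsto_fst[OF filterlim_ident[of "nhds z"]] by (simp add: z_def)
  ultimately have inU: "eventually (\<lambda>w. fst w \<in> interior U) (nhds z)"
    using eventually_compose_filterlim by blast
  have g'_eq: "eventually (\<lambda>w. g' w = ?f (fst (fst w)) (snd (fst w)) (fst (snd w))) (nhds z)"
    using eventually_compose_filterlim[OF Ag lim] inU
  proof eventually_elim
    case (elim w)
    then have "(fst w, fst (snd w), \<mu>) \<in> U \<times> UNIV \<times> \<Lambda>" using interior_subset \<mu> by auto
    then show ?case using elim(1) by (simp add: g'_def reset case_prod_unfold)
  qed
  interpret weighted_coordinates z "((1, 0), 0, 0)" "((0, 1), 0, 0)" 2 q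
    by standard (use q in \<open>auto simp: Basis_prod_def zero_prod_def\<close>)
  have X: "X w = fst (fst w)" and Y: "Y w = snd (fst w)" for w
    unfolding X_def Y_def by (simp_all add: z_def inner_prod_def)
  have dil: "dilate u w = ((u\<^sup>2 * fst (fst w), u ^ q * snd (fst w)), snd w)" for u w
    by (simp add: dilate_def X Y prod_eq_iff algebra_simps)
  have "weighted_ideal m g'"
  proof (rule weighted_ideal_order[OF g'], rule eventually_mono[OF eventually_dilate[OF g'_eq]])
    fix w assume w: "\<forall>u\<in>{0<..1}. g' (dilate u w) =
      ?f (fst (fst (dilate u w))) (snd (fst (dilate u w))) (fst (snd (dilate u w)))"
    obtain C where C: "eventually (\<lambda>u. norm (A (u\<^sup>2 * fst (fst w)) (u ^ q * snd (fst w)) (torus_proj (fst (snd w))) \<mu>)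
        \<le> C * u ^ m) (at_right 0)"
      using mixed_bigo_dilate[OF bigo q m, of "fst (fst w)" "snd (fst w)" "torus_proj (fst (snd w))"] by blast
    obtain K where K: "K > 0" "\<And>v. norm (l v) \<le> norm v * K" using bounded_linear.pos_bounded[OF l] by blast
    have u01: "eventually (\<lambda>u::real. u \<in> {0<..1}) (at_right 0)"
      unfolding eventually_at_right_field by (intro exI[of _ 1]) auto
    have "eventually (\<lambda>u. \<bar>g' (dilate u w)\<bar> \<le> C * K * u ^ m) (at_right 0)"
      using C u01
    proof eventually_elim
      case (elim u)
      have "\<bar>g' (dilate u w)\<bar> \<le> norm (A (u\<^sup>2 * fst (fst w)) (u ^ q * snd (fst w)) (torus_proj (fst (snd w))) \<mu>) * K"
        using w elim(2) K(2) by (simp add: dil)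
      also have "\<dots> \<le> C * u ^ m * K" using elim(1) K(1) by (intro mult_right_mono) auto
      finally show ?case by (simp add: mult_ac)
    qed
    then show "\<exists>C. eventually (\<lambda>u. \<bar>g' (dilate u w)\<bar> \<le> C * u ^ m) (at_right 0)" by blast
  qed
  from weighted_ideal_lipschitz[OF this, of "M + 3"] M
  obtain \<epsilon>1 where \<epsilon>1: "\<epsilon>1 > 0" and "\<exists>C\<ge>0. \<forall>u w w' D.
      0 < u \<and> u < \<epsilon>1 \<and> w \<in> ball z \<epsilon>1 \<and> w' \<in> ball z \<epsilon>1 \<and>
      \<bar>X w\<bar> \<le> (M + 3) * u ^ 2 \<and> \<bar>X w'\<bar> \<le> (M + 3) * u ^ 2 \<and> \<bar>X w' - X w\<bar> \<le> u ^ 2 * D \<and>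
      \<bar>Y w\<bar> \<le> (M + 3) * u ^ q \<and> \<bar>Y w'\<bar> \<le> (M + 3) * u ^ q \<and> \<bar>Y w' - Y w\<bar> \<le> u ^ q * D \<and>
      norm (w' - w) \<le> (M + 3) * D \<longrightarrow>
      \<bar>g' w\<bar> \<le> C * u ^ m \<and> \<bar>g' w'\<bar> \<le> C * u ^ m \<and> \<bar>g' w' - g' w\<bar> \<le> C * u ^ m * D"
    by auto
  then obtain C where C: "C \<ge> 0" and lip: "\<And>u w w' D.
      0 < u \<and> u < \<epsilon>1 \<and> w \<in> ball z \<epsilon>1 \<and> w' \<in> ball z \<epsilon>1 \<and>
      \<bar>X w\<bar> \<le> (M + 3) * u ^ 2 \<and> \<bar>X w'\<bar> \<le> (M + 3) * u ^ 2 \<and> \<bar>X w' - X w\<bar> \<le> u ^ 2 * D \<and>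
      \<bar>Y w\<bar> \<le> (M + 3) * u ^ q \<and> \<bar>Y w'\<bar> \<le> (M + 3) * u ^ q \<and> \<bar>Y w' - Y w\<bar> \<le> u ^ q * D \<and>
      norm (w' - w) \<le> (M + 3) * D \<Longrightarrow>
      \<bar>g' w\<bar> \<le> C * u ^ m \<and> \<bar>g' w'\<bar> \<le> C * u ^ m \<and> \<bar>g' w' - g' w\<bar> \<le> C * u ^ m * D"
    by meson
  obtain \<epsilon>2 where \<epsilon>2: "\<epsilon>2 > 0" "\<And>w. w \<in> ball z \<epsilon>2 \<Longrightarrow> g' w = ?f (fst (fst w)) (snd (fst w)) (fst (snd w))"
    using g'_eq unfolding eventually_nhds_metric by (metis mem_ball dist_commute)
  define e where "e = min 1 (min \<epsilon>1 \<epsilon>2 / (2 * M + 2))"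
  have e: "e > 0" "e \<le> 1" "(2 * M + 1) * e < min \<epsilon>1 \<epsilon>2" "e \<le> \<epsilon>1"
  proof -
    show "e > 0" "e \<le> 1" using \<epsilon>1 \<epsilon>2 M by (auto simp: e_def)
    have "(2 * M + 2) * e \<le> min \<epsilon>1 \<epsilon>2"
    proof -
      have "e \<le> min \<epsilon>1 \<epsilon>2 / (2 * M + 2)" by (simp add: e_def)
      then show ?thesis using M by (simp add: pos_le_divide_eq mult.commute)
    qed
    then show "(2 * M + 1) * e < min \<epsilon>1 \<epsilon>2" using \<open>e > 0\<close> by (simp add: algebra_simps)
    moreover have "e \<le> (2 * M + 1) * e" using M \<open>e > 0\<close> by (simp add: distrib_right)
    ultimately show "e \<le> \<epsilon>1" by simp
  qed
  have "weighted_lipschitz_on q m ?f (ball t0 e) M"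
  proof (rule weighted_lipschitz_onI[OF e(1) C])
    fix u x y t x' y' t' D
    assume u: "0 < u" "u < e" and t: "t \<in> ball t0 e" "t' \<in> ball t0 e"
      and cl: "weighted_close q M u D x y t x' y' t'"
    note D = weighted_close_nonneg[OF cl]
    have u1: "u\<^sup>2 \<le> u" "u ^ q \<le> u" "u\<^sup>2 \<le> 1" "u ^ q \<le> 1"
      using u e q power_decreasing[of 1 2 u] power_decreasing[of 1 q u] by (auto intro: power_le_one)
    have small: "((x, y), t, \<mu>) \<in> ball z (min \<epsilon>1 \<epsilon>2)"
      if "\<bar>x\<bar> \<le> M * u\<^sup>2" "\<bar>y\<bar> \<le> M * u ^ q" "t \<in> ball t0 e" for x y t
    proof -
      have "norm (((x, y), t, \<mu>) - z) \<le> norm (x, y) + norm (t - t0, 0 :: real ^ 'm)"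
        using norm_Pair_le[of "(x, y)" "(t - t0, 0 :: real ^ 'm)"] by (simp add: z_def)
      also have "\<dots> \<le> (\<bar>x\<bar> + \<bar>y\<bar>) + norm (t - t0)"
        using norm_Pair_le[of x y] by (simp add: norm_Pair)
      also have "\<dots> \<le> (M * e + M * e) + norm (t - t0)"
        using that u u1 M mult_left_mono[of "u\<^sup>2" e M] mult_left_mono[of "u ^ q" e M] by fastforce
      also have "\<dots> < (2 * M + 1) * e" using that by (simp add: dist_norm norm_minus_commute algebra_simps)
      finally show ?thesis using e(3) by (simp add: dist_norm norm_minus_commute)
    qed
    let ?w = "((x, y), t, \<mu>)" and ?w' = "((x', y'), t', \<mu>)"
    have w: "?w \<in> ball z (min \<epsilon>1 \<epsilon>2)" "?w' \<in> ball z (min \<epsilon>1 \<epsilon>2)"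
      using cl t small by (auto simp: weighted_close_def)
    have "norm (?w' - ?w) \<le> norm (x' - x, y' - y) + norm (t' - t, 0 :: real ^ 'm)"
      using norm_Pair_le[of "(x' - x, y' - y)" "(t' - t, 0 :: real ^ 'm)"] by simp
    also have "\<dots> \<le> (\<bar>x' - x\<bar> + \<bar>y' - y\<bar>) + norm (t' - t)"
      using norm_Pair_le[of "x' - x" "y' - y"] by (simp add: norm_Pair)
    also have "\<dots> \<le> (u\<^sup>2 * D + u ^ q * D) + D" using cl by (simp add: weighted_close_def)
    also have "\<dots> \<le> (D + D) + D"
      using u1 D mult_right_mono[of "u\<^sup>2" 1 D] mult_right_mono[of "u ^ q" 1 D] by simp
    also have "\<dots> \<le> (M + 3) * D" using M D by (simp add: algebra_simps)
    finally have nrm: "norm (?w' - ?w) \<le> (M + 3) * D" .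
    have big: "M * v \<le> (M + 3) * v" if "v \<ge> 0" for v using that by (simp add: distrib_right)
    have "\<bar>g' ?w\<bar> \<le> C * u ^ m \<and> \<bar>g' ?w'\<bar> \<le> C * u ^ m \<and> \<bar>g' ?w' - g' ?w\<bar> \<le> C * u ^ m * D"
    proof (rule lip, intro conjI)
      show "\<bar>X ?w\<bar> \<le> (M + 3) * u\<^sup>2" "\<bar>X ?w'\<bar> \<le> (M + 3) * u\<^sup>2"
        using cl big[of "u\<^sup>2"] by (auto simp: X weighted_close_def)
      show "\<bar>Y ?w\<bar> \<le> (M + 3) * u ^ q" "\<bar>Y ?w'\<bar> \<le> (M + 3) * u ^ q"
        using cl order_trans[OF _ big[of "u ^ q"]] u by (auto simp: Y weighted_close_def)
      show "\<bar>X ?w' - X ?w\<bar> \<le> u\<^sup>2 * D" "\<bar>Y ?w' - Y ?w\<bar> \<le> u ^ q * D"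
        using cl by (auto simp: X Y weighted_close_def)
    qed (use u e w nrm in auto)
    then show "\<bar>?f x y t\<bar> \<le> C * u ^ m \<and> \<bar>?f x' y' t' - ?f x y t\<bar> \<le> C * u ^ m * D"
      using \<epsilon>2(2)[of ?w] \<epsilon>2(2)[of ?w'] w by simp
  qed
  then show "\<exists>r>0. weighted_lipschitz_on q m ?f (ball t0 r) M" using e(1) by blast
qed


section \<open>Increments along a stable orbit\<close>

lemma bigo_eventually_eq:
  assumes "eventually (\<lambda>i. f i = g i) F" "g \<in> O[F](h)"
  shows "f \<in> O[F](h)"
  using landau_o.big.in_cong[OF assms(1)] assms(2) by blast

lemma power_lipschitz:
  fixes a b R :: real
  assumes "\<bar>a\<bar> \<le> R" "\<bar>b\<bar> \<le> R" "1 \<le> R"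
  shows "\<bar>a ^ n - b ^ n\<bar> \<le> real n * R ^ n * \<bar>a - b\<bar>"
proof (induction n)
  case (Suc n)
  have "a ^ Suc n - b ^ Suc n = a * (a ^ n - b ^ n) + (a - b) * b ^ n" by (simp add: algebra_simps)
  then have "\<bar>a ^ Suc n - b ^ Suc n\<bar> \<le> \<bar>a\<bar> * \<bar>a ^ n - b ^ n\<bar> + \<bar>a - b\<bar> * \<bar>b\<bar> ^ n"
    by (metis abs_mult abs_triangle_ineq power_abs)
  also have "\<dots> \<le> R * (real n * R ^ n * \<bar>a - b\<bar>) + \<bar>a - b\<bar> * R ^ n"
    using Suc assms by (intro add_mono mult_mono power_mono) auto
  also have "\<dots> \<le> R * (real n * R ^ n * \<bar>a - b\<bar>) + \<bar>a - b\<bar> * R ^ Suc n"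
    using assms by (intro add_left_mono mult_left_mono power_increasing) auto
  also have "\<dots> = real (Suc n) * R ^ Suc n * \<bar>a - b\<bar>" by (simp add: algebra_simps)
  finally show ?case .
qed simp

text \<open>
  Asymptotic estimates are stated along a filter on an arbitrary index set on which \<open>u\<close> tends to
  zero.  Later an index consists of a pair of orbits and a time, and the filter expresses that the
  initial parameter is small, so that the estimates are uniform in the orbits and in time.
\<close>

locale small_parameter =
  fixes F :: "'i filter" and u :: "'i \<Rightarrow> real"
  assumes u_lim: "filterlim u (at_right 0) F"
begin

lemma eventually_small:
  assumes "c > 0"
  shows "eventually (\<lambda>i. 0 < u i \<and> u i < c) F"
proof -
  have "eventually (\<lambda>x. 0 < x \<and> x < c) (at_right (0::real))"
    unfolding eventually_at_right_field using assms by blast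
  then show ?thesis by (rule eventually_compose_filterlim[OF _ u_lim])
qed

lemma power_mult_bigo:
  assumes "b \<le> a"
  shows "(\<lambda>i. u i ^ a * g i) \<in> O[F](\<lambda>i. u i ^ b * g i)"
proof (rule bigoI[of _ 1])
  show "eventually (\<lambda>i. norm (u i ^ a * g i) \<le> 1 * norm (u i ^ b * g i)) F"
    using eventually_small[of 1]
    by (rule eventually_mono) (use assms in \<open>auto simp: abs_mult power_decreasing intro!: mult_right_mono\<close>)
qed

lemma power_bigo: "b \<le> a \<Longrightarrow> (\<lambda>i. u i ^ a) \<in> O[F](\<lambda>i. u i ^ b)"
  using power_mult_bigo[of b a "\<lambda>_. 1"] by simp

lemma bigo_lower: "f \<in> O[F](\<lambda>i. u i ^ a) \<Longrightarrow> b \<le> a \<Longrightarrow> f \<in> O[F](\<lambda>i. u i ^ b)"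
  using landau_o.big_trans[OF _ power_bigo] .

lemma bigo_mult:
  assumes "f \<in> O[F](\<lambda>i. u i ^ a)" "g \<in> O[F](\<lambda>i. u i ^ b)" "c \<le> a + b"
  shows "(\<lambda>i. f i * g i) \<in> O[F](\<lambda>i. u i ^ c)"
  using landau_o.big_trans[OF landau_o.big.mult[OF assms(1,2), folded power_add] power_bigo[OF assms(3)]] .

lemma bigo_mult':
  assumes "f \<in> O[F](\<lambda>i. u i ^ a)" "g \<in> O[F](\<lambda>i. u i ^ b * h i)" "c \<le> a + b"
  shows "(\<lambda>i. f i * g i) \<in> O[F](\<lambda>i. u i ^ c * h i)"
proof -
  have "(\<lambda>i. f i * g i) \<in> O[F](\<lambda>i. u i ^ (a + b) * h i)"
    using landau_o.big.mult[OF assms(1,2)] by (simp add: power_add mult.assoc)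
  then show ?thesis by (rule landau_o.big_trans[OF _ power_mult_bigo[OF assms(3)]])
qed

lemma bigo_small:
  assumes "f \<in> O[F](\<lambda>i. u i ^ Suc n * g i)" "c > 0"
  shows "eventually (\<lambda>i. \<bar>f i\<bar> \<le> c * (u i ^ n * \<bar>g i\<bar>)) F"
proof -
  obtain C where C: "C > 0" "eventually (\<lambda>i. norm (f i) \<le> C * norm (u i ^ Suc n * g i)) F"
    using assms(1) by (rule landau_o.bigE)
  have "eventually (\<lambda>i. 0 < u i \<and> u i < c / C) F" using eventually_small C(1) assms(2) by simp
  with C(2) show ?thesis
  proof eventually_elim
    case (elim i)
    have "C * norm (u i ^ Suc n * g i) = (C * u i) * (u i ^ n * \<bar>g i\<bar>)" using elim by (simp add: abs_mult)
    also have "\<dots> \<le> c * (u i ^ n * \<bar>g i\<bar>)"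
      using elim C(1) by (intro mult_right_mono) (auto simp: pos_less_divide_eq mult.commute less_imp_le)
    finally show ?case using elim by simp
  qed
qed

lemma bigo_divide:
  assumes "f \<in> O[F](\<lambda>i. u i ^ q * g i)" "c > 0" "eventually (\<lambda>i. c * u i ^ q \<le> \<bar>w i\<bar>) F"
  shows "(\<lambda>i. f i / w i) \<in> O[F](g)"
proof -
  obtain C where C: "C > 0" "eventually (\<lambda>i. norm (f i) \<le> C * norm (u i ^ q * g i)) F"
    using assms(1) by (rule landau_o.bigE)
  have "eventually (\<lambda>i. norm (f i / w i) \<le> (C / c) * norm (g i)) F"
    using C(2) assms(3) eventually_small[of 1, OF zero_less_one]
  proof eventually_elim
    case (elim i)
    have up: "u i ^ q > 0" using elim by simp
    have w: "\<bar>w i\<bar> > 0" using elim(2) up assms(2) by (smt (verit) mult_pos_pos)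
    have "\<bar>f i\<bar> \<le> (C / c) * \<bar>g i\<bar> * (c * u i ^ q)"
      using elim(1) up assms(2) by (simp add: abs_mult mult_ac)
    also have "\<dots> \<le> (C / c) * \<bar>g i\<bar> * \<bar>w i\<bar>"
      using elim(2) C(1) assms(2) by (intro mult_left_mono) auto
    finally show ?case using w by (simp add: abs_divide pos_divide_le_eq)
  qed
  then show ?thesis by (rule bigoI)
qed

text \<open>
  Let \<open>X = \<kappa> u ^ q (1 + \<alpha>)\<close>.  With \<open>p = u / u1\<close>, whose powers are
  \<open>p ^ q = 1 + q r u ^ (k - 1) + O(u ^ k)\<close>, and \<open>\<gamma> = (X1 - X) / X1\<close> one has the exact relation
  \<open>p ^ q (\<alpha>1 - \<alpha>) = (\<gamma> + (p ^ q - 1)) (1 + \<alpha>1)\<close>.  It first shows that \<open>\<alpha>1 - \<alpha>\<close> is \<open>O(u ^ (k - 1))\<close>, the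
  same order as \<open>\<gamma>\<close>, and then that the products of \<open>\<alpha>\<close>, \<open>\<alpha>1\<close> with these terms are negligible.
\<close>

lemma relative_increment:
  fixes u1 X X1 :: "'i \<Rightarrow> real" and \<kappa> r :: real and k q :: nat
  defines "\<alpha> \<equiv> \<lambda>i. X i / (\<kappa> * u i ^ q) - 1" and "\<alpha>1 \<equiv> \<lambda>i. X1 i / (\<kappa> * u1 i ^ q) - 1"
  assumes k: "k \<ge> 2" and \<kappa>: "\<kappa> \<noteq> 0"
    and du: "(\<lambda>i. u1 i - u i + r * u i ^ k) \<in> O[F](\<lambda>i. u i ^ (k + 1))"
    and X: "(\<lambda>i. X i - \<kappa> * u i ^ q) \<in> O[F](\<lambda>i. u i ^ (q + 1))"
    and X1: "(\<lambda>i. X1 i - \<kappa> * u1 i ^ q) \<in> O[F](\<lambda>i. u i ^ (q + 1))"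
    and dX: "(\<lambda>i. X1 i - X i) \<in> O[F](\<lambda>i. u i ^ (q + (k - 1)))"
  shows "\<alpha> \<in> O[F](u)" "\<alpha>1 \<in> O[F](u)"
    "(\<lambda>i. (X1 i - X i) / X1 i) \<in> O[F](\<lambda>i. u i ^ (k - 1))"
    "(\<lambda>i. (X1 i - X i) / X1 i - (\<alpha>1 i - \<alpha> i) + real q * (r * u i ^ (k - 1))) \<in> O[F](\<lambda>i. u i ^ k)"
    "\<exists>c>0. eventually (\<lambda>i. c * u i ^ q \<le> \<bar>X1 i\<bar>) F"
proof -
  let ?O = "\<lambda>n. O[F](\<lambda>i. u i ^ n)"
  have half: "(0::real) < 1/2" by simp
  have k1: "Suc (k - 1) = k" using k by simp
  have uk: "(\<lambda>i. r * u i ^ k) \<in> ?O k" by simp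
  have "(\<lambda>i. (u1 i - u i + r * u i ^ k) - r * u i ^ k) \<in> ?O k"
    by (rule sum_in_bigo(2)[OF bigo_lower[OF du] uk]) simp
  then have u1u: "(\<lambda>i. u1 i - u i) \<in> ?O k" by simp
  have "(\<lambda>i. u1 i - u i) \<in> O[F](\<lambda>i. u i ^ Suc 1 * 1)"
    using bigo_lower[OF u1u, of 2] k by (simp add: numeral_2_eq_2)
  from bigo_small[OF this half]
  have ev1: "eventually (\<lambda>i. 0 < u i \<and> u i \<le> 1 \<and> u i / 2 \<le> u1 i) F"
    using eventually_small[of 1, OF zero_less_one]
  proof eventually_elim
    case (elim i)
    have "- (u1 i - u i) \<le> u i / 2" using elim by (intro order_trans[OF abs_ge_minus_self]) simp
    then show ?case using elim by simp
  qed
  define p where "p i = u i / u1 i" for i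
  have "(\<lambda>i. (u i - u1 i) / u1 i) \<in> ?O (k - 1)"
  proof (rule bigo_divide[where q = 1 and c = "1/2"])
    have "(\<lambda>i. u i - u1 i) \<in> ?O k"
      by (rule landau_o.big_trans[OF _ u1u], rule bigoI[of _ 1]) (simp add: abs_minus_commute)
    then show "(\<lambda>i. u i - u1 i) \<in> O[F](\<lambda>i. u i ^ 1 * u i ^ (k - 1))"
      using k1 by (simp flip: power_Suc)
  qed (use ev1 in \<open>auto elim!: eventually_mono\<close>)
  moreover have "eventually (\<lambda>i. p i - 1 = (u i - u1 i) / u1 i) F"
    using ev1 by eventually_elim (auto simp: p_def diff_divide_distrib)
  ultimately have p1: "(\<lambda>i. p i - 1) \<in> ?O (k - 1)" using bigo_eventually_eq by fast
  have p2: "(\<lambda>i. p i - 1 - r * u i ^ (k - 1)) \<in> ?O k"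
  proof -
    have "(\<lambda>i. (r * u i ^ (k - 1)) * (u1 i - u i)) \<in> ?O (k + 1)"
      by (rule bigo_mult[OF _ u1u, where a = "k - 1"]) (use k in auto)
    from iffD2[OF landau_o.big.uminus_in_iff sum_in_bigo(1)[OF du this]]
    have "(\<lambda>i. - ((u1 i - u i + r * u i ^ k) + (r * u i ^ (k - 1)) * (u1 i - u i))) \<in> ?O (k + 1)" .
    then have "(\<lambda>i. - ((u1 i - u i + r * u i ^ k) + (r * u i ^ (k - 1)) * (u1 i - u i)) / u1 i) \<in> ?O k"
      by (intro bigo_divide[where q = 1 and c = "1/2"]) (use ev1 in \<open>auto elim!: eventually_mono\<close>)
    moreover have "eventually (\<lambda>i. p i - 1 - r * u i ^ (k - 1)
        = - ((u1 i - u i + r * u i ^ k) + (r * u i ^ (k - 1)) * (u1 i - u i)) / u1 i) F"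
      using ev1
    proof eventually_elim
      case (elim i)
      have "u i ^ k = u i * u i ^ (k - 1)" using k1 by (metis power_Suc)
      then show ?case using elim by (simp add: p_def field_simps)
    qed
    ultimately show ?thesis using bigo_eventually_eq by fast
  qed
  have pO1: "p \<in> ?O 0"
  proof -
    have "(\<lambda>i. (p i - 1) + 1) \<in> ?O 0" by (rule sum_in_bigo(1)[OF bigo_lower[OF p1]]) auto
    then show ?thesis by simp
  qed
  have pq: "(\<lambda>i. p i ^ n - 1 - real n * (p i - 1)) \<in> ?O k" for n
  proof (induction n)
    case (Suc n)
    have "(\<lambda>i. (p i ^ n - 1 - real n * (p i - 1)) * p i) \<in> ?O k"
      by (rule bigo_mult[OF Suc pO1]) simp
    moreover have "(\<lambda>i. (real n * (p i - 1)) * (p i - 1)) \<in> ?O k"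
      by (rule bigo_mult[OF _ p1, where a = "k - 1"]) (use p1 k in auto)
    ultimately have "(\<lambda>i. (p i ^ n - 1 - real n * (p i - 1)) * p i + (real n * (p i - 1)) * (p i - 1)) \<in> ?O k"
      by (rule sum_in_bigo(1))
    then show ?case by (simp add: algebra_simps)
  qed simp
  have "(\<lambda>i. (p i ^ q - 1 - real q * (p i - 1)) + real q * (p i - 1 - r * u i ^ (k - 1))) \<in> ?O k"
    by (rule sum_in_bigo(1)[OF pq]) (use p2 in auto)
  then have pq2: "(\<lambda>i. p i ^ q - 1 - real q * (r * u i ^ (k - 1))) \<in> ?O k" by (simp add: algebra_simps)
  have "(\<lambda>i. (p i ^ q - 1 - real q * (r * u i ^ (k - 1))) + real q * (r * u i ^ (k - 1))) \<in> ?O (k - 1)"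
    by (rule sum_in_bigo(1)[OF bigo_lower[OF pq2]]) auto
  then have pq1: "(\<lambda>i. p i ^ q - 1) \<in> ?O (k - 1)" by simp
  have \<alpha>_eq: "eventually (\<lambda>i. \<alpha> i = (X i - \<kappa> * u i ^ q) / (\<kappa> * u i ^ q)) F"
    using ev1 by eventually_elim (use \<kappa> in \<open>auto simp: \<alpha>_def diff_divide_distrib\<close>)
  have "(\<lambda>i. (X i - \<kappa> * u i ^ q) / (\<kappa> * u i ^ q)) \<in> O[F](u)"
    by (rule bigo_divide[where q = q and c = "\<bar>\<kappa>\<bar>"])
       (use X \<kappa> ev1 in \<open>auto simp: abs_mult mult.commute elim!: eventually_mono\<close>)
  then show \<alpha>: "\<alpha> \<in> O[F](u)" using bigo_eventually_eq[OF \<alpha>_eq] by blast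
  have \<alpha>1_eq: "eventually (\<lambda>i. \<alpha>1 i = (X1 i - \<kappa> * u1 i ^ q) / (\<kappa> * u1 i ^ q)) F"
    using ev1 by eventually_elim (use \<kappa> in \<open>auto simp: \<alpha>1_def diff_divide_distrib\<close>)
  have u1q: "eventually (\<lambda>i. (1/2) ^ q * u i ^ q \<le> u1 i ^ q) F"
    using ev1
  proof eventually_elim
    case (elim i)
    then have "(u i / 2) ^ q \<le> u1 i ^ q" by (intro power_mono) auto
    then show ?case by (simp add: power_divide)
  qed
  have "(\<lambda>i. (X1 i - \<kappa> * u1 i ^ q) / (\<kappa> * u1 i ^ q)) \<in> O[F](u)"
  proof (rule bigo_divide[where q = q and c = "\<bar>\<kappa>\<bar> * (1/2) ^ q"])
    show "eventually (\<lambda>i. \<bar>\<kappa>\<bar> * (1/2) ^ q * u i ^ q \<le> \<bar>\<kappa> * u1 i ^ q\<bar>) F"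
      using u1q
    proof eventually_elim
      case (elim i)
      then have "\<bar>\<kappa>\<bar> * ((1/2) ^ q * u i ^ q) \<le> \<bar>\<kappa>\<bar> * \<bar>u1 i ^ q\<bar>"
        by (intro mult_left_mono) auto
      then show ?case by (simp add: abs_mult mult.assoc)
    qed
  qed (use X1 \<kappa> in \<open>auto simp: mult.commute\<close>)
  then show \<alpha>1: "\<alpha>1 \<in> O[F](u)" using bigo_eventually_eq[OF \<alpha>1_eq] by blast
  have "\<alpha>1 \<in> O[F](\<lambda>i. u i ^ Suc 0 * 1)" using \<alpha>1 by simp
  from bigo_small[OF this half] have ev2: "eventually (\<lambda>i. \<bar>\<alpha>1 i\<bar> \<le> 1/2) F" by simp
  define c where "c = \<bar>\<kappa>\<bar> * (1/2) ^ q * (1/2)"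
  have c: "c > 0" using \<kappa> by (simp add: c_def)
  have Xlow: "eventually (\<lambda>i. c * u i ^ q \<le> \<bar>X1 i\<bar>) F"
    using ev1 ev2 u1q
  proof eventually_elim
    case (elim i)
    have "X1 i = \<kappa> * u1 i ^ q * (1 + \<alpha>1 i)" using elim \<kappa> by (simp add: \<alpha>1_def)
    then have "\<bar>X1 i\<bar> = \<bar>\<kappa>\<bar> * u1 i ^ q * \<bar>1 + \<alpha>1 i\<bar>" using elim by (simp add: abs_mult)
    moreover have "\<bar>\<kappa>\<bar> * ((1/2) ^ q * u i ^ q) * (1/2) \<le> \<bar>\<kappa>\<bar> * u1 i ^ q * \<bar>1 + \<alpha>1 i\<bar>"
      using elim by (intro mult_mono) auto
    ultimately show ?case by (simp add: c_def mult_ac)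
  qed
  then show "\<exists>c>0. eventually (\<lambda>i. c * u i ^ q \<le> \<bar>X1 i\<bar>) F" using c by blast
  define \<gamma> where "\<gamma> i = (X1 i - X i) / X1 i" for i
  show \<gamma>: "(\<lambda>i. (X1 i - X i) / X1 i) \<in> ?O (k - 1)"
    by (rule bigo_divide[OF _ c Xlow]) (use dX in \<open>simp add: power_add\<close>)
  have key: "eventually (\<lambda>i. p i ^ q * (\<alpha>1 i - \<alpha> i) = (\<gamma> i + (p i ^ q - 1)) * (1 + \<alpha>1 i)) F"
    using ev1 ev2
  proof eventually_elim
    case (elim i)
    have u1: "u1 i \<noteq> 0" "u i \<noteq> 0" using elim by auto
    have e1: "X1 i = \<kappa> * u1 i ^ q * (1 + \<alpha>1 i)" using u1 \<kappa> by (simp add: \<alpha>1_def)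
    have e2: "X i = \<kappa> * u i ^ q * (1 + \<alpha> i)" using u1 \<kappa> by (simp add: \<alpha>_def)
    have nz: "1 + \<alpha>1 i \<noteq> 0" "\<kappa> * u1 i ^ q \<noteq> 0" using elim \<kappa> u1 by auto
    have "\<gamma> i = 1 - X i / X1 i" using e1 nz by (simp add: \<gamma>_def diff_divide_distrib)
    also have "X i / X1 i = p i ^ q * (1 + \<alpha> i) / (1 + \<alpha>1 i)"
      using nz by (simp add: e1 e2 p_def power_divide)
    finally show ?case using nz by (simp add: field_simps)
  qed
  have g1: "(\<lambda>i. \<gamma> i + (p i ^ q - 1)) \<in> ?O (k - 1)"
    unfolding \<gamma>_def by (rule sum_in_bigo(1)[OF \<gamma> pq1])
  have \<alpha>\<alpha>: "(\<lambda>i. \<alpha>1 i - \<alpha> i) \<in> ?O 1" using sum_in_bigo(2)[OF \<alpha>1 \<alpha>] by simp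
  have A1: "(\<lambda>i. (\<gamma> i + (p i ^ q - 1)) * \<alpha>1 i) \<in> ?O k"
    by (rule bigo_mult[OF g1, where b = 1]) (use \<alpha>1 k in auto)
  have A2: "(\<lambda>i. (p i ^ q - 1) * (\<alpha>1 i - \<alpha> i)) \<in> ?O k"
    by (rule bigo_mult[OF pq1 \<alpha>\<alpha>]) (use k in auto)
  have "(\<lambda>i. ((p i ^ q - 1) * (\<alpha>1 i - \<alpha> i) - (\<gamma> i + (p i ^ q - 1)) * \<alpha>1 i)
      - (p i ^ q - 1 - real q * (r * u i ^ (k - 1)))) \<in> ?O k"
    by (rule sum_in_bigo(2)[OF sum_in_bigo(2)[OF A2 A1] pq2])
  moreover have "eventually (\<lambda>i. (X1 i - X i) / X1 i - (\<alpha>1 i - \<alpha> i) + real q * (r * u i ^ (k - 1)) =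
     ((p i ^ q - 1) * (\<alpha>1 i - \<alpha> i) - (\<gamma> i + (p i ^ q - 1)) * \<alpha>1 i)
      - (p i ^ q - 1 - real q * (r * u i ^ (k - 1)))) F"
    using key by eventually_elim (simp add: \<gamma>_def[symmetric] algebra_simps)
  ultimately show "(\<lambda>i. (X1 i - X i) / X1 i - (\<alpha>1 i - \<alpha> i) + real q * (r * u i ^ (k - 1))) \<in> ?O k"
    using bigo_eventually_eq by fast
qed

text \<open>
  If \<open>\<xi>\<close> changes by \<open>\<gamma> (N - \<xi>)\<close> and \<open>\<gamma>\<close> contains the increment of \<open>\<alpha>\<close>, then subtracting
  \<open>\<alpha> (N - \<xi>)\<close> from \<open>\<xi>\<close> removes this contribution, by summation by parts: the error is \<open>\<alpha>1 = O(u)\<close>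
  times the increment of \<open>N - \<xi>\<close>.
\<close>

lemma adjusted_increment:
  fixes \<xi> \<xi>1 N N1 \<gamma> \<alpha> \<alpha>1 D \<delta> :: "'i \<Rightarrow> real" and Q r :: real
  assumes k: "k \<ge> 2"
    and nonneg: "eventually (\<lambda>i. 0 \<le> D i \<and> 0 \<le> \<delta> i) F"
    and \<gamma>: "(\<lambda>i. \<gamma> i - (\<alpha>1 i - \<alpha> i) + Q * (r * u i ^ (k - 1))) \<in> O[F](\<lambda>i. u i ^ k)"
    and \<alpha>1: "\<alpha>1 \<in> O[F](u)"
    and step: "(\<lambda>i. (\<xi>1 i - \<xi> i) - \<gamma> i * (N i - \<xi> i)) \<in> O[F](\<lambda>i. u i ^ k * D i + u i ^ (k - 1) * \<delta> i)"
    and diff: "(\<lambda>i. N i - \<xi> i) \<in> O[F](D)"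
    and d\<xi>: "(\<lambda>i. \<xi>1 i - \<xi> i) \<in> O[F](\<lambda>i. u i ^ (k - 1) * D i)"
    and dN: "(\<lambda>i. N1 i - N i) \<in> O[F](\<lambda>i. u i ^ (k - 1) * D i)"
  shows "(\<lambda>i. (\<xi>1 i - \<alpha>1 i * (N1 i - \<xi>1 i)) - (\<xi> i - \<alpha> i * (N i - \<xi> i)) + Q * (r * u i ^ (k - 1)) * (N i - \<xi> i))
    \<in> O[F](\<lambda>i. u i ^ k * D i + u i ^ (k - 1) * \<delta> i)" (is "_ \<in> ?E")
proof -
  have DE: "(\<lambda>i. u i ^ k * D i) \<in> ?E"
  proof (rule bigoI[of _ 1])
    show "eventually (\<lambda>i. norm (u i ^ k * D i) \<le> 1 * norm (u i ^ k * D i + u i ^ (k - 1) * \<delta> i)) F"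
      using nonneg eventually_small[of 1, OF zero_less_one] by eventually_elim simp
  qed
  have 1: "(\<lambda>i. (\<gamma> i - (\<alpha>1 i - \<alpha> i) + Q * (r * u i ^ (k - 1))) * (N i - \<xi> i)) \<in> ?E"
    by (rule landau_o.big_trans[OF landau_o.big.mult[OF \<gamma> diff] DE])
  have 2: "(\<lambda>i. \<alpha>1 i * ((N1 i - N i) - (\<xi>1 i - \<xi> i))) \<in> ?E"
  proof (rule landau_o.big_trans[OF _ DE], rule bigo_mult'[where a = 1 and b = "k - 1"])
    show "(\<lambda>i. N1 i - N i - (\<xi>1 i - \<xi> i)) \<in> O[F](\<lambda>i. u i ^ (k - 1) * D i)"
      by (rule sum_in_bigo(2)[OF dN d\<xi>])
  qed (use \<alpha>1 k in auto)
  have "(\<lambda>i. ((\<xi>1 i - \<xi> i) - \<gamma> i * (N i - \<xi> i)) + (\<gamma> i - (\<alpha>1 i - \<alpha> i) + Q * (r * u i ^ (k - 1))) * (N i - \<xi> i)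
      - \<alpha>1 i * ((N1 i - N i) - (\<xi>1 i - \<xi> i))) \<in> ?E"
    by (rule sum_in_bigo(2)[OF sum_in_bigo(1)[OF step 1] 2])
  then show ?thesis by (simp add: algebra_simps)
qed

end


section \<open>The expanding cone\<close>

text \<open>
  The relative differences \<open>\<xi>\<close> and \<open>\<eta>\<close> after the change of variables of \<open>adjusted_increment\<close>.  The
  equation for \<open>\<xi>\<close> drives it towards \<open>N = \<eta>\<close>, the one for \<open>\<eta>\<close> towards \<open>N = (1 + \<xi>) ^ k - 1\<close>.
\<close>

definition adjusted_xi :: "real \<Rightarrow> real \<Rightarrow> real \<Rightarrow> real \<Rightarrow> real"
  where "adjusted_xi u x \<xi> \<eta> = \<xi> - (x / u\<^sup>2 - 1) * (\<eta> - \<xi>)"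

definition adjusted_eta :: "nat \<Rightarrow> real \<Rightarrow> real \<Rightarrow> real \<Rightarrow> real \<Rightarrow> real \<Rightarrow> real"
  where "adjusted_eta k \<kappa> u y \<xi> \<eta> = \<eta> - (y / (\<kappa> * u ^ (k + 1)) - 1) * (((1 + \<xi>) ^ k - 1) - \<eta>)"

text \<open>
  The components of \<open>(\<xi>, \<eta>)\<close> with respect to the left eigenvectors \<open>(k + 1, - 2)\<close> and \<open>(k, 1)\<close> of
  the matrix with rows \<open>(2, - 2)\<close> and \<open>(- k (k + 1), k + 1)\<close>, for the eigenvalues \<open>2 k + 2\<close>
  and \<open>1 - k\<close>.
\<close>

definition unstable_part :: "nat \<Rightarrow> real \<Rightarrow> real \<Rightarrow> real \<Rightarrow> real \<Rightarrow> real \<Rightarrow> real \<Rightarrow> real"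
  where "unstable_part k \<kappa> u x y \<xi> \<eta> = (real k + 1) * adjusted_xi u x \<xi> \<eta> - 2 * adjusted_eta k \<kappa> u y \<xi> \<eta>"

definition stable_part :: "nat \<Rightarrow> real \<Rightarrow> real \<Rightarrow> real \<Rightarrow> real \<Rightarrow> real \<Rightarrow> real \<Rightarrow> real"
  where "stable_part k \<kappa> u x y \<xi> \<eta> = real k * adjusted_xi u x \<xi> \<eta> + adjusted_eta k \<kappa> u y \<xi> \<eta>"

definition in_cone :: "real \<Rightarrow> nat \<Rightarrow> real \<Rightarrow> real \<Rightarrow> real \<Rightarrow> real \<Rightarrow> real \<Rightarrow> real \<Rightarrow> real \<Rightarrow> bool"
  where "in_cone c k \<kappa> u x y \<xi> \<eta> \<delta> \<longleftrightarrow>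
    unstable_part k \<kappa> u x y \<xi> \<eta> > 0 \<and>
    \<bar>stable_part k \<kappa> u x y \<xi> \<eta>\<bar> \<le> unstable_part k \<kappa> u x y \<xi> \<eta> \<and>
    \<delta> \<le> c * unstable_part k \<kappa> u x y \<xi> \<eta>"

text \<open>
  What one step of a pair of orbits provides: the cone is mapped into itself while \<open>P u\<close> does not
  decrease, pairs with equal abscissae and angles and with \<open>y' / y < 1\<close> are in the cone, and \<open>P\<close> is
  bounded in terms of \<open>\<xi>\<close> and \<open>\<eta>\<close>.
\<close>

definition expanding_step ::
    "real \<Rightarrow> real \<Rightarrow> nat \<Rightarrow> real \<Rightarrow> real \<Rightarrow> real \<Rightarrow> real \<Rightarrow> real \<Rightarrow> real \<Rightarrow> real \<Rightarrow>
     real \<Rightarrow> real \<Rightarrow> real \<Rightarrow> real \<Rightarrow> real \<Rightarrow> real \<Rightarrow> bool"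
  where "expanding_step c B k \<kappa> u x y \<xi> \<eta> \<delta> u1 x1 y1 \<xi>1 \<eta>1 \<delta>1 \<longleftrightarrow>
    (in_cone c k \<kappa> u x y \<xi> \<eta> \<delta> \<longrightarrow> in_cone c k \<kappa> u1 x1 y1 \<xi>1 \<eta>1 \<delta>1 \<and>
      unstable_part k \<kappa> u x y \<xi> \<eta> * u \<le> unstable_part k \<kappa> u1 x1 y1 \<xi>1 \<eta>1 * u1) \<and>
    (\<xi> = 0 \<and> \<delta> = 0 \<and> \<eta> < 0 \<longrightarrow> in_cone c k \<kappa> u x y \<xi> \<eta> \<delta>) \<and>
    unstable_part k \<kappa> u x y \<xi> \<eta> \<le> B * (\<bar>\<xi>\<bar> + \<bar>\<eta>\<bar>)"

text \<open>
  Here \<open>N \<ge> 0\<close> is the nonlinear term.  It enters \<open>P\<close>, \<open>P + Q\<close> and \<open>P - Q\<close> with the positive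
  coefficients \<open>2 (K + 1)\<close>, \<open>K + 1\<close> and \<open>3 (K + 1)\<close>, so it can only help.  The growth factor
  \<open>1 + 3 h\<close> of \<open>P\<close> exceeds the loss \<open>1 - 2 h\<close> of \<open>u\<close>.
\<close>

lemma cone_step_arithmetic:
  fixes P P1 Q Q1 N h K E c \<delta> \<delta>1 u u1 :: real
  assumes K: "K \<ge> 2" and h: "0 < h" "h \<le> 1/6" and N: "N \<ge> 0" and c: "c > 0" and u: "u > 0"
    and P: "P > 0" and Q: "\<bar>Q\<bar> \<le> P" and \<delta>: "\<delta> \<le> c * P"
    and P1: "\<bar>P1 - P - h * ((2 * K + 2) * P + 2 * (K + 1) * N)\<bar> \<le> h * P / 4"
    and Q1: "\<bar>Q1 - Q + h * ((K - 1) * Q + (K + 1) * N)\<bar> \<le> h * P / 4"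
    and \<delta>1: "\<delta>1 \<le> \<delta> + c * (h * P)"
    and u1: "u * (1 - 2 * h) \<le> u1"
  shows "P1 > 0 \<and> \<bar>Q1\<bar> \<le> P1 \<and> \<delta>1 \<le> c * P1 \<and> P * u \<le> P1 * u1"
proof -
  define p where "p = h * P"
  define n where "n = h * N"
  define s where "s = h * Q"
  have pos: "p > 0" "n \<ge> 0" "\<bar>s\<bar> \<le> p"
    using h P N Q by (auto simp: p_def n_def s_def abs_mult)
  have Kp: "K * p \<ge> 2 * p" "K * n \<ge> 0" "\<bar>(K - 1) * s\<bar> \<le> (K - 1) * p"
    using K pos by (auto simp: abs_mult intro!: mult_right_mono mult_left_mono)
  have e1: "h * ((2 * K + 2) * P + 2 * (K + 1) * N) = 2 * (K * p) + 2 * p + 2 * (K * n) + 2 * n"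
    by (simp add: p_def n_def algebra_simps)
  have e2: "h * ((K - 1) * Q + (K + 1) * N) = (K - 1) * s + K * n + n"
    by (simp add: s_def n_def algebra_simps)
  have e3: "(K - 1) * p = K * p - p" by (simp add: algebra_simps)
  have b1: "\<bar>P1 - P - (2 * (K * p) + 2 * p + 2 * (K * n) + 2 * n)\<bar> \<le> p / 4"
    using P1 unfolding e1 by (simp add: p_def)
  have b2: "\<bar>Q1 - Q + ((K - 1) * s + K * n + n)\<bar> \<le> p / 4"
    using Q1 unfolding e2 by (simp add: p_def)
  have grow: "P1 \<ge> P + 3 * p" using b1 Kp pos by linarith
  have "P1 > 0" using grow P pos by linarith
  moreover have "\<bar>Q1\<bar> \<le> P1" using b1 b2 Kp pos Q unfolding e3 by linarith
  moreover have "\<delta>1 \<le> c * P1"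
  proof -
    have "\<delta>1 \<le> c * (P + p)" using \<delta>1 \<delta> by (simp add: p_def distrib_left)
    also have "\<dots> \<le> c * P1" using c grow pos by (intro mult_left_mono) auto
    finally show ?thesis .
  qed
  moreover have "P * u \<le> P1 * u1"
  proof -
    have "6 * (h * h) \<le> h" using h mult_left_mono[of h "1/6" h] by simp
    then have "1 \<le> (1 + 3 * h) * (1 - 2 * h)" by (simp add: algebra_simps)
    then have "(P * u) * 1 \<le> (P * u) * ((1 + 3 * h) * (1 - 2 * h))" using P u by (intro mult_left_mono) auto
    also have "\<dots> = (P + 3 * p) * (u * (1 - 2 * h))" by (simp add: p_def algebra_simps)
    also have "\<dots> \<le> P1 * u1" using grow u1 u h P pos by (intro mult_mono) auto
    finally show ?thesis by simp
  qed
  ultimately show ?thesis by blast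
qed

context small_parameter
begin

text \<open>
  In the cone \<open>\<bar>\<xi>\<bar> + \<bar>\<eta>\<bar> + \<delta> \<le> 9 P\<close>.  So of the two error terms, \<open>u ^ k (\<bar>\<xi>\<bar> + \<bar>\<eta>\<bar> + \<delta>)\<close> is a small multiple of
  \<open>h P\<close> when \<open>u\<close> is small, and \<open>u ^ (k - 1) \<delta>\<close> is one when the opening \<open>c\<close> of the cone in the direction
  of the angles is small.
\<close>

lemma cone_step:
  fixes u1 x x1 y y1 \<xi> \<xi>1 \<eta> \<eta>1 \<delta> \<delta>1 :: "'i \<Rightarrow> real" and \<kappa> r M C :: real and k :: nat
  defines "D \<equiv> \<lambda>i. \<bar>\<xi> i\<bar> + \<bar>\<eta> i\<bar> + \<delta> i"
  assumes k: "k \<ge> 2" and \<kappa>: "\<kappa> \<noteq> 0" and r: "r > 0"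
    and du: "(\<lambda>i. u1 i - u i + r * u i ^ k) \<in> O[F](\<lambda>i. u i ^ (k + 1))"
    and x: "(\<lambda>i. x i - (u i)\<^sup>2) \<in> O[F](\<lambda>i. u i ^ 3)" and x1: "(\<lambda>i. x1 i - (u1 i)\<^sup>2) \<in> O[F](\<lambda>i. u i ^ 3)"
    and y: "(\<lambda>i. y i - \<kappa> * u i ^ (k + 1)) \<in> O[F](\<lambda>i. u i ^ (k + 2))"
    and y1: "(\<lambda>i. y1 i - \<kappa> * u1 i ^ (k + 1)) \<in> O[F](\<lambda>i. u i ^ (k + 2))"
    and dx: "(\<lambda>i. x1 i - x i) \<in> O[F](\<lambda>i. u i ^ (k + 1))"
    and dy: "(\<lambda>i. y1 i - y i) \<in> O[F](\<lambda>i. u i ^ (2 * k))"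
    and bd: "eventually (\<lambda>i. -1 \<le> \<xi> i \<and> \<bar>\<xi> i\<bar> \<le> M \<and> \<bar>\<xi>1 i\<bar> \<le> M \<and> 0 \<le> \<delta> i) F"
    and eqx: "(\<lambda>i. x1 i * (\<xi>1 i - \<xi> i) - (x1 i - x i) * (\<eta> i - \<xi> i)) \<in> O[F](\<lambda>i. u i ^ (k + 1) * \<delta> i)"
    and eqy: "(\<lambda>i. y1 i * (\<eta>1 i - \<eta> i) - (y1 i - y i) * (((1 + \<xi> i) ^ k - 1) - \<eta> i))
      \<in> O[F](\<lambda>i. u i ^ (2 * k) * \<delta> i + u i ^ (2 * k + 1) * D i)"
    and eqd: "eventually (\<lambda>i. \<delta>1 i \<le> \<delta> i + C * (u i ^ k * D i)) F"
  shows "\<exists>c>0. \<exists>B. eventually (\<lambda>i. expanding_step c B k \<kappa>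
    (u i) (x i) (y i) (\<xi> i) (\<eta> i) (\<delta> i) (u1 i) (x1 i) (y1 i) (\<xi>1 i) (\<eta>1 i) (\<delta>1 i)) F"
proof -
  define G where "G v = (1 + v) ^ k - 1" for v :: real
  define h where "h i = r * u i ^ (k - 1)" for i
  define \<alpha> where "\<alpha> i = x i / (1 * u i ^ 2) - 1" for i
  define \<alpha>1 where "\<alpha>1 i = x1 i / (1 * u1 i ^ 2) - 1" for i
  define \<beta> where "\<beta> i = y i / (\<kappa> * u i ^ (k + 1)) - 1" for i
  define \<beta>1 where "\<beta>1 i = y1 i / (\<kappa> * u1 i ^ (k + 1)) - 1" for i
  define a where "a i = \<xi> i - \<alpha> i * (\<eta> i - \<xi> i)" for i
  define a1 where "a1 i = \<xi>1 i - \<alpha>1 i * (\<eta>1 i - \<xi>1 i)" for i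
  define b where "b i = \<eta> i - \<beta> i * (G (\<xi> i) - \<eta> i)" for i
  define b1 where "b1 i = \<eta>1 i - \<beta>1 i * (G (\<xi>1 i) - \<eta>1 i)" for i
  define P where "P i = (real k + 1) * a i - 2 * b i" for i
  define P1 where "P1 i = (real k + 1) * a1 i - 2 * b1 i" for i
  define Q where "Q i = real k * a i + b i" for i
  define Q1 where "Q1 i = real k * a1 i + b1 i" for i
  have PQ: "unstable_part k \<kappa> (u i) (x i) (y i) (\<xi> i) (\<eta> i) = P i"
    "unstable_part k \<kappa> (u1 i) (x1 i) (y1 i) (\<xi>1 i) (\<eta>1 i) = P1 i"
    "stable_part k \<kappa> (u i) (x i) (y i) (\<xi> i) (\<eta> i) = Q i"
    "stable_part k \<kappa> (u1 i) (x1 i) (y1 i) (\<xi>1 i) (\<eta>1 i) = Q1 i" for i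
    by (simp_all add: unstable_part_def stable_part_def adjusted_xi_def adjusted_eta_def
        P_def P1_def Q_def Q1_def a_def a1_def b_def b1_def \<alpha>_def \<alpha>1_def \<beta>_def \<beta>1_def G_def)
  let ?E = "\<lambda>i. u i ^ k * D i + u i ^ (k - 1) * \<delta> i"
  note ev01 = eventually_small[of 1, OF zero_less_one]
  have nonneg: "eventually (\<lambda>i. 0 \<le> D i \<and> 0 \<le> \<delta> i) F"
    using bd by eventually_elim (simp add: D_def)
  have DE: "(\<lambda>i. u i ^ k * D i) \<in> O[F](?E)"
    by (rule bigoI[of _ 1]) (use nonneg ev01 in \<open>eventually_elim, simp\<close>)
  have \<delta>E: "(\<lambda>i. u i ^ (k - 1) * \<delta> i) \<in> O[F](?E)"
    by (rule bigoI[of _ 1]) (use nonneg ev01 in \<open>eventually_elim, simp\<close>)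
  have ED: "?E \<in> O[F](\<lambda>i. u i ^ (k - 1) * D i)"
  proof (rule sum_in_bigo(1)[OF power_mult_bigo])
    show "(\<lambda>i. u i ^ (k - 1) * \<delta> i) \<in> O[F](\<lambda>i. u i ^ (k - 1) * D i)"
      by (rule bigoI[of _ 1]) (use bd ev01 in \<open>eventually_elim, simp add: D_def abs_mult mult_left_mono\<close>)
  qed simp
  have \<xi>D: "\<xi> \<in> O[F](D)"
    by (rule bigoI[of _ 1]) (use bd in \<open>eventually_elim, simp add: D_def\<close>)
  have \<eta>D: "\<eta> \<in> O[F](D)"
    by (rule bigoI[of _ 1]) (use bd in \<open>eventually_elim, simp add: D_def\<close>)
  define R where "R = real k * (1 + M) ^ k"
  have G_lip: "\<bar>G v - G w\<bar> \<le> R * \<bar>v - w\<bar>" if "\<bar>v\<bar> \<le> M" "\<bar>w\<bar> \<le> M" for v w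
    using power_lipschitz[of "1 + v" "1 + M" "1 + w" k] that by (auto simp: G_def R_def)
  have GD: "(\<lambda>i. G (\<xi> i)) \<in> O[F](D)"
  proof (rule landau_o.big_trans[OF _ \<xi>D], rule bigoI[of _ R])
    show "eventually (\<lambda>i. norm (G (\<xi> i)) \<le> R * norm (\<xi> i)) F"
      using bd by eventually_elim (use G_lip[of _ 0] in \<open>fastforce simp: G_def\<close>)
  qed

  have x': "(\<lambda>i. x i - 1 * u i ^ 2) \<in> O[F](\<lambda>i. u i ^ (2 + 1))"
    and x1': "(\<lambda>i. x1 i - 1 * u1 i ^ 2) \<in> O[F](\<lambda>i. u i ^ (2 + 1))"
    and dx': "(\<lambda>i. x1 i - x i) \<in> O[F](\<lambda>i. u i ^ (2 + (k - 1)))"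
    and y': "(\<lambda>i. y i - \<kappa> * u i ^ (k + 1)) \<in> O[F](\<lambda>i. u i ^ (k + 1 + 1))"
    and y1': "(\<lambda>i. y1 i - \<kappa> * u1 i ^ (k + 1)) \<in> O[F](\<lambda>i. u i ^ (k + 1 + 1))"
    and dy': "(\<lambda>i. y1 i - y i) \<in> O[F](\<lambda>i. u i ^ (k + 1 + (k - 1)))"
    using x x1 dx y y1 dy k by (simp_all add: numeral_3_eq_3 numeral_2_eq_2 mult_2)
  note X = relative_increment[OF k one_neq_zero du x' x1' dx', folded \<alpha>_def \<alpha>1_def]
  note Y = relative_increment[OF k \<kappa> du y' y1' dy', folded \<beta>_def \<beta>1_def]
  define \<gamma> where "\<gamma> i = (x1 i - x i) / x1 i" for i
  define \<gamma>' where "\<gamma>' i = (y1 i - y i) / y1 i" for i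
  have stepx: "(\<lambda>i. (\<xi>1 i - \<xi> i) - \<gamma> i * (\<eta> i - \<xi> i)) \<in> O[F](?E)"
  proof -
    obtain c where c: "c > 0" "eventually (\<lambda>i. c * u i ^ 2 \<le> \<bar>x1 i\<bar>) F" using X(5) by blast
    have "(\<lambda>i. (x1 i * (\<xi>1 i - \<xi> i) - (x1 i - x i) * (\<eta> i - \<xi> i)) / x1 i) \<in> O[F](\<lambda>i. u i ^ (k - 1) * \<delta> i)"
    proof (rule bigo_divide[OF _ c])
      have "k + 1 = 2 + (k - 1)" using k by simp
      then have eq: "u i ^ (k + 1) * \<delta> i = u i ^ 2 * (u i ^ (k - 1) * \<delta> i)" for i
        by (metis mult.assoc power_add)
      show "(\<lambda>i. x1 i * (\<xi>1 i - \<xi> i) - (x1 i - x i) * (\<eta> i - \<xi> i))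
          \<in> O[F](\<lambda>i. u i ^ 2 * (u i ^ (k - 1) * \<delta> i))" using eqx by (simp only: eq)
    qed
    moreover have "eventually (\<lambda>i. (\<xi>1 i - \<xi> i) - \<gamma> i * (\<eta> i - \<xi> i) =
        (x1 i * (\<xi>1 i - \<xi> i) - (x1 i - x i) * (\<eta> i - \<xi> i)) / x1 i) F"
      using c(2) ev01
    proof eventually_elim
      case (elim i)
      then have "c * u i ^ 2 > 0" using c(1) by simp
      then have "x1 i \<noteq> 0" using elim by auto
      then show ?case by (simp add: \<gamma>_def field_simps)
    qed
    ultimately show ?thesis using bigo_eventually_eq landau_o.big_trans[OF _ \<delta>E] by fast
  qed
  have stepy: "(\<lambda>i. (\<eta>1 i - \<eta> i) - \<gamma>' i * (G (\<xi> i) - \<eta> i)) \<in> O[F](?E)"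
  proof -
    obtain c where c: "c > 0" "eventually (\<lambda>i. c * u i ^ (k + 1) \<le> \<bar>y1 i\<bar>) F" using Y(5) by blast
    have "(\<lambda>i. (y1 i * (\<eta>1 i - \<eta> i) - (y1 i - y i) * (G (\<xi> i) - \<eta> i)) / y1 i) \<in> O[F](?E)"
    proof (rule bigo_divide[OF _ c])
      have 1: "2 * k = k + 1 + (k - 1)" "2 * k + 1 = k + 1 + k" using k by simp_all
      have eq: "u i ^ (2 * k) * \<delta> i + u i ^ (2 * k + 1) * D i = u i ^ (k + 1) * ?E i" for i
      proof -
        have "u i ^ (2 * k) = u i ^ (k + 1) * u i ^ (k - 1)" "u i ^ (2 * k + 1) = u i ^ (k + 1) * u i ^ k"
          using 1 power_add by metis+
        then show ?thesis by (simp only: distrib_left mult.assoc add.commute)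
      qed
      show "(\<lambda>i. y1 i * (\<eta>1 i - \<eta> i) - (y1 i - y i) * (G (\<xi> i) - \<eta> i))
          \<in> O[F](\<lambda>i. u i ^ (k + 1) * ?E i)" using eqy by (simp only: eq G_def)
    qed
    moreover have "eventually (\<lambda>i. (\<eta>1 i - \<eta> i) - \<gamma>' i * (G (\<xi> i) - \<eta> i) =
        (y1 i * (\<eta>1 i - \<eta> i) - (y1 i - y i) * (G (\<xi> i) - \<eta> i)) / y1 i) F"
      using c(2) ev01
    proof eventually_elim
      case (elim i)
      then have "c * u i ^ (k + 1) > 0" using c(1) by simp
      then have "y1 i \<noteq> 0" using elim by auto
      then show ?case by (simp add: \<gamma>'_def field_simps)
    qed
    ultimately show ?thesis using bigo_eventually_eq by fast
  qed
  have diffx: "(\<lambda>i. \<eta> i - \<xi> i) \<in> O[F](D)" by (rule sum_in_bigo(2)[OF \<eta>D \<xi>D])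
  have diffy: "(\<lambda>i. G (\<xi> i) - \<eta> i) \<in> O[F](D)" by (rule sum_in_bigo(2)[OF GD \<eta>D])
  have d\<xi>: "(\<lambda>i. \<xi>1 i - \<xi> i) \<in> O[F](\<lambda>i. u i ^ (k - 1) * D i)"
    using sum_in_bigo(1)[OF landau_o.big_trans[OF stepx ED] landau_o.big.mult[OF X(3)[folded \<gamma>_def] diffx]] by simp
  have d\<eta>: "(\<lambda>i. \<eta>1 i - \<eta> i) \<in> O[F](\<lambda>i. u i ^ (k - 1) * D i)"
    using sum_in_bigo(1)[OF landau_o.big_trans[OF stepy ED] landau_o.big.mult[OF Y(3)[folded \<gamma>'_def] diffy]] by simp
  have dG: "(\<lambda>i. G (\<xi>1 i) - G (\<xi> i)) \<in> O[F](\<lambda>i. u i ^ (k - 1) * D i)"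
    by (rule landau_o.big_trans[OF _ d\<xi>], rule bigoI[of _ R])
       (use bd in \<open>eventually_elim, simp add: G_lip\<close>)
  have S1: "(\<lambda>i. a1 i - a i + 2 * h i * (\<eta> i - \<xi> i)) \<in> O[F](?E)"
    unfolding a_def a1_def h_def
    using adjusted_increment[OF k nonneg X(4)[folded \<gamma>_def] X(2) stepx diffx d\<xi> d\<eta>] by simp
  have S2: "(\<lambda>i. b1 i - b i + (real k + 1) * h i * (G (\<xi> i) - \<eta> i)) \<in> O[F](?E)"
    unfolding b_def b1_def h_def
    using adjusted_increment[OF k nonneg Y(4)[folded \<gamma>'_def] Y(2) stepy diffy d\<eta> dG] by (simp add: add.commute)
  have S3: "(\<lambda>i. \<xi> i - a i) \<in> O[F](\<lambda>i. u i * D i)"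
    unfolding a_def using landau_o.big.mult[OF X(1) diffx] by simp
  have S4: "(\<lambda>i. \<eta> i - b i) \<in> O[F](\<lambda>i. u i * D i)"
    unfolding b_def using landau_o.big.mult[OF Y(1) diffy] by simp
  have hO: "h \<in> O[F](\<lambda>i. u i ^ (k - 1))" by (simp add: h_def[abs_def])
  have uk: "u i ^ (k - 1) * (u i * D i) = u i ^ k * D i" for i
    using k power_minus_mult[of k "u i"] by (simp add: mult.assoc[symmetric])
  have S3': "(\<lambda>i. h i * (\<xi> i - a i)) \<in> O[F](?E)" and S4': "(\<lambda>i. h i * (\<eta> i - b i)) \<in> O[F](?E)"
    using landau_o.big.mult[OF hO S3] landau_o.big.mult[OF hO S4] landau_o.big_trans[OF _ DE]
    unfolding uk by blast+
  have cm: "(\<lambda>i. v * f i) \<in> O[F](?E)" if "f \<in> O[F](?E)" for f v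
    using that by (cases "v = 0") auto
  have EP: "(\<lambda>i. P1 i - P i - h i * ((2 * real k + 2) * P i + 2 * (real k + 1) * (G (\<xi> i) - real k * \<xi> i))) \<in> O[F](?E)"
  proof -
    have "(\<lambda>i. (real k + 1) * (a1 i - a i + 2 * h i * (\<eta> i - \<xi> i)) - 2 * (b1 i - b i + (real k + 1) * h i * (G (\<xi> i) - \<eta> i))
       + ((2 * (real k + 1) * (real k + 1)) * (h i * (\<xi> i - a i)) - (4 * (real k + 1)) * (h i * (\<eta> i - b i)))) \<in> O[F](?E)"
      by (rule sum_in_bigo(1)[OF sum_in_bigo(2)[OF cm[OF S1] cm[OF S2]] sum_in_bigo(2)[OF cm[OF S3'] cm[OF S4']]])
    moreover have "P1 i - P i - h i * ((2 * real k + 2) * P i + 2 * (real k + 1) * (G (\<xi> i) - real k * \<xi> i)) =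
      (real k + 1) * (a1 i - a i + 2 * h i * (\<eta> i - \<xi> i)) - 2 * (b1 i - b i + (real k + 1) * h i * (G (\<xi> i) - \<eta> i))
       + ((2 * (real k + 1) * (real k + 1)) * (h i * (\<xi> i - a i)) - (4 * (real k + 1)) * (h i * (\<eta> i - b i)))" for i
      unfolding P_def P1_def by (simp add: algebra_simps)
    ultimately show ?thesis by simp
  qed
  have EQ: "(\<lambda>i. Q1 i - Q i + h i * ((real k - 1) * Q i + (real k + 1) * (G (\<xi> i) - real k * \<xi> i))) \<in> O[F](?E)"
  proof -
    have "(\<lambda>i. real k * (a1 i - a i + 2 * h i * (\<eta> i - \<xi> i)) + (b1 i - b i + (real k + 1) * h i * (G (\<xi> i) - \<eta> i))
       - (((real k - 1) * real k) * (h i * (\<xi> i - a i)) + (real k - 1) * (h i * (\<eta> i - b i)))) \<in> O[F](?E)"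
      by (rule sum_in_bigo(2)[OF sum_in_bigo(1)[OF cm[OF S1] S2] sum_in_bigo(1)[OF cm[OF S3'] cm[OF S4']]])
    moreover have "Q1 i - Q i + h i * ((real k - 1) * Q i + (real k + 1) * (G (\<xi> i) - real k * \<xi> i)) =
      real k * (a1 i - a i + 2 * h i * (\<eta> i - \<xi> i)) + (b1 i - b i + (real k + 1) * h i * (G (\<xi> i) - \<eta> i))
       - (((real k - 1) * real k) * (h i * (\<xi> i - a i)) + (real k - 1) * (h i * (\<eta> i - b i)))" for i
      unfolding Q_def Q1_def by (simp add: algebra_simps)
    ultimately show ?thesis by simp
  qed
  obtain C1 where C1: "C1 > 0" "eventually (\<lambda>i. \<bar>P1 i - P i - h i * ((2 * real k + 2) * P i + 2 * (real k + 1) * (G (\<xi> i) - real k * \<xi> i))\<bar> \<le> C1 * \<bar>?E i\<bar>) F"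
    using EP by (auto elim!: landau_o.bigE)
  obtain C2 where C2: "C2 > 0" "eventually (\<lambda>i. \<bar>Q1 i - Q i + h i * ((real k - 1) * Q i + (real k + 1) * (G (\<xi> i) - real k * \<xi> i))\<bar> \<le> C2 * \<bar>?E i\<bar>) F"
    using EQ by (auto elim!: landau_o.bigE)
  define C3 where "C3 = C1 + C2 + \<bar>C\<bar>"
  have C3: "C3 > 0" "C1 \<le> C3" "C2 \<le> C3" "C \<le> C3" using C1 C2 by (auto simp: C3_def)
  \<comment> \<open>With these choices each of the two error terms is at most \<open>h * P / 8\<close>.\<close>
  define c where "c = min 1 (r / (8 * C3))"
  have c: "c > 0" "c \<le> 1" "C3 * c \<le> r / 8" using r C3 by (auto simp: c_def min_def field_simps)
  define \<epsilon> where "\<epsilon> = min 1 (min (1 / (6 * r)) (c * r / (72 * C3)))"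
  have \<epsilon>: "\<epsilon> > 0" "\<epsilon> \<le> 1" "\<epsilon> * r \<le> 1/6" "C3 * (9 * \<epsilon>) \<le> c * r / 8"
    "C3 * (9 * \<epsilon>) \<le> r / 8"
  proof -
    show "\<epsilon> > 0" "\<epsilon> \<le> 1" using r c C3 by (auto simp: \<epsilon>_def)
    have "\<epsilon> \<le> 1 / (6 * r)" by (simp add: \<epsilon>_def)
    then show "\<epsilon> * r \<le> 1/6" using r by (simp add: field_simps)
    have "\<epsilon> \<le> c * r / (72 * C3)" by (simp add: \<epsilon>_def)
    then show *: "C3 * (9 * \<epsilon>) \<le> c * r / 8" using C3 by (simp add: field_simps)
    have "c * r / 8 \<le> r / 8" using c r by simp
    with * show "C3 * (9 * \<epsilon>) \<le> r / 8" by linarith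
  qed
  have near: "eventually (\<lambda>i. \<bar>\<alpha> i\<bar> * (real k + 1) \<le> 1/16 \<and> \<bar>\<beta> i\<bar> * (R + 1) \<le> 1/16) F"
  proof -
    have "\<alpha> \<in> O[F](\<lambda>i. u i ^ Suc 0 * 1)" "\<beta> \<in> O[F](\<lambda>i. u i ^ Suc 0 * 1)" using X(1) Y(1) by simp_all
    moreover have "0 < 1/16 / (real k + 1)" "0 < 1/16 / (\<bar>R\<bar> + 1)" by (simp_all add: add_nonneg_pos)
    ultimately have "eventually (\<lambda>i. \<bar>\<alpha> i\<bar> \<le> 1/16 / (real k + 1)) F" "eventually (\<lambda>i. \<bar>\<beta> i\<bar> \<le> 1/16 / (\<bar>R\<bar> + 1)) F"
      using bigo_small[of \<alpha> 0 "\<lambda>_. 1" "1/16 / (real k + 1)"] bigo_small[of \<beta> 0 "\<lambda>_. 1" "1/16 / (\<bar>R\<bar> + 1)"]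
      by simp_all
    then show ?thesis
    proof eventually_elim
      case (elim i)
      have "\<bar>\<beta> i\<bar> * (R + 1) \<le> \<bar>\<beta> i\<bar> * (\<bar>R\<bar> + 1)" by (intro mult_left_mono) auto
      also have "\<dots> \<le> 1/16" using elim(2) by (simp add: pos_le_divide_eq add_nonneg_pos algebra_simps)
      finally show ?case using elim(1) by (simp add: pos_le_divide_eq algebra_simps)
    qed
  qed
  have u1ev: "eventually (\<lambda>i. \<bar>u1 i - u i + r * u i ^ k\<bar> \<le> r * u i ^ k) F"
  proof -
    have "(\<lambda>i. u1 i - u i + r * u i ^ k) \<in> O[F](\<lambda>i. u i ^ Suc k * 1)" using du by simp
    from bigo_small[OF this r] show ?thesis by simp
  qed
  have "eventually (\<lambda>i. expanding_step c (2 * (real k + 3)) k \<kappa>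
    (u i) (x i) (y i) (\<xi> i) (\<eta> i) (\<delta> i) (u1 i) (x1 i) (y1 i) (\<xi>1 i) (\<eta>1 i) (\<delta>1 i)) F"
    using bd nonneg C1(2) C2(2) near u1ev eqd eventually_small[OF \<epsilon>(1)]
  proof eventually_elim
    case (elim i)
    note el = elim
    define S where "S = \<bar>\<xi> i\<bar> + \<bar>\<eta> i\<bar>"
    have S0: "S \<ge> 0" by (simp add: S_def)
    have u: "0 < u i" "u i < \<epsilon>" using el(8) by auto
    have \<alpha>: "\<bar>\<alpha> i\<bar> \<le> 1/16"
    proof -
      have "\<bar>\<alpha> i\<bar> * 1 \<le> \<bar>\<alpha> i\<bar> * (real k + 1)" by (intro mult_left_mono) auto
      then show ?thesis using el(5) by linarith
    qed
    have ax: "\<bar>\<xi> i - a i\<bar> \<le> S / 8"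
    proof -
      have "\<bar>\<xi> i - a i\<bar> = \<bar>\<alpha> i\<bar> * \<bar>\<eta> i - \<xi> i\<bar>" by (simp add: a_def abs_mult)
      also have "\<dots> \<le> 1/16 * (2 * S)" using \<alpha> by (intro mult_mono) (auto simp: S_def)
      finally show ?thesis by simp
    qed
    have be: "\<bar>\<eta> i - b i\<bar> \<le> S / 8"
    proof -
      have "\<bar>G (\<xi> i)\<bar> \<le> R * \<bar>\<xi> i\<bar>" using G_lip[of "\<xi> i" 0] el(1) by (auto simp: G_def)
      moreover have M0: "R \<ge> 0" using el(1) by (auto simp: R_def)
      ultimately have "\<bar>G (\<xi> i) - \<eta> i\<bar> \<le> R * S + S"
        using mult_left_mono[of "\<bar>\<xi> i\<bar>" S R] abs_triangle_ineq4[of "G (\<xi> i)" "\<eta> i"]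
        unfolding S_def by linarith
      then have GS: "\<bar>G (\<xi> i) - \<eta> i\<bar> \<le> (R + 1) * S" by (simp add: distrib_right)
      have "\<bar>\<eta> i - b i\<bar> = \<bar>\<beta> i\<bar> * \<bar>G (\<xi> i) - \<eta> i\<bar>" by (simp add: b_def abs_mult)
      also have "\<dots> \<le> \<bar>\<beta> i\<bar> * ((R + 1) * S)" by (intro mult_left_mono GS) auto
      also have "\<dots> = (\<bar>\<beta> i\<bar> * (R + 1)) * S" by simp
      also have "\<dots> \<le> 1/16 * S" using el(5) S0 by (intro mult_right_mono) auto
      finally show ?thesis using S0 by simp
    qed
    have kr: "real k \<ge> 2" using k by simp
    have third: "P i \<le> (2 * (real k + 3)) * S"
    proof -
      have "\<bar>a i\<bar> \<le> \<bar>\<xi> i\<bar> + \<bar>\<xi> i - a i\<bar>" "\<bar>b i\<bar> \<le> \<bar>\<eta> i\<bar> + \<bar>\<eta> i - b i\<bar>" by linarith+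
      moreover have "\<bar>\<xi> i\<bar> \<le> S" "\<bar>\<eta> i\<bar> \<le> S" by (auto simp: S_def)
      ultimately have ab: "\<bar>a i\<bar> \<le> 2 * S" "\<bar>b i\<bar> \<le> 2 * S" using ax be S0 by auto
      have "P i \<le> (real k + 1) * \<bar>a i\<bar> + 2 * \<bar>b i\<bar>"
        unfolding P_def using mult_left_mono[of "a i" "\<bar>a i\<bar>" "real k + 1"] abs_ge_minus_self[of "b i"]
        by linarith
      also have "\<dots> \<le> (real k + 1) * (2 * S) + 2 * (2 * S)" using ab by (intro add_mono mult_left_mono) auto
      finally show ?thesis by (simp add: algebra_simps)
    qed
    have second: "in_cone c k \<kappa> (u i) (x i) (y i) (\<xi> i) (\<eta> i) (\<delta> i)" if z: "\<xi> i = 0 \<and> \<delta> i = 0 \<and> \<eta> i < 0"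
    proof -
      have S: "S = - \<eta> i" using z by (simp add: S_def)
      have aa: "a i = - (\<alpha> i * \<eta> i)" and bb: "b i = \<eta> i + \<beta> i * \<eta> i" using z by (simp_all add: a_def b_def G_def)
      have R0: "R \<ge> 0" using el(1) by (auto simp: R_def)
      have \<beta>: "\<bar>\<beta> i\<bar> \<le> 1/16"
      proof -
        have "\<bar>\<beta> i\<bar> * 1 \<le> \<bar>\<beta> i\<bar> * (R + 1)" using R0 by (intro mult_left_mono) auto
        then show ?thesis using el(5) by linarith
      qed
      have \<alpha>k: "\<bar>(real k + 1) * (\<alpha> i * S)\<bar> \<le> 1/16 * S" "\<bar>real k * (\<alpha> i * S)\<bar> \<le> 1/16 * S"
      proof -
        have "\<bar>(real k + 1) * (\<alpha> i * S)\<bar> = (\<bar>\<alpha> i\<bar> * (real k + 1)) * S" using S0 by (simp add: abs_mult)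
        also have "\<dots> \<le> 1/16 * S" using el(5) S0 by (intro mult_right_mono) auto
        finally show *: "\<bar>(real k + 1) * (\<alpha> i * S)\<bar> \<le> 1/16 * S" .
        have "\<bar>real k * (\<alpha> i * S)\<bar> \<le> \<bar>(real k + 1) * (\<alpha> i * S)\<bar>" by (simp add: abs_mult mult_right_mono)
        with * show "\<bar>real k * (\<alpha> i * S)\<bar> \<le> 1/16 * S" by linarith
      qed
      have \<beta>S: "\<bar>\<beta> i * S\<bar> \<le> 1/16 * S" using mult_right_mono[OF \<beta> S0] S0 by (simp add: abs_mult)
      have Peq: "P i = (real k + 1) * (\<alpha> i * S) + 2 * S + 2 * (\<beta> i * S)"
        and Qeq: "Q i = real k * (\<alpha> i * S) - S - \<beta> i * S"
        using aa bb by (simp_all add: P_def Q_def S algebra_simps)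
      have "S > 0" using z S by simp
      then have "P i > 0" "\<bar>Q i\<bar> \<le> P i" using \<alpha>k \<beta>S unfolding Peq Qeq by linarith+
      then show ?thesis unfolding in_cone_def PQ using z c(1) by simp
    qed
    have first: "in_cone c k \<kappa> (u1 i) (x1 i) (y1 i) (\<xi>1 i) (\<eta>1 i) (\<delta>1 i) \<and> P i * u i \<le> P1 i * u1 i"
      if cone: "in_cone c k \<kappa> (u i) (x i) (y i) (\<xi> i) (\<eta> i) (\<delta> i)"
    proof -
      have P: "P i > 0" "\<bar>Q i\<bar> \<le> P i" "\<delta> i \<le> c * P i" using cone by (auto simp: in_cone_def PQ)
      have aP: "\<bar>a i\<bar> \<le> P i" "\<bar>b i\<bar> \<le> P i"
      proof -
        have "(3 * real k + 1) * a i = P i + 2 * Q i" by (simp add: P_def Q_def algebra_simps)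
        then have "(3 * real k + 1) * \<bar>a i\<bar> = \<bar>P i + 2 * Q i\<bar>" by (metis abs_mult abs_of_nonneg add_nonneg_nonneg mult_nonneg_nonneg of_nat_0_le_iff zero_le_numeral zero_le_one)
        also have "\<dots> \<le> 3 * P i" using P by linarith
        also have "\<dots> \<le> (3 * real k + 1) * P i" using P kr by (intro mult_right_mono) auto
        finally show "\<bar>a i\<bar> \<le> P i" using kr by (simp add: mult_le_cancel_left)
        have "(3 * real k + 1) * b i = (real k + 1) * Q i - real k * P i" by (simp add: P_def Q_def algebra_simps)
        then have "(3 * real k + 1) * \<bar>b i\<bar> = \<bar>(real k + 1) * Q i - real k * P i\<bar>" by (metis abs_mult abs_of_nonneg add_nonneg_nonneg mult_nonneg_nonneg of_nat_0_le_iff zero_le_numeral zero_le_one)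
        also have "\<dots> \<le> (real k + 1) * \<bar>Q i\<bar> + real k * \<bar>P i\<bar>"
          by (rule order_trans[OF abs_triangle_ineq4]) (simp add: abs_mult)
        also have "\<dots> \<le> (real k + 1) * P i + real k * P i" using P by (intro add_mono mult_left_mono) auto
        also have "\<dots> \<le> (3 * real k + 1) * P i" using P by (simp add: algebra_simps)
        finally show "\<bar>b i\<bar> \<le> P i" using kr by (simp add: mult_le_cancel_left)
      qed
      have "\<bar>\<xi> i\<bar> \<le> \<bar>a i\<bar> + \<bar>\<xi> i - a i\<bar>" "\<bar>\<eta> i\<bar> \<le> \<bar>b i\<bar> + \<bar>\<eta> i - b i\<bar>" by linarith+
      then have "\<bar>\<xi> i\<bar> \<le> P i + S / 8" "\<bar>\<eta> i\<bar> \<le> P i + S / 8" using ax be aP by auto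
      then have "S \<le> (P i + S / 8) + (P i + S / 8)" unfolding S_def by (rule add_mono)
      then have S: "S \<le> 4 * P i" using P by simp
      have D: "D i \<le> 9 * P i"
        using S P mult_right_mono[OF c(2), of "P i"] unfolding D_def S_def by linarith
      have hpos: "0 < h i" using u r by (simp add: h_def)
      have hsm: "h i \<le> 1/6"
      proof -
        have "u i ^ (k - 1) \<le> u i ^ 1" using u \<epsilon> k by (intro power_decreasing) auto
        then have "h i \<le> r * \<epsilon>" using r u by (simp add: h_def)
        then show ?thesis using \<epsilon>(3) by (simp add: mult.commute)
      qed
      have huk: "u i ^ k = u i * u i ^ (k - 1)" using k by (metis Suc_diff_1 power_Suc pos2 order_less_le_trans)
      have ukD: "C3 * (u i ^ k * D i) \<le> (C3 * (9 * \<epsilon>) / r) * (h i * P i)"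
      proof -
        have "C3 * (u i ^ k * D i) \<le> C3 * (u i ^ k * (9 * P i))"
          using C3 u D by (intro mult_left_mono) auto
        also have "\<dots> = (C3 * 9 * u i ^ (k - 1) * P i) * u i" by (simp add: huk)
        also have "\<dots> \<le> (C3 * 9 * u i ^ (k - 1) * P i) * \<epsilon>"
          using C3 u P by (intro mult_left_mono) auto
        also have "\<dots> = (C3 * (9 * \<epsilon>) / r) * (h i * P i)" using r by (simp add: h_def)
        finally show ?thesis .
      qed
      have hP: "h i * P i > 0" using hpos P by simp
      have ukD1: "C3 * (u i ^ k * D i) \<le> 1/8 * (h i * P i)"
        by (rule order_trans[OF ukD mult_right_mono]) (use \<epsilon>(5) r hP in \<open>auto simp: field_simps\<close>)
      have ukD2: "C3 * (u i ^ k * D i) \<le> c * (h i * P i)"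
      proof (rule order_trans[OF ukD mult_right_mono])
        have "0 < c * r" using c r by simp
        then have "C3 * (9 * \<epsilon>) \<le> c * r" using \<epsilon>(4) by linarith
        then show "C3 * (9 * \<epsilon>) / r \<le> c" using r by (simp add: pos_divide_le_eq)
      qed (use hP in simp)
      have E\<delta>: "C3 * (u i ^ (k - 1) * \<delta> i) \<le> 1/8 * (h i * P i)"
      proof -
        have "C3 * (u i ^ (k - 1) * \<delta> i) \<le> C3 * (u i ^ (k - 1) * (c * P i))"
          using C3 u P by (intro mult_left_mono) auto
        also have "\<dots> = (C3 * c) * (u i ^ (k - 1) * P i)" by simp
        also have "\<dots> \<le> (r / 8) * (u i ^ (k - 1) * P i)" using c u P by (intro mult_right_mono) auto
        finally show ?thesis by (simp add: h_def)
      qed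
      have Enn: "?E i \<ge> 0" using el(2) u by simp
      have EE: "C3 * \<bar>?E i\<bar> \<le> h i * P i / 4"
        using ukD1 E\<delta> Enn by (simp add: distrib_left)
      have N: "G (\<xi> i) - real k * \<xi> i \<ge> 0"
        using Bernoulli_inequality[of "\<xi> i" k] el(1) by (simp add: G_def)
      have "P1 i > 0 \<and> \<bar>Q1 i\<bar> \<le> P1 i \<and> \<delta>1 i \<le> c * P1 i \<and> P i * u i \<le> P1 i * u1 i"
      proof (rule cone_step_arithmetic[OF kr hpos hsm N c(1) u(1) P])
        have "C1 * \<bar>?E i\<bar> \<le> C3 * \<bar>?E i\<bar>" "C2 * \<bar>?E i\<bar> \<le> C3 * \<bar>?E i\<bar>"
          using C3 by (auto intro: mult_right_mono)
        then show "\<bar>P1 i - P i - h i * ((2 * real k + 2) * P i + 2 * (real k + 1) * (G (\<xi> i) - real k * \<xi> i))\<bar> \<le> h i * P i / 4"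
          "\<bar>Q1 i - Q i + h i * ((real k - 1) * Q i + (real k + 1) * (G (\<xi> i) - real k * \<xi> i))\<bar> \<le> h i * P i / 4"
          using el(3,4) EE by linarith+
        have "C * (u i ^ k * D i) \<le> C3 * (u i ^ k * D i)" using C3 el(2) u by (intro mult_right_mono) auto
        then show "\<delta>1 i \<le> \<delta> i + c * (h i * P i)" using el(7) ukD2 by linarith
        show "u i * (1 - 2 * h i) \<le> u1 i"
          using el(6) by (simp add: h_def huk algebra_simps abs_le_iff)
      qed
      then show ?thesis by (simp add: in_cone_def PQ)
    qed
    show ?case unfolding expanding_step_def PQ using first second third by (simp add: S_def)
  qed
  then show ?thesis using c(1) by blast
qed

end


section \<open>Orbits on stable manifolds\<close>

text \<open>
  An orbit of the lifted map that follows a stable manifold with leading coefficients \<open>\<kappa>\<close> and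
  \<open>- r\<close>.  Only one constant \<open>C\<close> is used, so that estimates become uniform over all such orbits.
\<close>

definition stable_orbit ::
    "nat \<Rightarrow> ('v::real_normed_vector \<Rightarrow> real) \<Rightarrow> ('v \<Rightarrow> real) \<Rightarrow> (real \<Rightarrow> real \<Rightarrow> 'v \<Rightarrow> real) \<Rightarrow>
     (real \<Rightarrow> real \<Rightarrow> 'v \<Rightarrow> 'v) \<Rightarrow> 'v \<Rightarrow> real \<Rightarrow> real \<Rightarrow> real \<Rightarrow>
     (nat \<Rightarrow> real) \<Rightarrow> (nat \<Rightarrow> real) \<Rightarrow> (nat \<Rightarrow> real) \<Rightarrow> (nat \<Rightarrow> 'v) \<Rightarrow> bool"
  where "stable_orbit k c a A H \<omega> \<kappa> r C u x y T \<longleftrightarrow> (\<forall>n.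
    0 < u n \<and> \<bar>u (Suc n) - u n + r * u n ^ k\<bar> \<le> C * u n ^ (k + 1) \<and>
    \<bar>x n - (u n)\<^sup>2\<bar> \<le> C * u n ^ 3 \<and> \<bar>y n - \<kappa> * u n ^ (k + 1)\<bar> \<le> C * u n ^ (k + 2) \<and>
    x (Suc n) = x n + c (T n) * y n \<and>
    y (Suc n) = y n + a (T n) * x n ^ k + A (x n) (y n) (T n) \<and>
    T (Suc n) = T n + \<omega> + H (x n) (y n) (T n))"

lemma stable_orbit_sizes:
  fixes w x y C \<kappa> :: real
  assumes w: "0 < w" and C: "2 * C * w \<le> 1" "2 * C * w \<le> \<bar>\<kappa>\<bar>"
    and x: "\<bar>x - w\<^sup>2\<bar> \<le> C * w ^ 3" and y: "\<bar>y - \<kappa> * w ^ (k + 1)\<bar> \<le> C * w ^ (k + 2)"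
  shows "w\<^sup>2 / 2 \<le> x" "x \<le> 2 * w\<^sup>2" "\<bar>\<kappa>\<bar> / 2 * w ^ (k + 1) \<le> \<bar>y\<bar>" "\<bar>y\<bar> \<le> 2 * \<bar>\<kappa>\<bar> * w ^ (k + 1)"
proof -
  have "C * w * w\<^sup>2 \<le> 1/2 * w\<^sup>2" using C by (intro mult_right_mono) auto
  then have "\<bar>x - w\<^sup>2\<bar> \<le> w\<^sup>2 / 2" using x by (simp add: power2_eq_square power3_eq_cube mult_ac)
  then have "x - w\<^sup>2 \<le> w\<^sup>2 / 2" "- (x - w\<^sup>2) \<le> w\<^sup>2 / 2" by (simp_all only: abs_le_iff)
  then show "w\<^sup>2 / 2 \<le> x" "x \<le> 2 * w\<^sup>2" using zero_le_power2[of w] by linarith+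
  have "C * w * w ^ (k + 1) \<le> \<bar>\<kappa>\<bar> / 2 * w ^ (k + 1)" using C w by (intro mult_right_mono) auto
  then have "\<bar>y - \<kappa> * w ^ (k + 1)\<bar> \<le> \<bar>\<kappa>\<bar> / 2 * w ^ (k + 1)" using y by (simp add: mult_ac)
  moreover have "\<bar>\<kappa> * w ^ (k + 1)\<bar> = \<bar>\<kappa>\<bar> * w ^ (k + 1)" using w by (simp add: abs_mult)
  moreover have "\<bar>y\<bar> \<le> \<bar>\<kappa> * w ^ (k + 1)\<bar> + \<bar>y - \<kappa> * w ^ (k + 1)\<bar>"
    "\<bar>\<kappa> * w ^ (k + 1)\<bar> \<le> \<bar>y\<bar> + \<bar>y - \<kappa> * w ^ (k + 1)\<bar>" by linarith+
  moreover have "0 \<le> \<bar>\<kappa>\<bar> * w ^ (k + 1)" using w by simp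
  ultimately show "\<bar>\<kappa>\<bar> / 2 * w ^ (k + 1) \<le> \<bar>y\<bar>" "\<bar>y\<bar> \<le> 2 * \<bar>\<kappa>\<bar> * w ^ (k + 1)" by linarith+
qed

lemma parameter_decrease:
  fixes u :: "nat \<Rightarrow> real"
  assumes step: "\<And>n. 0 < u n \<and> \<bar>u (Suc n) - u n + r * u n ^ k\<bar> \<le> C * u n ^ (k + 1)"
    and C: "C \<ge> 0" and r: "r > 0" and small: "C * u 0 \<le> r / 2"
  shows "u (Suc n) \<le> u n - r / 2 * u n ^ k" "u n - 2 * r * u n ^ k \<le> u (Suc n)" "u n \<le> u 0"
proof -
  have one: "u (Suc n) \<le> u n - r / 2 * u n ^ k \<and> u n - 2 * r * u n ^ k \<le> u (Suc n)" if "u n \<le> u 0" for n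
  proof -
    have "C * u n ^ (k + 1) = (C * u n) * u n ^ k" by simp
    also have "\<dots> \<le> (r / 2) * u n ^ k"
      using mult_left_mono[OF that C] small step[of n] by (intro mult_right_mono) auto
    finally have "\<bar>u (Suc n) - u n + r * u n ^ k\<bar> \<le> (r / 2) * u n ^ k" using step[of n] by linarith
    then have "u (Suc n) - u n + r * u n ^ k \<le> (r / 2) * u n ^ k"
      "- (u (Suc n) - u n + r * u n ^ k) \<le> (r / 2) * u n ^ k" by (simp_all only: abs_le_iff)
    moreover have "0 \<le> r * u n ^ k" using r step[of n] by (simp add: less_imp_le)
    ultimately show ?thesis by simp
  qed
  show le: "u n \<le> u 0" for n
  proof (induction n)
    case (Suc n)
    have "0 \<le> r / 2 * u n ^ k" using r step[of n] by (simp add: less_imp_le)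
    then show ?case using one[OF Suc] Suc by linarith
  qed simp
  show "u (Suc n) \<le> u n - r / 2 * u n ^ k" "u n - 2 * r * u n ^ k \<le> u (Suc n)"
    using one[OF le] by auto
qed

lemma parameter_tendsto_0:
  fixes u :: "nat \<Rightarrow> real"
  assumes pos: "\<And>n. 0 < u n" and dec: "\<And>n. u (Suc n) \<le> u n - r * u n ^ k" and r: "r > 0"
  shows "u \<longlonglongrightarrow> 0"
proof -
  have "u (Suc n) \<le> u n" for n
  proof -
    have "0 \<le> r * u n ^ k" using r pos[of n] by simp
    then show ?thesis using dec[of n] by linarith
  qed
  then have "decseq u" by (simp add: decseq_Suc_iff)
  then obtain L where L: "u \<longlonglongrightarrow> L"
    using decseq_convergent[of u 0] pos less_imp_le by metis
  have L0: "L \<ge> 0" using LIMSEQ_le_const[OF L] pos less_imp_le by blast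
  have "(\<lambda>n. u n - r * u n ^ k) \<longlonglongrightarrow> L - r * L ^ k" by (intro tendsto_intros L)
  then have "L \<le> L - r * L ^ k"
    using LIMSEQ_le[OF LIMSEQ_Suc[OF L]] dec by blast
  then have "r * L ^ k \<le> 0" by simp
  then have "L ^ k \<le> 0" using r by (simp add: mult_le_0_iff)
  then have "L = 0" using L0 by (metis less_eq_real_def not_less zero_less_power)
  then show ?thesis using L by simp
qed

text \<open>
  Different leading coefficients \<open>r\<close> and \<open>r'\<close> change the asymptotic parameter only by a constant
  factor.  If \<open>v\<close> is between \<open>m u\<close> and \<open>2 m u\<close>, its decrease \<open>r' / 2 v ^ k\<close> is at least the decrease
  \<open>2 m (2 r u ^ k)\<close> of the barrier \<open>2 m u\<close>, provided that \<open>m ^ (k - 1) \<ge> 8 r / r'\<close>; if \<open>v\<close> is smaller, it is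
  still below the barrier after one step because \<open>u\<close> is at most halved.
\<close>

lemma parameters_comparable:
  fixes u v :: "nat \<Rightarrow> real"
  assumes k: "k \<ge> 2" and r: "r > 0" "r' > 0"
    and u: "\<And>n. 0 < u n" "\<And>n. u n - 2 * r * u n ^ k \<le> u (Suc n)" "\<And>n. u n \<le> u 0"
    and v: "\<And>n. 0 < v n" "\<And>n. v (Suc n) \<le> v n - r' / 2 * v n ^ k"
    and start: "v 0 \<le> 2 * u 0" and small: "u 0 \<le> 1" "4 * r * u 0 \<le> 1"
  shows "v n \<le> 2 * max 1 (8 * r / r') * u n"
proof -
  \<comment> \<open>Then \<open>8 * r \<le> r\' * m \<le> r\' * m ^ (k - 1)\<close>, as needed for the barrier \<open>2 * m * u\<close>.\<close>
  define m where "m = max 1 (8 * r / r')"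
  have m: "m \<ge> 1" "8 * r \<le> r' * m" using r by (auto simp: m_def max_def field_simps)
  have "v n \<le> 2 * m * u n"
  proof (induction n)
    case 0
    have "2 * u 0 \<le> 2 * m * u 0" using m u(1)[of 0] by simp
    then show ?case using start by linarith
  next
    case (Suc n)
    have k1: "u n ^ k = u n ^ (k - 1) * u n" using k power_minus_mult[of k "u n"] by simp
    have ule: "u n ^ (k - 1) \<le> u n ^ 1"
      using u(1)[of n] u(3)[of n] small(1) k by (intro power_decreasing) auto
    have half: "u n / 2 \<le> u (Suc n)"
    proof -
      have "2 * r * u n ^ k = (2 * r * u n ^ (k - 1)) * u n" by (simp add: k1)
      also have "\<dots> \<le> (2 * r * u 0) * u n"
        using ule u(3)[of n] r u(1)[of n] by (intro mult_right_mono mult_left_mono) auto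
      also have "\<dots> \<le> (1 / 2) * u n" using small(2) u(1)[of n] by (intro mult_right_mono) auto
      finally show ?thesis using u(2)[of n] by linarith
    qed
    show ?case
    proof (cases "v n \<le> m * u n")
      case True
      have "0 \<le> r' / 2 * v n ^ k" using r v(1)[of n] by (simp add: less_imp_le)
      then have "v (Suc n) \<le> m * u n" using v(2)[of n] True by linarith
      also have "\<dots> \<le> m * (2 * u (Suc n))" using half m by (intro mult_left_mono) auto
      finally show ?thesis by (simp add: mult_ac)
    next
      case False
      have mk: "m \<le> m ^ (k - 1)" using m(1) k power_increasing[of 1 "k - 1" m] by simp
      have "2 * m * (2 * r * u n ^ k) = (8 * r) * (m * u n ^ k) / 2" by simp
      also have "\<dots> \<le> (r' * m) * (m * u n ^ k) / 2"
        using m u(1)[of n] by (intro divide_right_mono mult_right_mono) (auto simp: less_imp_le)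
      also have "\<dots> \<le> (r' * m ^ (k - 1)) * (m * u n ^ k) / 2"
        using mk m u(1)[of n] r by (intro divide_right_mono mult_right_mono mult_left_mono) (auto simp: less_imp_le)
      also have "\<dots> = r' / 2 * (m * u n) ^ k"
        using k power_minus_mult[of k m] by (simp add: power_mult_distrib mult_ac)
      also have "\<dots> \<le> r' / 2 * v n ^ k"
        using False m u(1)[of n] r by (intro mult_left_mono power_mono) auto
      finally have *: "2 * m * (2 * r * u n ^ k) \<le> r' / 2 * v n ^ k" .
      have "v (Suc n) \<le> 2 * m * u n - 2 * m * (2 * r * u n ^ k)" using v(2)[of n] Suc * by linarith
      also have "\<dots> = 2 * m * (u n - 2 * r * u n ^ k)" by (simp add: algebra_simps)
      also have "\<dots> \<le> 2 * m * u (Suc n)" using u(2)[of n] m by (intro mult_left_mono) auto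
      finally show ?thesis .
    qed
  qed
  then show ?thesis by (simp add: m_def)
qed

lemma weighted_lipschitz_angle_bounds:
  assumes "weighted_lipschitz q 0 (\<lambda>x y t. c t)"
  obtains K where "K \<ge> 0" "\<And>t. \<bar>c t\<bar> \<le> K" "\<And>t t'. \<bar>c t' - c t\<bar> \<le> K * norm (t' - t)"
proof -
  obtain \<epsilon> K where \<epsilon>: "\<epsilon> > 0" and K: "K \<ge> 0"
    and b: "\<And>u (x::real) (y::real) t x' y' t' D. 0 < u \<Longrightarrow> u < \<epsilon> \<Longrightarrow>
      weighted_close q 0 u D x y t x' y' t' \<Longrightarrow> \<bar>c t\<bar> \<le> K * u ^ 0 \<and> \<bar>c t' - c t\<bar> \<le> K * u ^ 0 * D"
    by (rule weighted_lipschitzE[OF assms order_refl], rule that)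
  have "\<bar>c t\<bar> \<le> K \<and> \<bar>c t' - c t\<bar> \<le> K * norm (t' - t)" for t t'
    using b[of "\<epsilon> / 2" "norm (t' - t)" 0 0 t 0 0 t'] \<epsilon> by (simp add: weighted_close_def)
  then show ?thesis using K that by blast
qed

text \<open>
  If \<open>\<kappa> = 0\<close>, the increments \<open>c y\<close> of \<open>x\<close> are \<open>O(u ^ (k + 2))\<close>, which is at most a multiple of
  \<open>u\<^sup>2\<close> times the decrease of \<open>u\<close>.  Their sum along the whole orbit is \<open>O(u 0 ^ 3)\<close>, too small to bring
  \<open>x\<close> from about \<open>u 0 ^ 2\<close> down to \<open>0\<close>.
\<close>

lemma stable_orbit_leading_coefficient:
  fixes c :: "'v::real_normed_vector \<Rightarrow> real"
  assumes k: "k \<ge> 2" and r: "r > 0" and C: "C \<ge> 0" and K: "\<And>t. \<bar>c t\<bar> \<le> K"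
  shows "\<exists>\<epsilon>>0. \<forall>u x y T. stable_orbit k c a A H \<omega> \<kappa> r C u x y T \<longrightarrow> u 0 < \<epsilon> \<longrightarrow> \<kappa> \<noteq> 0"
proof -
  have K0: "K \<ge> 0" using K[of 0] by linarith
  define L where "L = 2 * K * C / r"
  have L: "L \<ge> 0" using K0 C r by (simp add: L_def)
  define \<epsilon> where "\<epsilon> = min (r / (2 * (C + 1))) (1 / (2 * (L + C + 1)))"
  have \<epsilon>: "\<epsilon> > 0" using r C L by (auto simp: \<epsilon>_def)
  have "\<kappa> \<noteq> 0" if orb: "stable_orbit k c a A H \<omega> \<kappa> r C u x y T" and u0: "u 0 < \<epsilon>" for u x y T
  proof
    assume \<kappa>: "\<kappa> = 0"
    note o = orb[unfolded stable_orbit_def, rule_format]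
    have pos: "0 < u n" for n using o by blast
    have small: "C * u 0 \<le> r / 2"
    proof -
      have "u 0 < r / (2 * (C + 1))" using u0 by (simp add: \<epsilon>_def)
      then have "u 0 * (2 * (C + 1)) < r" using C by (subst (asm) pos_less_divide_eq) auto
      then show ?thesis using pos[of 0] by (simp add: algebra_simps)
    qed
    have st: "0 < u n \<and> \<bar>u (Suc n) - u n + r * u n ^ k\<bar> \<le> C * u n ^ (k + 1)" for n using o by blast
    note dec = parameter_decrease[OF st C r small]
    have lim: "u \<longlonglongrightarrow> 0" by (rule parameter_tendsto_0[where r = "r / 2" and k = k]) (use r pos dec(1) in auto)
    have inc: "\<bar>x (Suc n) - x n\<bar> \<le> L * (u 0)\<^sup>2 * (u n - u (Suc n))" for n
    proof -
      have "\<bar>x (Suc n) - x n\<bar> = \<bar>c (T n)\<bar> * \<bar>y n\<bar>" using o[of n] by (simp add: abs_mult)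
      also have "\<dots> \<le> K * (C * u n ^ (k + 2))" using K o[of n] \<kappa> K0 by (intro mult_mono) auto
      also have "\<dots> = K * C * (u n)\<^sup>2 * u n ^ k" by (simp add: power2_eq_square mult_ac)
      also have "\<dots> \<le> K * C * (u 0)\<^sup>2 * u n ^ k"
        using K0 C dec(3)[of n] pos[of n] by (intro mult_right_mono mult_left_mono power_mono) auto
      also have "\<dots> = L * (u 0)\<^sup>2 * (r / 2 * u n ^ k)" using r by (simp add: L_def)
      also have "\<dots> \<le> L * (u 0)\<^sup>2 * (u n - u (Suc n))"
        using dec(1)[of n] L by (intro mult_left_mono) auto
      finally show ?thesis .
    qed
    have tele: "\<bar>x n - x 0\<bar> \<le> L * (u 0)\<^sup>2 * (u 0 - u n)" for n
    proof (induction n)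
      case (Suc n)
      have "\<bar>x (Suc n) - x 0\<bar> \<le> \<bar>x (Suc n) - x n\<bar> + \<bar>x n - x 0\<bar>" by linarith
      also have "\<dots> \<le> L * (u 0)\<^sup>2 * (u n - u (Suc n)) + L * (u 0)\<^sup>2 * (u 0 - u n)"
        using inc[of n] Suc by linarith
      finally show ?case by (simp add: algebra_simps)
    qed simp
    have xlim: "x \<longlonglongrightarrow> 0"
    proof -
      have "(\<lambda>n. x n - (u n)\<^sup>2) \<longlonglongrightarrow> 0"
      proof (rule tendsto_rabs_zero_cancel, rule tendsto_sandwich[OF _ _ tendsto_const])
        show "(\<lambda>n. C * u n ^ 3) \<longlonglongrightarrow> 0" using tendsto_mult[OF tendsto_const[of C] tendsto_power[OF lim, of 3]] by simp
      qed (use o in auto)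
      then have "(\<lambda>n. (x n - (u n)\<^sup>2) + (u n)\<^sup>2) \<longlonglongrightarrow> 0 + 0\<^sup>2" by (intro tendsto_intros lim)
      then show ?thesis by simp
    qed
    have "(\<lambda>n. \<bar>x n - x 0\<bar>) \<longlonglongrightarrow> \<bar>0 - x 0\<bar>" by (intro tendsto_intros xlim)
    moreover have "(\<lambda>n. L * (u 0)\<^sup>2 * (u 0 - u n)) \<longlonglongrightarrow> L * (u 0)\<^sup>2 * (u 0 - 0)" by (intro tendsto_intros lim)
    ultimately have "\<bar>0 - x 0\<bar> \<le> L * (u 0)\<^sup>2 * (u 0 - 0)" by (rule LIMSEQ_le) (use tele in blast)
    moreover have "\<bar>x 0 - (u 0)\<^sup>2\<bar> \<le> C * (u 0) ^ 3" using o by blast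
    ultimately have "(u 0)\<^sup>2 \<le> L * (u 0)\<^sup>2 * u 0 + C * (u 0) ^ 3" by simp
    also have "\<dots> = (u 0)\<^sup>2 * ((L + C) * u 0)" by (simp add: power2_eq_square power3_eq_cube algebra_simps)
    finally have "1 \<le> (L + C) * u 0" using pos[of 0] by simp
    moreover have "u 0 < 1 / (2 * (L + C + 1))" using u0 by (simp add: \<epsilon>_def)
    then have "u 0 * (2 * (L + C + 1)) < 1" using L C by (subst (asm) pos_less_divide_eq) auto
    ultimately show False using pos[of 0] by (simp add: algebra_simps)
  qed
  then show ?thesis using \<epsilon> by blast
qed

context small_parameter
begin

lemma bigo_of_bound:
  fixes f g :: "'i \<Rightarrow> real"
  shows "eventually (\<lambda>i. \<bar>f i\<bar> \<le> C * g i) F \<Longrightarrow> f \<in> O[F](g)"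
  by (rule bigoI[of _ "\<bar>C\<bar>"], erule eventually_mono)
     (metis abs_ge_self abs_mult order_trans real_norm_def)

text \<open>
  The equations of the two orbits are subtracted.  In the equation for \<open>x\<close> the coefficient \<open>c\<close> at
  the angle of the first orbit is eliminated by \<open>c y = x1 - x\<close>, and in the equation for \<open>y\<close> similarly
  \<open>a x ^ k = y1 - y - A\<close>; the remaining terms are differences of \<open>c\<close>, \<open>a\<close>, \<open>A\<close> and \<open>H\<close> at
  nearby points.
\<close>

lemma orbit_pair_cone_step:
  fixes u1 x x1 y y1 x' x1' y' y1' :: "'i \<Rightarrow> real" and T T1 T' T1' :: "'i \<Rightarrow> real ^ 'd"
    and c a :: "real ^ 'd \<Rightarrow> real"
  defines "\<xi> \<equiv> \<lambda>i. x' i / x i - 1" and "\<xi>1 \<equiv> \<lambda>i. x1' i / x1 i - 1"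
    and "\<eta> \<equiv> \<lambda>i. y' i / y i - 1" and "\<eta>1 \<equiv> \<lambda>i. y1' i / y1 i - 1"
    and "\<delta> \<equiv> \<lambda>i. norm (T' i - T i)" and "\<delta>1 \<equiv> \<lambda>i. norm (T1' i - T1 i)"
  assumes k: "k \<ge> 2" and \<kappa>: "\<kappa> \<noteq> 0" and r: "r > 0" and C: "C \<ge> 0" and M: "M \<ge> 0"
    and c: "weighted_lipschitz (k + 1) 0 (\<lambda>x y t. c t)" and a: "weighted_lipschitz (k + 1) 0 (\<lambda>x y t. a t)"
    and A: "weighted_lipschitz (k + 1) (2 * k + 1) A"
    and H: "\<And>j. weighted_lipschitz (k + 1) k (\<lambda>x y t. H x y t $ j)"
    and u1: "eventually (\<lambda>i. 0 < u1 i \<and> u1 i \<le> u i \<and> \<bar>u1 i - u i + r * u i ^ k\<bar> \<le> C * u i ^ (k + 1)) F"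
    and x: "eventually (\<lambda>i. \<bar>x i - (u i)\<^sup>2\<bar> \<le> C * u i ^ 3 \<and> \<bar>x1 i - (u1 i)\<^sup>2\<bar> \<le> C * u1 i ^ 3) F"
    and y: "eventually (\<lambda>i. \<bar>y i - \<kappa> * u i ^ (k + 1)\<bar> \<le> C * u i ^ (k + 2) \<and>
      \<bar>y1 i - \<kappa> * u1 i ^ (k + 1)\<bar> \<le> C * u1 i ^ (k + 2)) F"
    and dyn: "eventually (\<lambda>i. x1 i = x i + c (T i) * y i \<and>
      y1 i = y i + a (T i) * x i ^ k + A (x i) (y i) (T i) \<and>
      T1 i = T i + \<omega> + H (x i) (y i) (T i) \<and>
      x1' i = x' i + c (T' i) * y' i \<and>
      y1' i = y' i + a (T' i) * x' i ^ k + A (x' i) (y' i) (T' i) \<and>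
      T1' i = T' i + \<omega> + H (x' i) (y' i) (T' i)) F"
    and bd': "eventually (\<lambda>i. 0 \<le> x' i \<and> x' i \<le> M * (u i)\<^sup>2 \<and> \<bar>x1' i\<bar> \<le> M * (u i)\<^sup>2 \<and> \<bar>y' i\<bar> \<le> M * u i ^ (k + 1)) F"
  shows "\<exists>c>0. \<exists>B. eventually (\<lambda>i. expanding_step c B k \<kappa>
    (u i) (x i) (y i) (\<xi> i) (\<eta> i) (\<delta> i) (u1 i) (x1 i) (y1 i) (\<xi>1 i) (\<eta>1 i) (\<delta>1 i)) F"
proof -
  define D where "D i = \<bar>\<xi> i\<bar> + \<bar>\<eta> i\<bar> + \<delta> i" for i
  note ev01 = eventually_small[of 1, OF zero_less_one]
  obtain Kc where Kc: "Kc \<ge> 0" "\<And>t. \<bar>c t\<bar> \<le> Kc" "\<And>t t'. \<bar>c t' - c t\<bar> \<le> Kc * norm (t' - t)"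
    using weighted_lipschitz_angle_bounds[OF c] by blast
  obtain Ka where Ka: "Ka \<ge> 0" "\<And>t. \<bar>a t\<bar> \<le> Ka" "\<And>t t'. \<bar>a t' - a t\<bar> \<le> Ka * norm (t' - t)"
    using weighted_lipschitz_angle_bounds[OF a] by blast
  define M' where "M' = M + 2 + 2 * \<bar>\<kappa>\<bar>"
  define L where "L = 2 + 2 * \<bar>\<kappa>\<bar>"
  have M': "M' \<ge> 0" and L: "L \<ge> 1" using M by (auto simp: M'_def L_def)
  obtain eA CA where CA: "eA > 0" "CA \<ge> 0" and Ab: "\<And>u x y t x' y' t' D. 0 < u \<Longrightarrow> u < eA \<Longrightarrow>
      weighted_close (k + 1) M' u D x y t x' y' t' \<Longrightarrow>
      \<bar>A x y t\<bar> \<le> CA * u ^ (2 * k + 1) \<and> \<bar>A x' y' t' - A x y t\<bar> \<le> CA * u ^ (2 * k + 1) * D"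
    by (rule weighted_lipschitzE[OF A M'], rule that)
  have "\<exists>e C. e > 0 \<and> C \<ge> 0 \<and> (\<forall>u x y t x' y' t' D. 0 < u \<longrightarrow> u < e \<longrightarrow>
      weighted_close (k + 1) M' u D x y t x' y' t' \<longrightarrow> \<bar>H x' y' t' $ j - H x y t $ j\<bar> \<le> C * u ^ k * D)" for j
    by (rule weighted_lipschitzE[OF H[of j] M']) metis
  then obtain eH CH where CH: "\<And>j. eH j > 0" "\<And>j. CH j \<ge> 0"
    and Hb: "\<And>j u x y t x' y' t' D. 0 < u \<Longrightarrow> u < eH j \<Longrightarrow>
      weighted_close (k + 1) M' u D x y t x' y' t' \<Longrightarrow> \<bar>H x' y' t' $ j - H x y t $ j\<bar> \<le> CH j * u ^ k * D"
    by metis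
  define e1 where "e1 = min 1 (min (1 / (2 * (C + 1))) (min (\<bar>\<kappa>\<bar> / (2 * (C + 1))) (min (1 / (2 * (r + C))) eA)))"
  define e where "e = min e1 (Min (range eH))"
  have epos: "e > 0" using C \<kappa> r CA CH by (auto simp: e_def e1_def Min_gr_iff)
  have e_le: "e \<le> e1" "\<And>j. e \<le> eH j" by (auto simp: e_def min.coboundedI2)
  have basic: "eventually (\<lambda>i. 0 < u i \<and> u i \<le> 1 \<and> u i / 2 \<le> u1 i \<and>
      (u i)\<^sup>2 / 2 \<le> x i \<and> x i \<le> 2 * (u i)\<^sup>2 \<and> (u i)\<^sup>2 / 8 \<le> x1 i \<and>
      \<bar>\<kappa>\<bar> / 2 * u i ^ (k + 1) \<le> \<bar>y i\<bar> \<and> \<bar>y i\<bar> \<le> 2 * \<bar>\<kappa>\<bar> * u i ^ (k + 1) \<and> y1 i \<noteq> 0) F"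
    using eventually_small[OF epos] u1 x y
  proof eventually_elim
    case (elim i)
    have ub: "u i < 1" "u i < 1 / (2 * (C + 1))" "u i < \<bar>\<kappa>\<bar> / (2 * (C + 1))" "u i < 1 / (2 * (r + C))" "0 < u i"
      using elim(1) e_le(1) by (auto simp: e1_def)
    have Cw: "2 * C * w \<le> 1" "2 * C * w \<le> \<bar>\<kappa>\<bar>" if "0 < w" "w \<le> u i" for w
    proof -
      have "u i * (2 * (C + 1)) < 1" "u i * (2 * (C + 1)) < \<bar>\<kappa>\<bar>"
        using ub C by (simp_all add: pos_less_divide_eq del: distrib_left_numeral)
      moreover have "2 * C * w \<le> u i * (2 * (C + 1))"
        using mult_left_mono[OF that(2) C] ub(5) by (simp add: algebra_simps)
      ultimately show "2 * C * w \<le> 1" "2 * C * w \<le> \<bar>\<kappa>\<bar>" by linarith+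
    qed
    have half: "u i / 2 \<le> u1 i"
    proof -
      have "u i ^ k \<le> u i ^ 2" "u i ^ (k + 1) \<le> u i ^ 2" using ub k by (intro power_decreasing; simp)+
      then have "r * u i ^ k + C * u i ^ (k + 1) \<le> r * u i ^ 2 + C * u i ^ 2"
        using r C by (intro add_mono mult_left_mono) auto
      also have "\<dots> = (r + C) * u i * u i" by (simp add: power2_eq_square algebra_simps)
      also have "\<dots> \<le> (1 / 2) * u i"
      proof (rule mult_right_mono)
        show "(r + C) * u i \<le> 1 / 2" using ub r C by (simp add: pos_less_divide_eq algebra_simps)
      qed (use ub in simp)
      finally have "r * u i ^ k + C * u i ^ (k + 1) \<le> u i / 2" by simp
      then show ?thesis using elim(2) by (auto simp: abs_le_iff)
    qed
    have u1b: "0 < u1 i" "u1 i \<le> u i" using elim(2) by auto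
    have "(u i)\<^sup>2 / 8 \<le> x1 i"
    proof -
      have "(u i / 2)\<^sup>2 \<le> (u1 i)\<^sup>2" using half ub by (intro power_mono) auto
      then show ?thesis
        using stable_orbit_sizes(1)[OF u1b(1) Cw[OF u1b] conjunct2[OF elim(3)] conjunct2[OF elim(4)]]
        by (simp add: power_divide)
    qed
    moreover have "y1 i \<noteq> 0"
    proof -
      have "0 < \<bar>\<kappa>\<bar> / 2 * u1 i ^ (k + 1)" using \<kappa> u1b by simp
      then show ?thesis using stable_orbit_sizes(3)[OF u1b(1) Cw[OF u1b] conjunct2[OF elim(3)] conjunct2[OF elim(4)]]
        by auto
    qed
    moreover have "(u i)\<^sup>2 / 2 \<le> x i" "x i \<le> 2 * (u i)\<^sup>2"
      "\<bar>\<kappa>\<bar> / 2 * u i ^ (k + 1) \<le> \<bar>y i\<bar>" "\<bar>y i\<bar> \<le> 2 * \<bar>\<kappa>\<bar> * u i ^ (k + 1)"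
      using stable_orbit_sizes[OF ub(5) Cw[OF ub(5) order_refl] conjunct1[OF elim(3)] conjunct1[OF elim(4)]] by blast+
    ultimately show ?case using ub half by (simp add: less_imp_le)
  qed
  have products: "eventually (\<lambda>i. x i * \<xi> i = x' i - x i \<and> y i * \<eta> i = y' i - y i \<and>
      x1 i * \<xi>1 i = x1' i - x1 i \<and> y1 i * \<eta>1 i = y1' i - y1 i \<and> x i * (1 + \<xi> i) = x' i) F"
    using basic
  proof eventually_elim
    case (elim i)
    have "(u i)\<^sup>2 > 0" "\<bar>\<kappa>\<bar> / 2 * u i ^ (k + 1) > 0" using elim \<kappa> by auto
    then have "x i \<noteq> 0" "x1 i \<noteq> 0" "y i \<noteq> 0" "y1 i \<noteq> 0" using elim by auto
    then show ?case by (simp add: \<xi>_def \<xi>1_def \<eta>_def \<eta>1_def algebra_simps)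
  qed
  have close: "eventually (\<lambda>i. weighted_close (k + 1) M' (u i) (L * D i) (x i) (y i) (T i) (x' i) (y' i) (T' i)) F"
    using basic products bd'
  proof eventually_elim
    case (elim i)
    have D: "0 \<le> D i" "\<bar>\<xi> i\<bar> \<le> D i" "\<bar>\<eta> i\<bar> \<le> D i" "\<delta> i \<le> D i" by (auto simp: D_def \<delta>_def)
    have up: "0 \<le> (u i)\<^sup>2" "0 \<le> u i ^ (k + 1)" using elim(1) by auto
    have "\<bar>x' i - x i\<bar> = x i * \<bar>\<xi> i\<bar>"
    proof -
      have "x i \<ge> 0" using elim(1) up by linarith
      then show ?thesis using elim(2) by (metis abs_mult abs_of_nonneg)
    qed
    also have "\<dots> \<le> (2 * (u i)\<^sup>2) * D i" using elim(1) D up by (intro mult_mono) auto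
    also have "\<dots> \<le> (L * (u i)\<^sup>2) * D i" using up D by (intro mult_right_mono) (auto simp: L_def)
    finally have 1: "\<bar>x' i - x i\<bar> \<le> (u i)\<^sup>2 * (L * D i)" by (simp add: mult_ac)
    have "\<bar>y' i - y i\<bar> = \<bar>y i\<bar> * \<bar>\<eta> i\<bar>" using elim(2) by (metis abs_mult)
    also have "\<dots> \<le> (2 * \<bar>\<kappa>\<bar> * u i ^ (k + 1)) * D i" using elim(1) D up by (intro mult_mono) auto
    also have "\<dots> \<le> (L * u i ^ (k + 1)) * D i" using up D by (intro mult_right_mono) (auto simp: L_def)
    finally have 2: "\<bar>y' i - y i\<bar> \<le> u i ^ (k + 1) * (L * D i)" by (simp only: mult_ac)
    have 3: "norm (T' i - T i) \<le> L * D i"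
      using D(4) mult_right_mono[OF L D(1)] by (simp add: \<delta>_def)
    have "M * (u i)\<^sup>2 \<le> M' * (u i)\<^sup>2" "2 * (u i)\<^sup>2 \<le> M' * (u i)\<^sup>2" "M * u i ^ (k + 1) \<le> M' * u i ^ (k + 1)"
      "2 * \<bar>\<kappa>\<bar> * u i ^ (k + 1) \<le> M' * u i ^ (k + 1)"
      using up M by (auto intro!: mult_right_mono simp: M'_def)
    moreover have "\<bar>x i\<bar> = x i" "\<bar>x' i\<bar> = x' i" using elim(1,3) up by simp_all
    ultimately have "\<bar>x i\<bar> \<le> M' * (u i)\<^sup>2" "\<bar>x' i\<bar> \<le> M' * (u i)\<^sup>2"
      "\<bar>y i\<bar> \<le> M' * u i ^ (k + 1)" "\<bar>y' i\<bar> \<le> M' * u i ^ (k + 1)"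
      using elim(1,3) by linarith+
    then show ?case unfolding weighted_close_def using 1 2 3 by blast
  qed
  define R where "R = real k * (1 + (8 * M + 1)) ^ k"
  have bd: "eventually (\<lambda>i. -1 \<le> \<xi> i \<and> \<bar>\<xi> i\<bar> \<le> 8 * M + 1 \<and> \<bar>\<xi>1 i\<bar> \<le> 8 * M + 1 \<and> 0 \<le> \<delta> i) F"
    using basic bd'
  proof eventually_elim
    case (elim i)
    have up: "(u i)\<^sup>2 > 0" using elim(1) by simp
    then have xp: "x i > 0" "x1 i > 0" using elim(1) by linarith+
    have r1: "0 \<le> x' i / x i" using elim(2) xp by simp
    have "x' i \<le> 2 * M * x i" using elim mult_left_mono[of "(u i)\<^sup>2 / 2" "x i" "2 * M"] M by auto
    then have r2: "x' i / x i \<le> 2 * M" using xp by (simp add: pos_divide_le_eq)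
    have "\<bar>x1' i\<bar> \<le> 8 * M * x1 i" using elim mult_left_mono[of "(u i)\<^sup>2 / 8" "x1 i" "8 * M"] M by auto
    then have r3: "\<bar>x1' i / x1 i\<bar> \<le> 8 * M" using xp by (simp add: pos_divide_le_eq abs_divide)
    have "-1 \<le> \<xi> i" "\<bar>\<xi> i\<bar> \<le> 8 * M + 1" using r1 r2 M unfolding \<xi>_def by (auto simp: abs_le_iff)
    moreover have "\<bar>\<xi>1 i\<bar> \<le> 8 * M + 1" using r3 unfolding \<xi>1_def by linarith
    ultimately show ?case by (simp add: \<delta>_def)
  qed
  have le_u: "eventually (\<lambda>i. C * u1 i ^ n \<le> C * u i ^ n) F" for n
    using u1 by eventually_elim (use C in \<open>auto intro!: mult_left_mono power_mono\<close>)
  show ?thesis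
  proof (rule cone_step[OF k \<kappa> r])
    show "(\<lambda>i. u1 i - u i + r * u i ^ k) \<in> O[F](\<lambda>i. u i ^ (k + 1))"
      by (rule bigo_of_bound[of _ C]) (use u1 in \<open>auto elim: eventually_mono\<close>)
    show "(\<lambda>i. x i - (u i)\<^sup>2) \<in> O[F](\<lambda>i. u i ^ 3)"
      by (rule bigo_of_bound[of _ C]) (use x in \<open>auto elim: eventually_mono\<close>)
    show "(\<lambda>i. x1 i - (u1 i)\<^sup>2) \<in> O[F](\<lambda>i. u i ^ 3)"
      by (rule bigo_of_bound[of _ C]) (use x le_u[of 3] in \<open>eventually_elim, auto\<close>)
    show "(\<lambda>i. y i - \<kappa> * u i ^ (k + 1)) \<in> O[F](\<lambda>i. u i ^ (k + 2))"
      by (rule bigo_of_bound[of _ C]) (use y in \<open>auto elim: eventually_mono\<close>)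
    show "(\<lambda>i. y1 i - \<kappa> * u1 i ^ (k + 1)) \<in> O[F](\<lambda>i. u i ^ (k + 2))"
      by (rule bigo_of_bound[of _ C]) (use y le_u[of "k + 2"] in \<open>eventually_elim, auto\<close>)
    show "(\<lambda>i. x1 i - x i) \<in> O[F](\<lambda>i. u i ^ (k + 1))"
    proof (rule bigo_of_bound[of _ "Kc * (2 * \<bar>\<kappa>\<bar>)"])
      show "eventually (\<lambda>i. \<bar>x1 i - x i\<bar> \<le> Kc * (2 * \<bar>\<kappa>\<bar>) * u i ^ (k + 1)) F"
        using dyn basic
      proof eventually_elim
        case (elim i)
        have "\<bar>x1 i - x i\<bar> = \<bar>c (T i)\<bar> * \<bar>y i\<bar>" using elim(1) by (simp add: abs_mult)
        also have "\<dots> \<le> Kc * (2 * \<bar>\<kappa>\<bar> * u i ^ (k + 1))" using Kc elim(2) by (intro mult_mono) auto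
        finally show ?case by (simp only: mult.assoc)
      qed
    qed
    show "(\<lambda>i. y1 i - y i) \<in> O[F](\<lambda>i. u i ^ (2 * k))"
    proof (rule bigo_of_bound[of _ "Ka * 2 ^ k + CA"])
      show "eventually (\<lambda>i. \<bar>y1 i - y i\<bar> \<le> (Ka * 2 ^ k + CA) * u i ^ (2 * k)) F"
        using dyn basic close eventually_small[OF epos]
      proof eventually_elim
        case (elim i)
        have x0: "0 \<le> x i" using elim(2) zero_le_power2[of "u i"] by linarith
        have "\<bar>a (T i) * x i ^ k\<bar> \<le> Ka * (2 * (u i)\<^sup>2) ^ k"
          unfolding abs_mult power_abs using Ka elim(2) x0 by (intro mult_mono power_mono) auto
        also have "\<dots> = Ka * 2 ^ k * u i ^ (2 * k)" by (simp add: power_mult_distrib power_mult)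
        finally have 1: "\<bar>a (T i) * x i ^ k\<bar> \<le> Ka * 2 ^ k * u i ^ (2 * k)" .
        have "\<bar>A (x i) (y i) (T i)\<bar> \<le> CA * u i ^ (2 * k + 1)"
          using Ab[OF _ _ elim(3)] elim(4) e_le(1) by (auto simp: e1_def)
        also have "\<dots> \<le> CA * u i ^ (2 * k)" using elim(2) CA by (intro mult_left_mono power_decreasing) auto
        finally show ?case using 1 elim(1) by (simp add: distrib_right)
      qed
    qed
    show "eventually (\<lambda>i. -1 \<le> \<xi> i \<and> \<bar>\<xi> i\<bar> \<le> 8 * M + 1 \<and> \<bar>\<xi>1 i\<bar> \<le> 8 * M + 1 \<and> 0 \<le> \<delta> i) F" by (rule bd)
    show "(\<lambda>i. x1 i * (\<xi>1 i - \<xi> i) - (x1 i - x i) * (\<eta> i - \<xi> i)) \<in> O[F](\<lambda>i. u i ^ (k + 1) * \<delta> i)"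
    proof (rule bigo_of_bound[of _ "Kc * M"])
      show "eventually (\<lambda>i. \<bar>x1 i * (\<xi>1 i - \<xi> i) - (x1 i - x i) * (\<eta> i - \<xi> i)\<bar> \<le> Kc * M * (u i ^ (k + 1) * \<delta> i)) F"
        using dyn products bd'
      proof eventually_elim
        case (elim i)
        have "x1 i * (\<xi>1 i - \<xi> i) - (x1 i - x i) * (\<eta> i - \<xi> i)
            = x1 i * \<xi>1 i - x i * \<xi> i - (x1 i - x i) * \<eta> i" by (simp add: algebra_simps)
        also have "\<dots> = (x1' i - x1 i) - (x' i - x i) - c (T i) * (y' i - y i)"
        proof -
          have "x1 i - x i = c (T i) * y i" using elim(1) by simp
          then have "(x1 i - x i) * \<eta> i = c (T i) * (y i * \<eta> i)" by simp
          then show ?thesis using elim(2) by (simp only:)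
        qed
        also have "\<dots> = (c (T' i) - c (T i)) * y' i" using elim(1) by (auto simp: algebra_simps)
        finally have "\<bar>x1 i * (\<xi>1 i - \<xi> i) - (x1 i - x i) * (\<eta> i - \<xi> i)\<bar> = \<bar>c (T' i) - c (T i)\<bar> * \<bar>y' i\<bar>"
          by (simp add: abs_mult)
        also have "\<dots> \<le> (Kc * \<delta> i) * (M * u i ^ (k + 1))"
          using Kc elim(3) by (intro mult_mono) (auto simp: \<delta>_def)
        finally show ?case by (simp only: mult_ac)
      qed
    qed
    show "(\<lambda>i. y1 i * (\<eta>1 i - \<eta> i) - (y1 i - y i) * (((1 + \<xi> i) ^ k - 1) - \<eta> i))
      \<in> O[F](\<lambda>i. u i ^ (2 * k) * \<delta> i + u i ^ (2 * k + 1) * (\<bar>\<xi> i\<bar> + \<bar>\<eta> i\<bar> + \<delta> i))"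
      unfolding D_def[symmetric]
    proof (rule bigo_of_bound[of _ "Ka * M ^ k + CA * L + CA * R"])
      show "eventually (\<lambda>i. \<bar>y1 i * (\<eta>1 i - \<eta> i) - (y1 i - y i) * (((1 + \<xi> i) ^ k - 1) - \<eta> i)\<bar>
          \<le> (Ka * M ^ k + CA * L + CA * R) * (u i ^ (2 * k) * \<delta> i + u i ^ (2 * k + 1) * D i)) F"
        using dyn products bd' bd close eventually_small[OF epos]
      proof eventually_elim
        case (elim i)
        define G where "G = (1 + \<xi> i) ^ k - 1"
        have D: "0 \<le> D i" "\<bar>\<xi> i\<bar> \<le> D i" "0 \<le> \<delta> i" by (auto simp: D_def \<delta>_def)
        have up: "0 \<le> u i ^ (2 * k)" "0 \<le> u i ^ (2 * k + 1)" using elim(6) by auto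
        have uA: "0 < u i" "u i < eA" using elim(6) e_le(1) by (auto simp: e1_def)
        have xk: "x i ^ k * (1 + G) = x' i ^ k"
          using elim(2) by (simp add: G_def flip: power_mult_distrib)
        have "y1 i * (\<eta>1 i - \<eta> i) - (y1 i - y i) * (G - \<eta> i)
            = y1 i * \<eta>1 i - y i * \<eta> i - (y1 i - y i) * G" by (simp add: algebra_simps)
        also have "\<dots> = (y1' i - y1 i) - (y' i - y i) - (a (T i) * x i ^ k + A (x i) (y i) (T i)) * G"
        proof -
          have "y1 i - y i = a (T i) * x i ^ k + A (x i) (y i) (T i)" using elim(1) by simp
          then show ?thesis using elim(2) by (simp only:)
        qed
        also have "\<dots> = a (T' i) * x' i ^ k + A (x' i) (y' i) (T' i) - A (x i) (y i) (T i)
            - a (T i) * (x i ^ k * (1 + G)) - A (x i) (y i) (T i) * G"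
          using elim(1) by (simp add: algebra_simps)
        also have "\<dots> = (a (T' i) - a (T i)) * x' i ^ k + (A (x' i) (y' i) (T' i) - A (x i) (y i) (T i))
            - A (x i) (y i) (T i) * G"
          unfolding xk by (simp add: algebra_simps)
        finally have eq: "y1 i * (\<eta>1 i - \<eta> i) - (y1 i - y i) * (G - \<eta> i) =
          (a (T' i) - a (T i)) * x' i ^ k + (A (x' i) (y' i) (T' i) - A (x i) (y i) (T i)) - A (x i) (y i) (T i) * G" .
        have 1: "\<bar>(a (T' i) - a (T i)) * x' i ^ k\<bar> \<le> Ka * M ^ k * (u i ^ (2 * k) * \<delta> i)"
        proof -
          have "\<bar>(a (T' i) - a (T i)) * x' i ^ k\<bar> \<le> (Ka * \<delta> i) * (M * (u i)\<^sup>2) ^ k"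
            unfolding abs_mult power_abs using Ka elim(3) by (intro mult_mono power_mono) (auto simp: \<delta>_def)
          then show ?thesis by (simp add: power_mult_distrib power_mult[symmetric] mult_ac)
        qed
        have 2: "\<bar>A (x' i) (y' i) (T' i) - A (x i) (y i) (T i)\<bar> \<le> CA * L * (u i ^ (2 * k + 1) * D i)"
          using Ab[OF uA elim(5)] by (simp add: mult_ac)
        have G: "\<bar>G\<bar> \<le> R * D i"
        proof -
          have "\<bar>(1 + \<xi> i) ^ k - 1 ^ k\<bar> \<le> R * \<bar>(1 + \<xi> i) - 1\<bar>"
            unfolding R_def using elim(4) M by (intro power_lipschitz) auto
          also have "\<dots> \<le> R * D i" using D M by (intro mult_left_mono) (auto simp: R_def)
          finally show ?thesis by (simp add: G_def)
        qed
        have 3: "\<bar>A (x i) (y i) (T i) * G\<bar> \<le> CA * R * (u i ^ (2 * k + 1) * D i)"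
        proof -
          have "\<bar>A (x i) (y i) (T i)\<bar> \<le> CA * u i ^ (2 * k + 1)" using Ab[OF uA elim(5)] by simp
          then have "\<bar>A (x i) (y i) (T i) * G\<bar> \<le> (CA * u i ^ (2 * k + 1)) * (R * D i)"
            unfolding abs_mult using G CA up by (intro mult_mono) auto
          then show ?thesis by (simp only: mult_ac)
        qed
        define p where "p = u i ^ (2 * k) * \<delta> i"
        define q where "q = u i ^ (2 * k + 1) * D i"
        have pq: "p \<ge> 0" "q \<ge> 0" unfolding p_def q_def using up D by (auto intro: mult_nonneg_nonneg)
        have R0: "R \<ge> 0" using M by (simp add: R_def)
        have "(Ka * M ^ k) * p + (CA * L + CA * R) * q \<le> (Ka * M ^ k) * (p + q) + (CA * L + CA * R) * (p + q)"
          using pq Ka M CA L R0 by (intro add_mono mult_left_mono) auto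
        then have "(Ka * M ^ k) * p + (CA * L) * q + (CA * R) * q \<le> (Ka * M ^ k + CA * L + CA * R) * (p + q)"
          by (simp add: distrib_right)
        moreover have "\<bar>(a (T' i) - a (T i)) * x' i ^ k + (A (x' i) (y' i) (T' i) - A (x i) (y i) (T i)) - A (x i) (y i) (T i) * G\<bar>
          \<le> (Ka * M ^ k) * p + (CA * L) * q + (CA * R) * q"
          using 1 2 3 unfolding p_def q_def by linarith
        ultimately show ?case unfolding G_def[symmetric] eq p_def q_def by linarith
      qed
    qed
    show "eventually (\<lambda>i. \<delta>1 i \<le> \<delta> i + (\<Sum>j\<in>UNIV. CH j) * L * (u i ^ k * (\<bar>\<xi> i\<bar> + \<bar>\<eta> i\<bar> + \<delta> i))) F"
      unfolding D_def[symmetric]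
      using dyn close eventually_small[OF epos]
    proof eventually_elim
      case (elim i)
      define h where "h = H (x' i) (y' i) (T' i) - H (x i) (y i) (T i)"
      have "norm h \<le> (\<Sum>j\<in>UNIV. \<bar>h $ j\<bar>)" by (rule norm_le_l1_cart)
      also have "\<dots> \<le> (\<Sum>j\<in>UNIV. CH j * u i ^ k * (L * D i))"
      proof (rule sum_mono)
        fix j
        show "\<bar>h $ j\<bar> \<le> CH j * u i ^ k * (L * D i)"
          using Hb[OF _ _ elim(2), of j] elim(3) e_le(2)[of j] by (simp add: h_def)
      qed
      also have "\<dots> = (\<Sum>j\<in>UNIV. CH j * (L * (u i ^ k * D i)))" by (simp add: mult_ac)
      also have "\<dots> = (\<Sum>j\<in>UNIV. CH j) * L * (u i ^ k * D i)"
        by (simp only: sum_distrib_right[symmetric] mult.assoc)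
      finally have nh: "norm h \<le> (\<Sum>j\<in>UNIV. CH j) * L * (u i ^ k * D i)" .
      have "T1' i - T1 i = (T' i - T i) + h" using elim(1) by (simp add: h_def)
      then have "\<delta>1 i \<le> \<delta> i + norm h" unfolding \<delta>_def \<delta>1_def by (metis norm_triangle_ineq)
      then show ?case using nh by linarith
    qed
  qed
qed

end


text \<open>
  The index set of the filter consists of pairs \<open>(j, n)\<close> with the initial value \<open>u j 0\<close> tending to
  zero.  If the ratio of the ordinates is initially below one, the pair is in the cone for all times, and \<open>P u\<close>
  stays above its positive initial value; this contradicts the boundedness of \<open>P\<close> since \<open>u\<close> tends to zero
  along the orbit.
\<close>

lemma orbit_families_ordered:
  fixes u x y v x' y' :: "'j \<Rightarrow> nat \<Rightarrow> real" and T T' :: "'j \<Rightarrow> nat \<Rightarrow> real ^ 'd"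
    and c a :: "real ^ 'd \<Rightarrow> real"
  assumes k: "k \<ge> 2" and \<kappa>: "\<kappa> \<noteq> 0" "\<kappa>' \<noteq> 0" and r: "r > 0" "r' > 0" and C: "C \<ge> 0"
    and c: "weighted_lipschitz (k + 1) 0 (\<lambda>x y t. c t)" and a: "weighted_lipschitz (k + 1) 0 (\<lambda>x y t. a t)"
    and A: "weighted_lipschitz (k + 1) (2 * k + 1) A"
    and H: "\<And>i. weighted_lipschitz (k + 1) k (\<lambda>x y t. H x y t $ i)"
    and orb: "\<And>j. j \<in> J \<Longrightarrow> stable_orbit k c a A H \<omega> \<kappa> r C (u j) (x j) (y j) (T j)"
    and orb': "\<And>j. j \<in> J \<Longrightarrow> stable_orbit k c a A H \<omega> \<kappa>' r' C (v j) (x' j) (y' j) (T' j)"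
    and start: "\<And>j. j \<in> J \<Longrightarrow> v j 0 \<le> 2 * u j 0 \<and> x' j 0 = x j 0 \<and> T' j 0 = T j 0"
  shows "\<exists>\<epsilon>>0. \<forall>j\<in>J. u j 0 < \<epsilon> \<longrightarrow> 1 \<le> y' j 0 / y j 0"
proof -
  define m where "m = min (min r r') (min 1 (min \<bar>\<kappa>\<bar> \<bar>\<kappa>'\<bar>))"
  have m: "m > 0" "m \<le> r" "m \<le> r'" "m \<le> 1" "m \<le> \<bar>\<kappa>\<bar>" "m \<le> \<bar>\<kappa>'\<bar>" using r \<kappa> unfolding m_def by linarith+
  define e0 where "e0 = min (min 1 (1 / (4 * r))) (m / (4 * (C + 1)))"
  have e0: "e0 > 0" using r m C by (auto simp: e0_def)
  have small: "w \<le> 1 \<and> 4 * r * w \<le> 1 \<and> 4 * C * w \<le> m" if "0 < w" "w < e0" for w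
  proof -
    have "w < 1 / (4 * r)" "w < m / (4 * (C + 1))" "w \<le> 1" using that by (auto simp: e0_def)
    then have "w * (4 * r) < 1" "w * (4 * (C + 1)) < m" "w \<le> 1"
      using r C by (simp_all add: pos_less_divide_eq del: distrib_left_numeral)
    then show ?thesis using that by (simp add: algebra_simps)
  qed
  define \<Lambda> where "\<Lambda> = 2 * max 1 (8 * r / r')"
  have \<Lambda>: "\<Lambda> \<ge> 0" by (simp add: \<Lambda>_def)
  define M where "M = 2 * \<Lambda>\<^sup>2 + 2 * \<bar>\<kappa>'\<bar> * \<Lambda> ^ (k + 1)"
  have M: "M \<ge> 0" using \<Lambda> by (simp add: M_def)
  have facts: "0 < u j n \<and> u j (Suc n) \<le> u j n \<and> u j n \<le> u j 0 \<and>
      2 * C * u j n \<le> 1 \<and> 2 * C * u j n \<le> \<bar>\<kappa>\<bar> \<and> u j \<longlonglongrightarrow> 0 \<and>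
      0 \<le> x' j n \<and> x' j n \<le> M * (u j n)\<^sup>2 \<and> \<bar>x' j (Suc n)\<bar> \<le> M * (u j n)\<^sup>2 \<and> \<bar>y' j n\<bar> \<le> M * u j n ^ (k + 1)"
    if j: "j \<in> J" and ub: "u j 0 < e0" for j n
  proof -
    note o = orb[OF j, unfolded stable_orbit_def, rule_format]
    note o' = orb'[OF j, unfolded stable_orbit_def, rule_format]
    have up: "0 < u j n" "0 < v j n" for n using o o' by auto
    note sm = small[OF up(1) ub]
    have Cv: "2 * C * v j 0 \<le> m"
      using sm mult_left_mono[of "v j 0" "2 * u j 0" "2 * C"] start[OF j] C by simp
    have st: "0 < u j n \<and> \<bar>u j (Suc n) - u j n + r * u j n ^ k\<bar> \<le> C * u j n ^ (k + 1)" for n using o by blast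
    have st': "0 < v j n \<and> \<bar>v j (Suc n) - v j n + r' * v j n ^ k\<bar> \<le> C * v j n ^ (k + 1)" for n using o' by blast
    have "C * u j 0 \<le> r / 2" using sm m mult_nonneg_nonneg[OF C less_imp_le[OF up(1)[of 0]]] by linarith
    note dec = parameter_decrease[OF st C r(1) this]
    have "C * v j 0 \<le> r' / 2" using Cv m by simp
    note dec' = parameter_decrease[OF st' C r(2) this]
    have lim: "u j \<longlonglongrightarrow> 0"
      by (rule parameter_tendsto_0[where r = "r / 2" and k = k]) (use r up dec(1) in auto)
    have vu: "v j n \<le> \<Lambda> * u j n" for n
      unfolding \<Lambda>_def
      by (rule parameters_comparable[OF k r, where u = "u j" and v = "v j"])
         (use up dec dec' start[OF j] sm in auto)
    have mono: "u j (Suc n) \<le> u j n" "v j (Suc n) \<le> v j n" for n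
    proof -
      have "0 \<le> r / 2 * u j n ^ k" "0 \<le> r' / 2 * v j n ^ k" using r up[of n] by simp_all
      then show "u j (Suc n) \<le> u j n" "v j (Suc n) \<le> v j n" using dec(1)[of n] dec'(1)[of n] by linarith+
    qed
    have Cu: "2 * C * u j n \<le> m" for n
    proof -
      have "2 * C * u j n \<le> 2 * C * u j 0" using dec(3)[of n] C by (intro mult_left_mono) auto
      then show ?thesis using sm mult_nonneg_nonneg[OF C less_imp_le[OF up(1)[of 0]]] by linarith
    qed
    have Cvn: "2 * C * v j n \<le> m" for n
      using mult_left_mono[OF dec'(3)[of n], of "2 * C"] C Cv by simp
    have b: "\<bar>x' j n - (v j n)\<^sup>2\<bar> \<le> C * v j n ^ 3" "\<bar>y' j n - \<kappa>' * v j n ^ (k + 1)\<bar> \<le> C * v j n ^ (k + 2)" for n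
      using o'[of n] by blast+
    note sz = stable_orbit_sizes[OF up(2) _ _ b]
    have le: "2 * C * v j n \<le> 1" "2 * C * v j n \<le> \<bar>\<kappa>'\<bar>" for n using Cvn[of n] m by linarith+
    have pw: "v j n ^ q \<le> \<Lambda> ^ q * u j n ^ q" for n q
    proof -
      have "v j n ^ q \<le> (\<Lambda> * u j n) ^ q" using vu up(2)[of n] by (intro power_mono) auto
      then show ?thesis by (simp only: power_mult_distrib)
    qed
    have xb: "2 * (v j n)\<^sup>2 \<le> M * (u j n)\<^sup>2" for n
    proof -
      have "2 * (v j n)\<^sup>2 \<le> 2 * \<Lambda>\<^sup>2 * (u j n)\<^sup>2" using pw[of n 2] by simp
      also have "\<dots> \<le> M * (u j n)\<^sup>2" using \<Lambda> by (intro mult_right_mono) (auto simp: M_def)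
      finally show ?thesis .
    qed
    have yb: "2 * \<bar>\<kappa>'\<bar> * v j n ^ (k + 1) \<le> M * u j n ^ (k + 1)"
    proof -
      have "2 * \<bar>\<kappa>'\<bar> * v j n ^ (k + 1) \<le> 2 * \<bar>\<kappa>'\<bar> * (\<Lambda> ^ (k + 1) * u j n ^ (k + 1))"
        using pw[of n "k + 1"] by (intro mult_left_mono) auto
      also have "\<dots> = (2 * \<bar>\<kappa>'\<bar> * \<Lambda> ^ (k + 1)) * u j n ^ (k + 1)" by (simp only: mult.assoc)
      also have "\<dots> \<le> M * u j n ^ (k + 1)" using up(1)[of n] by (intro mult_right_mono) (auto simp: M_def)
      finally show ?thesis .
    qed
    have x0: "0 \<le> x' j n" "x' j n \<le> 2 * (v j n)\<^sup>2" for n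
      using sz(1,2)[OF le, of n] zero_le_power2[of "v j n"] by linarith+
    have "\<bar>x' j (Suc n)\<bar> \<le> 2 * (v j (Suc n))\<^sup>2" using x0[of "Suc n"] by simp
    also have "\<dots> \<le> 2 * (v j n)\<^sup>2" using mono(2)[of n] up(2)[of "Suc n"] by (intro mult_left_mono power_mono) auto
    finally have x1: "\<bar>x' j (Suc n)\<bar> \<le> M * (u j n)\<^sup>2" using xb[of n] by linarith
    have y0: "\<bar>y' j n\<bar> \<le> M * u j n ^ (k + 1)" using sz(4)[OF le, of n] yb by linarith
    have "x' j n \<le> M * (u j n)\<^sup>2" using x0(2)[of n] xb[of n] by linarith
    moreover have "2 * C * u j n \<le> 1" "2 * C * u j n \<le> \<bar>\<kappa>\<bar>" using Cu[of n] m by linarith+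
    ultimately show ?thesis using up(1)[of n] mono(1)[of n] dec(3)[of n] lim x0(1)[of n] x1 y0 by blast
  qed
  define F where "F = inf (filtercomap (\<lambda>i :: 'j \<times> nat. u (fst i) 0) (at_right 0)) (principal {i. fst i \<in> J})"
  have evI: "eventually P F" if "e > 0" "\<And>j n. j \<in> J \<Longrightarrow> u j 0 < e \<Longrightarrow> P (j, n)" for P e
    unfolding F_def eventually_inf_principal eventually_filtercomap
    using that by (intro exI[of _ "\<lambda>w. 0 < w \<and> w < e"]) (auto simp: eventually_at_right_field)
  have evD: "\<exists>e>0. \<forall>j n. j \<in> J \<longrightarrow> u j 0 < e \<longrightarrow> P (j, n)" if ev: "eventually P F" for P
  proof -
    obtain Q where Q: "eventually Q (at_right 0)" "\<And>i. Q (u (fst i) 0) \<Longrightarrow> fst i \<in> J \<longrightarrow> P i"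
      using ev unfolding F_def eventually_inf_principal eventually_filtercomap by auto
    obtain e where e: "e > 0" "\<And>w. 0 < w \<Longrightarrow> w < e \<Longrightarrow> Q w" using Q(1) unfolding eventually_at_right_field by blast
    have "P (j, n)" if "j \<in> J" "u j 0 < e" for j n
    proof -
      have "0 < u j 0" using orb[OF that(1)] unfolding stable_orbit_def by blast
      then show ?thesis using Q(2)[of "(j, n)"] e(2) that by simp
    qed
    then show ?thesis using e(1) by blast
  qed
  let ?s = "\<lambda>f (i :: 'j \<times> nat). f (fst i) (snd i)" and ?n = "\<lambda>f (i :: 'j \<times> nat). f (fst i) (Suc (snd i))"
  interpret small_parameter F "\<lambda>i. u (fst i) (snd i)"
  proof
    have "((\<lambda>i. u (fst i) (snd i)) \<longlongrightarrow> 0) F"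
    proof (rule tendstoI)
      fix e :: real assume e: "e > 0"
      show "eventually (\<lambda>i. dist (u (fst i) (snd i)) 0 < e) F"
      proof (rule evI[of "min e e0"])
        fix j n assume j: "j \<in> J" "u j 0 < min e e0"
        then have "0 < u j n \<and> u j n \<le> u j 0" using facts[of j n] by simp
        then show "dist (u (fst (j, n)) (snd (j, n))) 0 < e" using j(2) by simp
      qed (use e e0 in simp)
    qed
    moreover have "eventually (\<lambda>i. 0 < u (fst i) (snd i)) F"
      by (rule evI[OF e0]) (use facts in simp)
    ultimately show "filterlim (\<lambda>i. u (fst i) (snd i)) (at_right 0) F"
      by (rule tendsto_imp_filterlim_at_right)
  qed
  have "\<exists>c>0. \<exists>B. eventually (\<lambda>i. expanding_step c B k \<kappa>
      (?s u i) (?s x i) (?s y i) (?s x' i / ?s x i - 1) (?s y' i / ?s y i - 1) (norm (?s T' i - ?s T i))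
      (?n u i) (?n x i) (?n y i) (?n x' i / ?n x i - 1) (?n y' i / ?n y i - 1) (norm (?n T' i - ?n T i))) F"
  proof (rule orbit_pair_cone_step[OF k \<kappa>(1) r(1) C M c a A H])
    show "eventually (\<lambda>i. 0 < ?n u i \<and> ?n u i \<le> ?s u i \<and>
        \<bar>?n u i - ?s u i + r * ?s u i ^ k\<bar> \<le> C * ?s u i ^ (k + 1)) F"
      by (rule evI[OF e0]) (unfold fst_conv snd_conv, use facts orb[unfolded stable_orbit_def] in blast)
    show "eventually (\<lambda>i. \<bar>?s x i - (?s u i)\<^sup>2\<bar> \<le> C * ?s u i ^ 3 \<and> \<bar>?n x i - (?n u i)\<^sup>2\<bar> \<le> C * ?n u i ^ 3) F"
      by (rule evI[OF e0]) (unfold fst_conv snd_conv, use orb[unfolded stable_orbit_def] in blast)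
    show "eventually (\<lambda>i. \<bar>?s y i - \<kappa> * ?s u i ^ (k + 1)\<bar> \<le> C * ?s u i ^ (k + 2) \<and>
        \<bar>?n y i - \<kappa> * ?n u i ^ (k + 1)\<bar> \<le> C * ?n u i ^ (k + 2)) F"
      by (rule evI[OF e0]) (unfold fst_conv snd_conv, use orb[unfolded stable_orbit_def] in blast)
    show "eventually (\<lambda>i. ?n x i = ?s x i + c (?s T i) * ?s y i \<and>
        ?n y i = ?s y i + a (?s T i) * ?s x i ^ k + A (?s x i) (?s y i) (?s T i) \<and>
        ?n T i = ?s T i + \<omega> + H (?s x i) (?s y i) (?s T i) \<and>
        ?n x' i = ?s x' i + c (?s T' i) * ?s y' i \<and>
        ?n y' i = ?s y' i + a (?s T' i) * ?s x' i ^ k + A (?s x' i) (?s y' i) (?s T' i) \<and>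
        ?n T' i = ?s T' i + \<omega> + H (?s x' i) (?s y' i) (?s T' i)) F"
      by (rule evI[OF e0]) (unfold fst_conv snd_conv, use orb[unfolded stable_orbit_def] orb'[unfolded stable_orbit_def] in blast)
    show "eventually (\<lambda>i. 0 \<le> ?s x' i \<and> ?s x' i \<le> M * (?s u i)\<^sup>2 \<and> \<bar>?n x' i\<bar> \<le> M * (?s u i)\<^sup>2 \<and>
        \<bar>?s y' i\<bar> \<le> M * ?s u i ^ (k + 1)) F"
      by (rule evI[OF e0]) (unfold fst_conv snd_conv, use facts in blast)
  qed
  then obtain c0 B where "eventually (\<lambda>i. expanding_step c0 B k \<kappa>
      (?s u i) (?s x i) (?s y i) (?s x' i / ?s x i - 1) (?s y' i / ?s y i - 1) (norm (?s T' i - ?s T i))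
      (?n u i) (?n x i) (?n y i) (?n x' i / ?n x i - 1) (?n y' i / ?n y i - 1) (norm (?n T' i - ?n T i))) F" by blast
  from evD[OF this] obtain e1 where e1: "e1 > 0" and step: "\<And>j n. j \<in> J \<Longrightarrow> u j 0 < e1 \<Longrightarrow> expanding_step c0 B k \<kappa>
      (u j n) (x j n) (y j n) (x' j n / x j n - 1) (y' j n / y j n - 1) (norm (T' j n - T j n))
      (u j (Suc n)) (x j (Suc n)) (y j (Suc n)) (x' j (Suc n) / x j (Suc n) - 1)
      (y' j (Suc n) / y j (Suc n) - 1) (norm (T' j (Suc n) - T j (Suc n)))"
    unfolding fst_conv snd_conv by blast
  have "1 \<le> y' j 0 / y j 0" if j: "j \<in> J" and ub: "u j 0 < min e0 e1" for j
  proof (rule ccontr)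
    assume neg: "\<not> 1 \<le> y' j 0 / y j 0"
    define P where "P n = unstable_part k \<kappa> (u j n) (x j n) (y j n) (x' j n / x j n - 1) (y' j n / y j n - 1)" for n
    have ub0: "u j 0 < e0" and ub1: "u j 0 < e1" using ub by auto
    note st = step[OF j ub1, unfolded expanding_step_def]
    note fc = facts[OF j ub0]
    have up: "0 < u j n" for n using fc by blast
    have b: "\<bar>x j n - (u j n)\<^sup>2\<bar> \<le> C * u j n ^ 3" "\<bar>y j n - \<kappa> * u j n ^ (k + 1)\<bar> \<le> C * u j n ^ (k + 2)" for n
      using orb[OF j] unfolding stable_orbit_def by blast+
    have le: "2 * C * u j n \<le> 1" "2 * C * u j n \<le> \<bar>\<kappa>\<bar>" for n using fc by blast+
    note sz = stable_orbit_sizes[OF up le b]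
    have xp: "x j n > 0" for n
    proof -
      have "0 < (u j n)\<^sup>2 / 2" using up[of n] by simp
      then show ?thesis using sz(1)[of n] by linarith
    qed
    have cone: "in_cone c0 k \<kappa> (u j n) (x j n) (y j n) (x' j n / x j n - 1) (y' j n / y j n - 1) (norm (T' j n - T j n))
        \<and> P 0 * u j 0 \<le> P n * u j n" for n
    proof (induction n)
      case 0
      have "x' j 0 / x j 0 - 1 = 0" "norm (T' j 0 - T j 0) = 0" "y' j 0 / y j 0 - 1 < 0"
        using start[OF j] xp[of 0] neg by auto
      then show ?case using st[of 0] by blast
    next
      case (Suc n)
      then show ?case using st[of n] unfolding P_def by (meson order_trans)
    qed
    define W where "W = \<bar>B\<bar> * ((2 * M + 1) + (2 * M / \<bar>\<kappa>\<bar> + 1))"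
    have PW: "P n \<le> W" for n
    proof -
      have "x' j n \<le> 2 * M * x j n" using fc[of n] mult_left_mono[OF sz(1)[of n], of "2 * M"] M by auto
      then have "x' j n / x j n \<le> 2 * M" "0 \<le> x' j n / x j n" using xp[of n] fc[of n] by (simp_all add: pos_divide_le_eq)
      then have 1: "\<bar>x' j n / x j n - 1\<bar> \<le> 2 * M + 1" by (simp add: abs_le_iff)
      have yp: "\<bar>y j n\<bar> > 0" using sz(3)[of n] up[of n] \<kappa> by (smt (verit) divide_pos_pos mult_pos_pos zero_less_abs_iff zero_less_power)
      have "\<bar>y' j n\<bar> \<le> M * u j n ^ (k + 1)" using fc by blast
      also have "\<dots> = (2 * M / \<bar>\<kappa>\<bar>) * (\<bar>\<kappa>\<bar> / 2 * u j n ^ (k + 1))" using \<kappa> by simp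
      also have "\<dots> \<le> (2 * M / \<bar>\<kappa>\<bar>) * \<bar>y j n\<bar>" using sz(3)[of n] M by (intro mult_left_mono) auto
      finally have "\<bar>y' j n / y j n\<bar> \<le> 2 * M / \<bar>\<kappa>\<bar>" unfolding abs_divide using yp by (subst pos_divide_le_eq) auto
      then have 2: "\<bar>y' j n / y j n - 1\<bar> \<le> 2 * M / \<bar>\<kappa>\<bar> + 1" by linarith
      have "P n \<le> B * (\<bar>x' j n / x j n - 1\<bar> + \<bar>y' j n / y j n - 1\<bar>)" using st[of n] unfolding P_def by blast
      also have "\<dots> \<le> \<bar>B\<bar> * ((2 * M + 1) + (2 * M / \<bar>\<kappa>\<bar> + 1))" using 1 2 by (intro mult_mono add_mono) auto
      finally show ?thesis by (simp add: W_def)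
    qed
    have "P 0 > 0" using cone[of 0] unfolding in_cone_def P_def by blast
    then have pos: "P 0 * u j 0 > 0" using up[of 0] by simp
    have "(\<lambda>n. W * u j n) \<longlonglongrightarrow> W * 0" using fc by (intro tendsto_intros) auto
    moreover have "P 0 * u j 0 \<le> W * u j n" for n
      using cone[of n] mult_right_mono[OF PW[of n] less_imp_le[OF up[of n]]] by linarith
    ultimately have "P 0 * u j 0 \<le> W * 0" by (intro LIMSEQ_le_const) auto
    then show False using pos by simp
  qed
  then show ?thesis using e0 e1 by (intro exI[of _ "min e0 e1"]) auto
qed

lemma orbits_ordered:
  fixes c a :: "real ^ 'd \<Rightarrow> real"
  assumes k: "k \<ge> 2" and \<kappa>: "\<kappa> \<noteq> 0" "\<kappa>' \<noteq> 0" and r: "r > 0" "r' > 0" and C: "C \<ge> 0"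
    and c: "weighted_lipschitz (k + 1) 0 (\<lambda>x y t. c t)" and a: "weighted_lipschitz (k + 1) 0 (\<lambda>x y t. a t)"
    and A: "weighted_lipschitz (k + 1) (2 * k + 1) A"
    and H: "\<And>i. weighted_lipschitz (k + 1) k (\<lambda>x y t. H x y t $ i)"
  obtains \<epsilon> where "\<epsilon> > 0" "\<And>u x y T v x' y' T'.
    stable_orbit k c a A H \<omega> \<kappa> r C u x y T \<Longrightarrow> stable_orbit k c a A H \<omega> \<kappa>' r' C v x' y' T' \<Longrightarrow>
    v 0 \<le> 2 * u 0 \<Longrightarrow> x' 0 = x 0 \<Longrightarrow> T' 0 = T 0 \<Longrightarrow> u 0 < \<epsilon> \<Longrightarrow> 1 \<le> y' 0 / y 0"
proof -
  let ?J = "{((u, x, y, T), (v, x', y', T')).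
    stable_orbit k c a A H \<omega> \<kappa> r C u x y T \<and> stable_orbit k c a A H \<omega> \<kappa>' r' C v x' y' T' \<and>
    v 0 \<le> 2 * u 0 \<and> x' 0 = x 0 \<and> T' 0 = T 0}"
  have "\<exists>\<epsilon>>0. \<forall>j\<in>?J. fst (fst j) 0 < \<epsilon> \<longrightarrow> 1 \<le> fst (snd (snd (snd j))) 0 / fst (snd (snd (fst j))) 0"
    by (rule orbit_families_ordered[OF k \<kappa> r C c a A H,
          where u = "\<lambda>j. fst (fst j)" and x = "\<lambda>j. fst (snd (fst j))" and T = "\<lambda>j. snd (snd (snd (fst j)))"
            and v = "\<lambda>j. fst (snd j)" and x' = "\<lambda>j. fst (snd (snd j))" and T' = "\<lambda>j. snd (snd (snd (snd j)))"])
       auto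
  then obtain \<epsilon> where \<epsilon>: "\<epsilon> > 0" "\<forall>j\<in>?J. fst (fst j) 0 < \<epsilon> \<longrightarrow> 1 \<le> fst (snd (snd (snd j))) 0 / fst (snd (snd (fst j))) 0"
    by blast
  show ?thesis
  proof (rule that[OF \<epsilon>(1)])
    fix u x y T v x' y' T'
    assume "stable_orbit k c a A H \<omega> \<kappa> r C u x y T" "stable_orbit k c a A H \<omega> \<kappa>' r' C v x' y' T'"
      "v 0 \<le> 2 * u 0" "x' 0 = x 0" "T' 0 = T 0" "u 0 < \<epsilon>"
    then show "1 \<le> y' 0 / y 0" using bspec[OF \<epsilon>(2), of "((u, x, y, T), (v, x', y', T'))"] by simp
  qed
qed

section \<open>Uniqueness\<close>

text \<open>
  The equations \<open>X v t = x\<close> and \<open>t + S v t = \<tau>\<close> are written as the fixed point problem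
  \<open>v = sqrt (v\<^sup>2 - X v t + x)\<close>, \<open>t = \<tau> - S v t\<close>.  Since \<open>v\<^sup>2 - X v t\<close> and \<open>S v t\<close> are small, the
  right hand sides map a box around \<open>(u, \<tau>)\<close> into itself, and Brouwer's theorem applies.  The derivative of
  \<open>X\<close> with respect to \<open>v\<close> is not controlled, so monotonicity is not available.
\<close>

lemma parametrization_surjective:
  fixes X :: "real \<Rightarrow> real ^ 'd \<Rightarrow> real" and S :: "real \<Rightarrow> real ^ 'd \<Rightarrow> real ^ 'd"
  assumes e: "e > 0" and C: "C \<ge> 0"
    and cont: "continuous_on ({0<..<e} \<times> UNIV) (\<lambda>(u, t). (X u t, S u t))"
    and X: "\<And>u t. 0 < u \<Longrightarrow> u < e \<Longrightarrow> \<bar>X u t - u\<^sup>2\<bar> \<le> C * u ^ 3"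
    and S: "\<And>u t. 0 < u \<Longrightarrow> u < e \<Longrightarrow> norm (S u t) \<le> C * u"
  obtains \<epsilon> where "\<epsilon> > 0" "\<And>u x \<tau>. 0 < u \<Longrightarrow> u < \<epsilon> \<Longrightarrow> \<bar>x - u\<^sup>2\<bar> \<le> C * u ^ 3 \<Longrightarrow>
    \<exists>v t. u / 2 \<le> v \<and> v \<le> 2 * u \<and> X v t = x \<and> t + S v t = \<tau>"
proof -
  define \<epsilon> where "\<epsilon> = min (e / 2) (1 / (12 * (C + 1)))"
  have \<epsilon>: "\<epsilon> > 0" using e C by (simp add: \<epsilon>_def)
  show ?thesis
  proof (rule that[OF \<epsilon>])
    fix u x :: real and \<tau> :: "real ^ 'd" assume u: "0 < u" "u < \<epsilon>" and x: "\<bar>x - u\<^sup>2\<bar> \<le> C * u ^ 3"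
    have ue: "2 * u < e" and "u < 1 / (12 * (C + 1))" using u by (auto simp: \<epsilon>_def)
    then have "u * (12 * (C + 1)) < 1" using C by (subst (asm) pos_less_divide_eq) auto
    then have Cu: "12 * C * u \<le> 1" using u by (simp add: algebra_simps)
    define Q where "Q = {u / 2 .. 2 * u} \<times> cball \<tau> 1"
    define f where "f = (\<lambda>(v, t). (sqrt (v\<^sup>2 - X v t + x), \<tau> - S v t))"
    have val: "u / 2 \<le> sqrt (v\<^sup>2 - X v t + x)" "sqrt (v\<^sup>2 - X v t + x) \<le> 2 * u" "0 \<le> v\<^sup>2 - X v t + x"
      "norm (S v t) \<le> 1" if v: "u / 2 \<le> v" "v \<le> 2 * u" for v t
    proof -
      have v0: "0 < v" "v < e" using v u ue by auto
      have "C * v ^ 3 \<le> C * (2 * u) ^ 3" using v v0 C by (intro mult_left_mono power_mono) auto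
      then have "\<bar>X v t - v\<^sup>2\<bar> \<le> 8 * (C * u ^ 3)" using X[OF v0, of t] by (simp add: power_mult_distrib)
      moreover have "12 * (C * u ^ 3) \<le> u\<^sup>2"
      proof -
        have "12 * (C * u ^ 3) = (12 * C * u) * u\<^sup>2" by (simp add: power2_eq_square power3_eq_cube)
        also have "\<dots> \<le> 1 * u\<^sup>2" using Cu by (intro mult_right_mono) auto
        finally show ?thesis by simp
      qed
      ultimately have 1: "u\<^sup>2 / 4 \<le> v\<^sup>2 - X v t + x" "v\<^sup>2 - X v t + x \<le> 4 * u\<^sup>2"
        using x zero_le_power2[of u] by linarith+
      show "u / 2 \<le> sqrt (v\<^sup>2 - X v t + x)" using 1 by (intro real_le_rsqrt) (simp add: power_divide)
      show "sqrt (v\<^sup>2 - X v t + x) \<le> 2 * u" using 1 u by (intro real_le_lsqrt) (auto simp: power_mult_distrib)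
      show "0 \<le> v\<^sup>2 - X v t + x" using 1(1) zero_le_power2[of u] by linarith
      have "norm (S v t) \<le> C * v" using S[OF v0] .
      also have "\<dots> \<le> C * (2 * u)" using v C by (intro mult_left_mono) auto
      also have "\<dots> \<le> 1" using Cu mult_nonneg_nonneg[OF C less_imp_le[OF u(1)]] by linarith
      finally show "norm (S v t) \<le> 1" .
    qed
    have sub: "Q \<subseteq> {0<..<e} \<times> UNIV" using u ue by (auto simp: Q_def)
    have cQ: "continuous_on Q (\<lambda>(v, t). (X v t, S v t))" by (rule continuous_on_subset[OF cont sub])
    have cX: "continuous_on Q (\<lambda>z. X (fst z) (snd z))" and cS: "continuous_on Q (\<lambda>z. S (fst z) (snd z))"
      using continuous_on_fst[OF cQ] continuous_on_snd[OF cQ] by (simp_all add: case_prod_unfold)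
    have "continuous_on Q f"
      unfolding f_def case_prod_unfold by (intro continuous_intros cX cS)
    moreover have "f \<in> Q \<rightarrow> Q"
      using val by (auto simp: Q_def f_def dist_norm)
    moreover have "compact Q" "convex Q" "Q \<noteq> {}"
      using u by (auto simp: Q_def intro!: compact_Times convex_Times)
    ultimately obtain z where z: "z \<in> Q" "f z = z" using brouwer[of Q f] by blast
    obtain v t where vt: "z = (v, t)" by (cases z)
    have v: "u / 2 \<le> v" "v \<le> 2 * u" using z(1) by (auto simp: Q_def vt)
    have fz: "sqrt (v\<^sup>2 - X v t + x) = v" "\<tau> - S v t = t" using z(2) by (auto simp: f_def vt)
    have "v\<^sup>2 - X v t + x = v\<^sup>2" using val(3)[OF v, of t] fz(1) real_sqrt_pow2 by metis
    then have "X v t = x" by simp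
    moreover have "t + S v t = \<tau>" using fz(2) by (simp add: algebra_simps)
    ultimately show "\<exists>v t. u / 2 \<le> v \<and> v \<le> 2 * u \<and> X v t = x \<and> t + S v t = \<tau>" using v by blast
  qed
qed


text \<open>
  A stable manifold in the universal cover of the angles, reduced to the data that the comparison
  uses: positions and the orbits starting there.
\<close>

definition stable_lift ::
    "nat \<Rightarrow> (real ^ 'd \<Rightarrow> real) \<Rightarrow> (real ^ 'd \<Rightarrow> real) \<Rightarrow> (real \<Rightarrow> real \<Rightarrow> real ^ 'd \<Rightarrow> real) \<Rightarrow>
     (real \<Rightarrow> real \<Rightarrow> real ^ 'd \<Rightarrow> real ^ 'd) \<Rightarrow> real ^ 'd \<Rightarrow> real \<Rightarrow> real \<Rightarrow> real \<Rightarrow> real \<Rightarrow>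
     (real \<Rightarrow> real ^ 'd \<Rightarrow> real) \<Rightarrow> (real \<Rightarrow> real ^ 'd \<Rightarrow> real) \<Rightarrow> (real \<Rightarrow> real ^ 'd \<Rightarrow> real ^ 'd) \<Rightarrow> bool"
  where "stable_lift k c a A H \<omega> \<kappa> r C \<epsilon> X Y S \<longleftrightarrow>
    0 < \<epsilon> \<and> 0 < r \<and> \<kappa> \<noteq> 0 \<and> 0 \<le> C \<and>
    continuous_on ({0<..<\<epsilon>} \<times> UNIV) (\<lambda>(u, t). (X u t, S u t)) \<and>
    (\<forall>u t. 0 < u \<longrightarrow> u < \<epsilon> \<longrightarrow> \<bar>X u t - u\<^sup>2\<bar> \<le> C * u ^ 3 \<and> norm (S u t) \<le> C * u \<and>
      (\<exists>us xs ys Ts. stable_orbit k c a A H \<omega> \<kappa> r C us xs ys Ts \<and>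
        us 0 = u \<and> xs 0 = X u t \<and> ys 0 = Y u t \<and> Ts 0 = t + S u t))"

lemma stable_orbit_weaken:
  assumes "stable_orbit k c a A H \<omega> \<kappa> r C u x y T" "C \<le> C'"
  shows "stable_orbit k c a A H \<omega> \<kappa> r C' u x y T"
  unfolding stable_orbit_def
proof
  fix n
  note o = assms(1)[unfolded stable_orbit_def, rule_format, of n]
  have "C * u n ^ m \<le> C' * u n ^ m" for m
    using o assms(2) by (intro mult_right_mono) auto
  then show "0 < u n \<and> \<bar>u (Suc n) - u n + r * u n ^ k\<bar> \<le> C' * u n ^ (k + 1) \<and>
    \<bar>x n - (u n)\<^sup>2\<bar> \<le> C' * u n ^ 3 \<and> \<bar>y n - \<kappa> * u n ^ (k + 1)\<bar> \<le> C' * u n ^ (k + 2) \<and>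
    x (Suc n) = x n + c (T n) * y n \<and>
    y (Suc n) = y n + a (T n) * x n ^ k + A (x n) (y n) (T n) \<and>
    T (Suc n) = T n + \<omega> + H (x n) (y n) (T n)"
    using o by (meson order_trans)
qed

lemma stable_lift_weaken:
  assumes "stable_lift k c a A H \<omega> \<kappa> r C \<epsilon> X Y S" "C \<le> C'"
  shows "stable_lift k c a A H \<omega> \<kappa> r C' \<epsilon> X Y S"
proof -
  note l = assms(1)[unfolded stable_lift_def]
  have "\<bar>X u t - u\<^sup>2\<bar> \<le> C' * u ^ 3 \<and> norm (S u t) \<le> C' * u \<and>
      (\<exists>us xs ys Ts. stable_orbit k c a A H \<omega> \<kappa> r C' us xs ys Ts \<and>
        us 0 = u \<and> xs 0 = X u t \<and> ys 0 = Y u t \<and> Ts 0 = t + S u t)" if u: "0 < u" "u < \<epsilon>" for u t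
  proof -
    have "C * u ^ 3 \<le> C' * u ^ 3" "C * u \<le> C' * u" using u assms(2) by (auto intro: mult_right_mono)
    moreover have "\<bar>X u t - u\<^sup>2\<bar> \<le> C * u ^ 3" "norm (S u t) \<le> C * u" using l u by blast+
    ultimately have "\<bar>X u t - u\<^sup>2\<bar> \<le> C' * u ^ 3" "norm (S u t) \<le> C' * u" by linarith+
    moreover obtain us xs ys Ts where "stable_orbit k c a A H \<omega> \<kappa> r C us xs ys Ts"
      "us 0 = u" "xs 0 = X u t" "ys 0 = Y u t" "Ts 0 = t + S u t" using l u by blast
    then have "\<exists>us xs ys Ts. stable_orbit k c a A H \<omega> \<kappa> r C' us xs ys Ts \<and>
        us 0 = u \<and> xs 0 = X u t \<and> ys 0 = Y u t \<and> Ts 0 = t + S u t"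
      using stable_orbit_weaken assms(2) by blast
    ultimately show ?thesis by blast
  qed
  then show ?thesis using l assms(2) unfolding stable_lift_def by (meson order_trans)
qed

text \<open>
  Brouwer's theorem gives a point of the second manifold with the same abscissa and angle.  Comparing the orbits in
  both orders gives both inequalities between the ordinates.
\<close>

lemma stable_lifts_coincide:
  fixes c a :: "real ^ 'd \<Rightarrow> real"
  assumes k: "k \<ge> 2"
    and c: "weighted_lipschitz (k + 1) 0 (\<lambda>x y t. c t)" and a: "weighted_lipschitz (k + 1) 0 (\<lambda>x y t. a t)"
    and A: "weighted_lipschitz (k + 1) (2 * k + 1) A"
    and H: "\<And>i. weighted_lipschitz (k + 1) k (\<lambda>x y t. H x y t $ i)"
    and L: "stable_lift k c a A H \<omega> \<kappa> r C \<epsilon> X Y S" and L': "stable_lift k c a A H \<omega> \<kappa>' r' C' \<epsilon>' X' Y' S'"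
  obtains e where "e > 0" "\<And>u t. 0 < u \<Longrightarrow> u < e \<Longrightarrow>
    \<exists>v t'. 0 < v \<and> v \<le> 2 * u \<and> v < \<epsilon>' \<and> X' v t' = X u t \<and> Y' v t' = Y u t \<and> t' + S' v t' = t + S u t"
proof -
  define D where "D = max C C'"
  have l: "0 < \<epsilon> \<and> 0 < r \<and> \<kappa> \<noteq> 0 \<and> 0 \<le> D \<and>
    continuous_on ({0<..<\<epsilon>} \<times> UNIV) (\<lambda>(u, t). (X u t, S u t)) \<and>
    (\<forall>u t. 0 < u \<longrightarrow> u < \<epsilon> \<longrightarrow> \<bar>X u t - u\<^sup>2\<bar> \<le> D * u ^ 3 \<and> norm (S u t) \<le> D * u \<and>
      (\<exists>us xs ys Ts. stable_orbit k c a A H \<omega> \<kappa> r D us xs ys Ts \<and>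
        us 0 = u \<and> xs 0 = X u t \<and> ys 0 = Y u t \<and> Ts 0 = t + S u t))"
    by (rule stable_lift_weaken[OF L, unfolded stable_lift_def]) (simp add: D_def)
  have l': "0 < \<epsilon>' \<and> 0 < r' \<and> \<kappa>' \<noteq> 0 \<and> 0 \<le> D \<and>
    continuous_on ({0<..<\<epsilon>'} \<times> UNIV) (\<lambda>(u, t). (X' u t, S' u t)) \<and>
    (\<forall>u t. 0 < u \<longrightarrow> u < \<epsilon>' \<longrightarrow> \<bar>X' u t - u\<^sup>2\<bar> \<le> D * u ^ 3 \<and> norm (S' u t) \<le> D * u \<and>
      (\<exists>us xs ys Ts. stable_orbit k c a A H \<omega> \<kappa>' r' D us xs ys Ts \<and>
        us 0 = u \<and> xs 0 = X' u t \<and> ys 0 = Y' u t \<and> Ts 0 = t + S' u t))"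
    by (rule stable_lift_weaken[OF L', unfolded stable_lift_def]) (simp add: D_def)
  have pos: "\<kappa> \<noteq> 0" "\<kappa>' \<noteq> 0" "r > 0" "r' > 0" "D \<ge> 0" using l l' by auto
  obtain e1 where e1: "e1 > 0" and ord: "\<And>u x y T v x' y' T'.
    stable_orbit k c a A H \<omega> \<kappa> r D u x y T \<Longrightarrow> stable_orbit k c a A H \<omega> \<kappa>' r' D v x' y' T' \<Longrightarrow>
    v 0 \<le> 2 * u 0 \<Longrightarrow> x' 0 = x 0 \<Longrightarrow> T' 0 = T 0 \<Longrightarrow> u 0 < e1 \<Longrightarrow> 1 \<le> y' 0 / y 0"
    using orbits_ordered[OF k pos c a A H] by blast
  obtain e2 where e2: "e2 > 0" and ord': "\<And>u x y T v x' y' T'.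
    stable_orbit k c a A H \<omega> \<kappa>' r' D u x y T \<Longrightarrow> stable_orbit k c a A H \<omega> \<kappa> r D v x' y' T' \<Longrightarrow>
    v 0 \<le> 2 * u 0 \<Longrightarrow> x' 0 = x 0 \<Longrightarrow> T' 0 = T 0 \<Longrightarrow> u 0 < e2 \<Longrightarrow> 1 \<le> y' 0 / y 0"
    using orbits_ordered[OF k pos(2,1,4,3,5) c a A H] by blast
  obtain e3 where e3: "e3 > 0" and sur: "\<And>u x \<tau>. 0 < u \<Longrightarrow> u < e3 \<Longrightarrow> \<bar>x - u\<^sup>2\<bar> \<le> D * u ^ 3 \<Longrightarrow>
    \<exists>v t. u / 2 \<le> v \<and> v \<le> 2 * u \<and> X' v t = x \<and> t + S' v t = \<tau>"
  proof (rule parametrization_surjective[of \<epsilon>' D X' S'])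
    show "0 < \<epsilon>'" "0 \<le> D" "continuous_on ({0<..<\<epsilon>'} \<times> UNIV) (\<lambda>(u, t). (X' u t, S' u t))" using l' by blast+
    show "\<bar>X' u t - u\<^sup>2\<bar> \<le> D * u ^ 3" "norm (S' u t) \<le> D * u" if "0 < u" "u < \<epsilon>'" for u t
      using l' that by blast+
  qed (rule that)
  define e where "e = min (min \<epsilon> (\<epsilon>' / 2)) (min e1 (min (e2 / 2) e3))"
  have "e > 0" using l l' e1 e2 e3 by (simp add: e_def)
  then show ?thesis
  proof (rule that)
    fix u t assume u: "0 < u" "u < e"
    have ub: "u < \<epsilon>" "2 * u < \<epsilon>'" "u < e1" "2 * u < e2" "u < e3" using u by (auto simp: e_def)
    have "\<bar>X u t - u\<^sup>2\<bar> \<le> D * u ^ 3" using l u ub by blast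
    then obtain v t' where v: "u / 2 \<le> v" "v \<le> 2 * u" and X': "X' v t' = X u t" and T': "t' + S' v t' = t + S u t"
      using sur[OF u(1) ub(5)] by blast
    have vb: "0 < v" "v < \<epsilon>'" "v < e2" using v u ub by auto
    obtain us xs ys Ts where o: "stable_orbit k c a A H \<omega> \<kappa> r D us xs ys Ts"
      "us 0 = u" "xs 0 = X u t" "ys 0 = Y u t" "Ts 0 = t + S u t" using l u ub by blast
    obtain vs xs' ys' Ts' where o': "stable_orbit k c a A H \<omega> \<kappa>' r' D vs xs' ys' Ts'"
      "vs 0 = v" "xs' 0 = X' v t'" "ys' 0 = Y' v t'" "Ts' 0 = t' + S' v t'" using l' vb by blast
    define q where "q = ys' 0 / ys 0"
    have q1: "1 \<le> q" unfolding q_def using ord[OF o(1) o'(1)] o o' v ub X' T' by simp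
    have "1 \<le> ys 0 / ys' 0" using ord'[OF o'(1) o(1)] o o' v vb X' T' by simp
    also have "ys 0 / ys' 0 = 1 / q" by (simp add: q_def)
    finally have "q \<le> 1" using q1 by (subst (asm) pos_le_divide_eq) auto
    then have "ys' 0 / ys 0 = 1" using q1 by (simp add: q_def)
    then have "ys' 0 = ys 0" by (simp add: divide_eq_1_iff)
    then have "Y' v t' = Y u t" using o o' by simp
    then show "\<exists>v t'. 0 < v \<and> v \<le> 2 * u \<and> v < \<epsilon>' \<and> X' v t' = X u t \<and> Y' v t' = Y u t \<and> t' + S' v t' = t + S u t"
      using v vb X' T' by blast
  qed
qed

lemma unif_bigoD:
  assumes "unif_bigo f n"
  obtains C b where "C \<ge> 0" "b > 0" "\<And>u \<theta>. 0 < u \<Longrightarrow> u < b \<Longrightarrow> norm (f u \<theta>) \<le> C * u ^ n"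
proof -
  obtain C where "eventually (\<lambda>u. \<forall>\<theta>. norm (f u \<theta>) \<le> C * u ^ n) (at_right 0)"
    using assms unfolding unif_bigo_def by blast
  then obtain b where b: "b > 0" "\<And>u. 0 < u \<Longrightarrow> u < b \<Longrightarrow> \<forall>\<theta>. norm (f u \<theta>) \<le> C * u ^ n"
    unfolding eventually_at_right_field by blast
  have "norm (f u \<theta>) \<le> \<bar>C\<bar> * u ^ n" if "0 < u" "u < b" for u \<theta>
  proof -
    have "C * u ^ n \<le> \<bar>C\<bar> * u ^ n" using that by (intro mult_right_mono) auto
    then show ?thesis using b(2)[OF that] order_trans by blast
  qed
  then show ?thesis using that[of "\<bar>C\<bar>" b] b(1) by simp
qed

text \<open>
  The invariance equation determines the angles only modulo integers.  In the cover all terms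
  except for the rotation are small, so the integer is zero.  At \<open>u = 0\<close> the expansions do not apply;
  the values there are obtained by continuity.
\<close>

lemma stable_parametrization_lift:
  fixes c a :: "real ^ 'd \<Rightarrow> real"
  assumes k: "k \<ge> 2" and p: "2 * p > k - 1"
    and G: "\<And>x y t. (x, y) \<in> U \<Longrightarrow> G (x, y, torus_proj t) =
      (x + c t * y, y + a t * x ^ k + A x y t, torus_proj (t + \<omega> + H x y t))"
    and c: "weighted_lipschitz (k + 1) 0 (\<lambda>x y t. c t)"
    and H: "\<And>i. weighted_lipschitz (k + 1) k (\<lambda>x y t. H x y t $ i)"
    and P: "stable_parametrization U \<omega> k p G \<rho> K"
  obtains \<kappa> r C \<epsilon> X Y S where "stable_lift k c a A H \<omega> \<kappa> r C \<epsilon> X Y S" "\<epsilon> \<le> \<rho>"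
    "\<And>u t. 0 < u \<Longrightarrow> u < \<epsilon> \<Longrightarrow> K (u, torus_proj t) = (X u t, Y u t, torus_proj (t + S u t))"
    "\<And>\<theta>. K (0, \<theta>) = (0, 0, \<theta>)"
proof -
  from P obtain X Y S Rx \<kappa> K\<theta> Rk where \<rho>: "\<rho> > 0"
    and K: "\<forall>u\<in>{0..<\<rho>}. \<forall>\<theta>. K (u, \<theta>) = (X u \<theta>, Y u \<theta>, \<theta> + torus_proj (S u \<theta>)) \<and> (X u \<theta>, Y u \<theta>) \<in> U"
    and C1: "C1_on (\<lambda>(u, t). (X u (torus_proj t), Y u (torus_proj t), S u (torus_proj t))) ({0..<\<rho>} \<times> UNIV)"
    and bX: "unif_bigo (\<lambda>u \<theta>. X u \<theta> - u\<^sup>2) 3"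
    and bY: "unif_bigo (\<lambda>u \<theta>. Y u \<theta> - \<kappa> * u ^ (k + 1)) (k + 2)"
    and bS: "unif_bigo (\<lambda>u \<theta>. S u \<theta> - u ^ (2 * p + 1 - k) *\<^sub>R K\<theta>) (2 * p + 2 - k)"
    and bR: "unif_bigo (\<lambda>u \<theta>. Rx u \<theta> - (u + Rk * u ^ k)) (k + 1)"
    and Rk: "Rk < 0"
    and inv: "\<forall>u\<in>{0..<\<rho>}. \<forall>\<theta>. Rx u \<theta> \<in> {0..<\<rho>} \<and> G (K (u, \<theta>)) = K (Rx u \<theta>, \<theta> + torus_proj \<omega>)"
    unfolding stable_parametrization_def by (elim exE conjE) (rule that)
  define r where "r = - Rk"
  have r: "r > 0" using Rk by (simp add: r_def)
  obtain CX dX where CX: "CX \<ge> 0" "dX > 0" "\<And>u \<theta>. 0 < u \<Longrightarrow> u < dX \<Longrightarrow> norm (X u \<theta> - u\<^sup>2) \<le> CX * u ^ 3"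
    by (rule unif_bigoD[OF bX], rule that)
  obtain CY dY where CY: "CY \<ge> 0" "dY > 0" "\<And>u \<theta>. 0 < u \<Longrightarrow> u < dY \<Longrightarrow> norm (Y u \<theta> - \<kappa> * u ^ (k + 1)) \<le> CY * u ^ (k + 2)"
    by (rule unif_bigoD[OF bY], rule that)
  obtain CS dS where CS: "CS \<ge> 0" "dS > 0" "\<And>u \<theta>. 0 < u \<Longrightarrow> u < dS \<Longrightarrow>
      norm (S u \<theta> - u ^ (2 * p + 1 - k) *\<^sub>R K\<theta>) \<le> CS * u ^ (2 * p + 2 - k)"
    by (rule unif_bigoD[OF bS], rule that)
  obtain CR dR where CR: "CR \<ge> 0" "dR > 0" "\<And>u \<theta>. 0 < u \<Longrightarrow> u < dR \<Longrightarrow> norm (Rx u \<theta> - (u + Rk * u ^ k)) \<le> CR * u ^ (k + 1)"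
    by (rule unif_bigoD[OF bR], rule that)
  define C where "C = CX + CY + CR + CS + norm K\<theta>"
  have C: "C \<ge> 0" "CX \<le> C" "CY \<le> C" "CR \<le> C" "CS + norm K\<theta> \<le> C"
    using CX CY CS CR by (auto simp: C_def)
  define M where "M = 1 + \<bar>\<kappa>\<bar> + C"
  have M: "M \<ge> 0" using C by (simp add: M_def)
  have "\<exists>e C. e > 0 \<and> C \<ge> 0 \<and> (\<forall>u x y t. 0 < u \<longrightarrow> u < e \<longrightarrow>
      \<bar>x\<bar> \<le> M * u\<^sup>2 \<longrightarrow> \<bar>y\<bar> \<le> M * u ^ (k + 1) \<longrightarrow> \<bar>H x y t $ i\<bar> \<le> C * u ^ k)" for i
  proof -
    obtain e C where e: "e > 0" "C \<ge> 0" and b: "\<And>u x y t x' y' t' D. 0 < u \<Longrightarrow> u < e \<Longrightarrow>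
      weighted_close (k + 1) M u D x y t x' y' t' \<Longrightarrow>
      \<bar>H x y t $ i\<bar> \<le> C * u ^ k \<and> \<bar>H x' y' t' $ i - H x y t $ i\<bar> \<le> C * u ^ k * D"
      by (rule weighted_lipschitzE[OF H[of i] M], rule that)
    have "\<bar>H x y t $ i\<bar> \<le> C * u ^ k" if "0 < u" "u < e" "\<bar>x\<bar> \<le> M * u\<^sup>2" "\<bar>y\<bar> \<le> M * u ^ (k + 1)" for u x y t
      using b[OF that(1,2), of 0 x y t x y t] that by (simp add: weighted_close_def)
    then show ?thesis using e by blast
  qed
  then obtain eH CH where CH: "\<And>i. eH i > 0" "\<And>i. CH i \<ge> 0"
    and Hb: "\<And>i u x y t. 0 < u \<Longrightarrow> u < eH i \<Longrightarrow> \<bar>x\<bar> \<le> M * u\<^sup>2 \<Longrightarrow> \<bar>y\<bar> \<le> M * u ^ (k + 1) \<Longrightarrow> \<bar>H x y t $ i\<bar> \<le> CH i * u ^ k"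
    by metis
  obtain Kc where Kc: "\<And>t. \<bar>c t\<bar> \<le> Kc" by (rule weighted_lipschitz_angle_bounds[OF c]) (rule that)
  have "\<exists>\<epsilon>>0. \<forall>u x y T. stable_orbit k c a A H \<omega> \<kappa> r C u x y T \<longrightarrow> u 0 < \<epsilon> \<longrightarrow> \<kappa> \<noteq> 0"
    by (rule stable_orbit_leading_coefficient[OF k r C(1) Kc])
  then obtain e\<kappa> where e\<kappa>: "e\<kappa> > 0" "\<forall>u x y T. stable_orbit k c a A H \<omega> \<kappa> r C u x y T \<longrightarrow> u 0 < e\<kappa> \<longrightarrow> \<kappa> \<noteq> 0"
    by (elim exE conjE) (rule that)
  \<comment> \<open>Below this bound the expansions are valid, \<open>Rx\<close> decreases \<open>u\<close> but keeps it positive, and each of the three angular terms is less than \<open>1 / 4\<close>.\<close>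
  define \<epsilon> where "\<epsilon> = Min ({dX, dY, dS, dR, \<rho>, 1, e\<kappa>, 1 / (4 * (C + 1)), r / (2 * (C + 1)), 1 / (2 * r)} \<union> range eH \<union>
    range (\<lambda>i. 1 / (4 * (CH i + 1))))"
  have \<epsilon>: "\<epsilon> > 0" unfolding \<epsilon>_def
    using CX CY CS CR \<rho> e\<kappa> C r CH by (subst Min_gr_iff) (auto intro!: divide_pos_pos add_nonneg_pos mult_pos_pos)
  have \<epsilon>_le: "\<epsilon> \<le> z" if "z \<in> {dX, dY, dS, dR, \<rho>, 1, e\<kappa>, 1 / (4 * (C + 1)), r / (2 * (C + 1)), 1 / (2 * r)} \<union> range eH \<union>
    range (\<lambda>i. 1 / (4 * (CH i + 1)))" for z
    unfolding \<epsilon>_def using that by (intro Min_le) auto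
  have \<epsilon>\<rho>: "\<epsilon> \<le> \<rho>" "\<epsilon> \<le> 1" "\<epsilon> \<le> e\<kappa>" by (auto intro: \<epsilon>_le)
  have bounds: "\<bar>X u \<theta> - u\<^sup>2\<bar> \<le> C * u ^ 3 \<and> \<bar>Y u \<theta> - \<kappa> * u ^ (k + 1)\<bar> \<le> C * u ^ (k + 2) \<and>
      norm (S u \<theta>) \<le> C * u \<and> \<bar>Rx u \<theta> - u + r * u ^ k\<bar> \<le> C * u ^ (k + 1)"
    if u: "0 < u" "u < \<epsilon>" for u \<theta>
  proof -
    have le: "u < dX" "u < dY" "u < dS" "u < dR" "u \<le> 1"
      using u \<epsilon>_le[of dX] \<epsilon>_le[of dY] \<epsilon>_le[of dS] \<epsilon>_le[of dR] \<epsilon>\<rho>(2) by auto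
    have up: "C' * u ^ m \<le> C * u ^ m" if "C' \<le> C" for C' m using u that by (intro mult_right_mono) auto
    have "norm (S u \<theta>) \<le> norm (S u \<theta> - u ^ (2 * p + 1 - k) *\<^sub>R K\<theta>) + norm (u ^ (2 * p + 1 - k) *\<^sub>R K\<theta>)"
      by (metis diff_add_cancel norm_triangle_ineq)
    also have "\<dots> \<le> CS * u ^ (2 * p + 2 - k) + u ^ (2 * p + 1 - k) * norm K\<theta>"
      using CS(3)[OF u(1) le(3)] u by (intro add_mono) auto
    also have "\<dots> \<le> CS * u ^ 1 + u ^ 1 * norm K\<theta>"
      using u le CS p k by (intro add_mono mult_left_mono mult_right_mono power_decreasing) auto
    also have "\<dots> = (CS + norm K\<theta>) * u ^ 1" by (simp add: algebra_simps)
    also have "\<dots> \<le> C * u ^ 1" by (rule up[OF C(5)])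
    finally have "norm (S u \<theta>) \<le> C * u" by simp
    moreover have "\<bar>Rx u \<theta> - u + r * u ^ k\<bar> \<le> CR * u ^ (k + 1)"
      using CR(3)[OF u(1) le(4), of \<theta>] by (simp add: r_def diff_diff_eq)
    ultimately show ?thesis
      using CX(3)[OF u(1) le(1), of \<theta>] CY(3)[OF u(1) le(2), of \<theta>] up[OF C(2), of 3] up[OF C(3), of "k + 2"] up[OF C(4), of "k + 1"]
      unfolding real_norm_def by linarith
  qed
  have R: "0 < Rx u \<theta> \<and> Rx u \<theta> \<le> u" if u: "0 < u" "u < \<epsilon>" for u \<theta>
  proof -
    have "u < r / (2 * (C + 1))" "u < 1 / (2 * r)" "u \<le> 1" using u \<epsilon>_le[of "r / (2 * (C + 1))"] \<epsilon>_le[of "1 / (2 * r)"] \<epsilon>\<rho>(2) by auto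
    then have "u * (2 * (C + 1)) < r" "u * (2 * r) < 1" "u \<le> 1"
      using C r by (simp_all add: pos_less_divide_eq del: distrib_left_numeral)
    then have s: "C * u \<le> r / 2" "2 * r * u < 1" using u by (simp_all add: algebra_simps)
    have "C * u ^ (k + 1) = (C * u) * u ^ k" by simp
    also have "\<dots> \<le> r / 2 * u ^ k" using s u by (intro mult_right_mono) auto
    finally have "\<bar>Rx u \<theta> - u + r * u ^ k\<bar> \<le> r / 2 * u ^ k" using bounds[OF u, of \<theta>] by linarith
    then have 1: "Rx u \<theta> - u + r * u ^ k \<le> r / 2 * u ^ k" "- (Rx u \<theta> - u + r * u ^ k) \<le> r / 2 * u ^ k"
      by (simp_all only: abs_le_iff)
    have "u ^ k \<le> u ^ 2" using u \<open>u \<le> 1\<close> k by (intro power_decreasing) auto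
    then have "2 * r * u ^ k \<le> 2 * r * u ^ 2" using r by simp
    also have "\<dots> = (2 * r * u) * u" by (simp add: power2_eq_square)
    also have "\<dots> < 1 * u" using s u by (intro mult_strict_right_mono) auto
    finally have "2 * r * u ^ k < u" by simp
    moreover have "0 \<le> r * u ^ k" using r u by simp
    ultimately show ?thesis using 1 by simp
  qed
  have step: "X (Rx u (torus_proj t)) (torus_proj (t + \<omega>)) = X u (torus_proj t) + c (t + S u (torus_proj t)) * Y u (torus_proj t) \<and>
      Y (Rx u (torus_proj t)) (torus_proj (t + \<omega>)) = Y u (torus_proj t) + a (t + S u (torus_proj t)) * X u (torus_proj t) ^ k
        + A (X u (torus_proj t)) (Y u (torus_proj t)) (t + S u (torus_proj t)) \<and>
      S (Rx u (torus_proj t)) (torus_proj (t + \<omega>)) = S u (torus_proj t) +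
        H (X u (torus_proj t)) (Y u (torus_proj t)) (t + S u (torus_proj t))"
    if u: "0 < u" "u < \<epsilon>" for u t
  proof -
    let ?\<theta> = "torus_proj t" and ?\<theta>' = "torus_proj (t + \<omega>)"
    let ?u' = "Rx u ?\<theta>"
    let ?h = "H (X u ?\<theta>) (Y u ?\<theta>) (t + S u ?\<theta>)"
    have uin: "u \<in> {0..<\<rho>}" using u \<epsilon>\<rho> by auto
    have u'in: "?u' \<in> {0..<\<rho>}" using inv uin by blast
    have Ku: "K (u, ?\<theta>) = (X u ?\<theta>, Y u ?\<theta>, torus_proj (t + S u ?\<theta>))" and inU: "(X u ?\<theta>, Y u ?\<theta>) \<in> U"
      using K uin by (auto simp: torus_proj_add)
    have Ku': "K (?u', ?\<theta>') = (X ?u' ?\<theta>', Y ?u' ?\<theta>', torus_proj (t + \<omega> + S ?u' ?\<theta>'))"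
      using K u'in by (auto simp: torus_proj_add)
    have "G (K (u, ?\<theta>)) = K (?u', ?\<theta>')" using inv uin by (simp add: torus_proj_add)
    then have eqs: "X u ?\<theta> + c (t + S u ?\<theta>) * Y u ?\<theta> = X ?u' ?\<theta>'"
      "Y u ?\<theta> + a (t + S u ?\<theta>) * X u ?\<theta> ^ k + A (X u ?\<theta>) (Y u ?\<theta>) (t + S u ?\<theta>) = Y ?u' ?\<theta>'"
      "torus_proj (t + S u ?\<theta> + \<omega> + ?h) = torus_proj (t + \<omega> + S ?u' ?\<theta>')"
      unfolding Ku Ku' G[OF inU] by auto
    have u'b: "0 < ?u'" "?u' \<le> u" "?u' < \<epsilon>" using R[OF u, of ?\<theta>] u by auto
    have "S ?u' ?\<theta>' $ i = (S u ?\<theta> + ?h) $ i" for i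
    proof -
      have "u < 1 / (4 * (C + 1))" "u < 1 / (4 * (CH i + 1))" "u < eH i" "u \<le> 1"
        using u \<epsilon>_le[of "1 / (4 * (C + 1))"] \<epsilon>_le[of "1 / (4 * (CH i + 1))"] \<epsilon>_le[of "eH i"] \<epsilon>\<rho>(2) by auto
      then have "u * (4 * (C + 1)) < 1" "u * (4 * (CH i + 1)) < 1" and ue: "u < eH i" "u \<le> 1"
        using C CH[of i] by (simp_all add: pos_less_divide_eq add_nonneg_pos del: distrib_left_numeral)
      then have s: "C * u < 1/4" "CH i * u < 1/4" using u by (simp_all add: algebra_simps)
      have "\<bar>S u ?\<theta> $ i\<bar> \<le> C * u" using bounds[OF u, of ?\<theta>] component_le_norm_cart order_trans by blast
      moreover have "\<bar>S ?u' ?\<theta>' $ i\<bar> \<le> C * u"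
      proof -
        have "\<bar>S ?u' ?\<theta>' $ i\<bar> \<le> C * ?u'" using bounds[OF u'b(1,3), of ?\<theta>'] component_le_norm_cart order_trans by blast
        also have "\<dots> \<le> C * u" using u'b C by (intro mult_left_mono) auto
        finally show ?thesis .
      qed
      moreover have "\<bar>?h $ i\<bar> \<le> CH i * u"
      proof -
        have pw: "u ^ 3 \<le> u\<^sup>2" "u ^ (k + 2) \<le> u ^ (k + 1)" "u ^ k \<le> u ^ 1"
          using u ue k by (intro power_decreasing; simp)+
        have "\<bar>X u ?\<theta>\<bar> \<le> \<bar>X u ?\<theta> - u\<^sup>2\<bar> + u\<^sup>2" using zero_le_power2[of u] by linarith
        also have "\<dots> \<le> u\<^sup>2 + C * u ^ 3" using bounds[OF u, of ?\<theta>] by simp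
        also have "\<dots> \<le> u\<^sup>2 + C * u\<^sup>2" using pw C by (intro add_left_mono mult_left_mono) auto
        also have "\<dots> = (1 + C) * u\<^sup>2" by (simp add: distrib_right)
        also have "\<dots> \<le> M * u\<^sup>2" by (intro mult_right_mono) (auto simp: M_def)
        finally have x: "\<bar>X u ?\<theta>\<bar> \<le> M * u\<^sup>2" .
        have "\<bar>Y u ?\<theta>\<bar> \<le> \<bar>\<kappa> * u ^ (k + 1)\<bar> + \<bar>Y u ?\<theta> - \<kappa> * u ^ (k + 1)\<bar>" by linarith
        also have "\<dots> \<le> \<bar>\<kappa>\<bar> * u ^ (k + 1) + C * u ^ (k + 2)" using bounds[OF u, of ?\<theta>] u by (intro add_mono) (auto simp: abs_mult)
        also have "\<dots> \<le> \<bar>\<kappa>\<bar> * u ^ (k + 1) + C * u ^ (k + 1)" using pw C by (intro add_left_mono mult_left_mono) auto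
        also have "\<dots> = (\<bar>\<kappa>\<bar> + C) * u ^ (k + 1)" by (simp only: distrib_right)
        also have "\<dots> \<le> M * u ^ (k + 1)" using u by (intro mult_right_mono) (auto simp: M_def)
        finally have y: "\<bar>Y u ?\<theta>\<bar> \<le> M * u ^ (k + 1)" .
        have "\<bar>?h $ i\<bar> \<le> CH i * u ^ k" by (rule Hb[OF u(1) ue(1) x y])
        also have "\<dots> \<le> CH i * u ^ 1" using pw CH(2)[of i] by (intro mult_left_mono) auto
        finally show ?thesis by simp
      qed
      moreover have "\<bar>S u ?\<theta> $ i + ?h $ i - S ?u' ?\<theta>' $ i\<bar> \<le> \<bar>S u ?\<theta> $ i\<bar> + \<bar>?h $ i\<bar> + \<bar>S ?u' ?\<theta>' $ i\<bar>" by linarith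
      ultimately have lt: "\<bar>S u ?\<theta> $ i + ?h $ i - S ?u' ?\<theta>' $ i\<bar> < 1" using s by linarith
      have "(t + S u ?\<theta> + \<omega> + ?h) $ i - (t + \<omega> + S ?u' ?\<theta>') $ i \<in> \<int>"
        using eqs(3) unfolding torus_proj_eq_iff by blast
      then have "S u ?\<theta> $ i + ?h $ i - S ?u' ?\<theta>' $ i \<in> \<int>" by (simp add: algebra_simps)
      then have "S u ?\<theta> $ i + ?h $ i - S ?u' ?\<theta>' $ i = 0" using lt Ints_nonzero_abs_ge1 by fastforce
      then show ?thesis by simp
    qed
    then have "S ?u' ?\<theta>' = S u ?\<theta> + ?h" by (simp add: vec_eq_iff)
    then show ?thesis using eqs(1,2) by simp
  qed
  have orbit: "\<exists>us xs ys Ts. stable_orbit k c a A H \<omega> \<kappa> r C us xs ys Ts \<and> us 0 = u \<and>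
      xs 0 = X u (torus_proj t) \<and> ys 0 = Y u (torus_proj t) \<and> Ts 0 = t + S u (torus_proj t)"
    if u: "0 < u" "u < \<epsilon>" for u t
  proof -
    define \<phi> where "\<phi> n = t + real n *\<^sub>R \<omega>" for n
    have \<phi>: "\<phi> (Suc n) = \<phi> n + \<omega>" for n by (simp add: \<phi>_def algebra_simps)
    define us where "us = rec_nat u (\<lambda>n v. Rx v (torus_proj (\<phi> n)))"
    have us: "us 0 = u" "us (Suc n) = Rx (us n) (torus_proj (\<phi> n))" for n by (simp_all add: us_def)
    have ub: "0 < us n \<and> us n < \<epsilon>" for n
    proof (induction n)
      case (Suc n)
      then show ?case using R[of "us n" "torus_proj (\<phi> n)"] by (auto simp: us)
    qed (use u us in simp)
    have st: "stable_orbit k c a A H \<omega> \<kappa> r C us (\<lambda>n. X (us n) (torus_proj (\<phi> n))) (\<lambda>n. Y (us n) (torus_proj (\<phi> n)))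
      (\<lambda>n. \<phi> n + S (us n) (torus_proj (\<phi> n)))"
      unfolding stable_orbit_def
    proof
      fix n
      have u: "0 < us n" "us n < \<epsilon>" using ub[of n] by auto
      show "0 < us n \<and> \<bar>us (Suc n) - us n + r * us n ^ k\<bar> \<le> C * us n ^ (k + 1) \<and>
        \<bar>X (us n) (torus_proj (\<phi> n)) - (us n)\<^sup>2\<bar> \<le> C * us n ^ 3 \<and>
        \<bar>Y (us n) (torus_proj (\<phi> n)) - \<kappa> * us n ^ (k + 1)\<bar> \<le> C * us n ^ (k + 2) \<and>
        X (us (Suc n)) (torus_proj (\<phi> (Suc n))) = X (us n) (torus_proj (\<phi> n)) +
          c (\<phi> n + S (us n) (torus_proj (\<phi> n))) * Y (us n) (torus_proj (\<phi> n)) \<and>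
        Y (us (Suc n)) (torus_proj (\<phi> (Suc n))) = Y (us n) (torus_proj (\<phi> n)) +
          a (\<phi> n + S (us n) (torus_proj (\<phi> n))) * X (us n) (torus_proj (\<phi> n)) ^ k +
          A (X (us n) (torus_proj (\<phi> n))) (Y (us n) (torus_proj (\<phi> n))) (\<phi> n + S (us n) (torus_proj (\<phi> n))) \<and>
        \<phi> (Suc n) + S (us (Suc n)) (torus_proj (\<phi> (Suc n))) = \<phi> n + S (us n) (torus_proj (\<phi> n)) + \<omega> +
          H (X (us n) (torus_proj (\<phi> n))) (Y (us n) (torus_proj (\<phi> n))) (\<phi> n + S (us n) (torus_proj (\<phi> n)))"
        unfolding us(2) \<phi> using bounds[OF u, of "torus_proj (\<phi> n)"] step[OF u, of "\<phi> n"] u(1)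
        by (simp add: add_ac)
    qed
    show ?thesis by (intro exI conjI, rule st) (simp_all add: us(1) \<phi>_def)
  qed
  have \<kappa>: "\<kappa> \<noteq> 0"
  proof -
    have "0 < \<epsilon> / 2" "\<epsilon> / 2 < \<epsilon>" using \<epsilon> by auto
    from orbit[OF this, of 0] obtain us xs ys Ts
      where o: "stable_orbit k c a A H \<omega> \<kappa> r C us xs ys Ts" "us 0 = \<epsilon> / 2" by blast
    have "us 0 < e\<kappa>" using o(2) \<epsilon> \<epsilon>\<rho>(3) by linarith
    then show ?thesis using e\<kappa>(2) o(1) by blast
  qed
  have cont: "continuous_on ({0..<\<rho>} \<times> UNIV) (\<lambda>(u, t). (X u (torus_proj t), Y u (torus_proj t), S u (torus_proj t)))"
    using C1 unfolding C1_on_def continuous_on_eq_continuous_within by (meson has_derivative_continuous)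
  have sub: "{0<..<\<epsilon>} \<times> UNIV \<subseteq> {0..<\<rho>} \<times> UNIV" using \<epsilon>\<rho> by auto
  note cont' = continuous_on_subset[OF cont sub]
  have "continuous_on ({0<..<\<epsilon>} \<times> UNIV) (\<lambda>(u, t). (X u (torus_proj t), S u (torus_proj t)))"
    using continuous_on_Pair[OF continuous_on_fst[OF cont'] continuous_on_snd[OF continuous_on_snd[OF cont']]]
    by (simp add: case_prod_unfold)
  then have lift: "stable_lift k c a A H \<omega> \<kappa> r C \<epsilon> (\<lambda>u t. X u (torus_proj t)) (\<lambda>u t. Y u (torus_proj t)) (\<lambda>u t. S u (torus_proj t))"
    unfolding stable_lift_def using \<epsilon> r \<kappa> C(1) bounds orbit by blast
  have zero: "K (0, \<theta>) = (0, 0, \<theta>)" for \<theta>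
  proof -
    obtain t where t: "\<theta> = torus_proj t" by (rule torus_proj_surj)
    define f where "f u = (X u \<theta>, Y u \<theta>, S u \<theta>)" for u
    have "continuous_on {0..<\<rho>} (\<lambda>u. (\<lambda>(u, t). (X u (torus_proj t), Y u (torus_proj t), S u (torus_proj t))) (u, t))"
      by (rule continuous_on_compose2[OF cont]) (auto intro!: continuous_intros)
    then have "continuous_on {0..<\<rho>} f" by (simp add: f_def[abs_def] t)
    then have "(f \<longlongrightarrow> f 0) (at 0 within {0..<\<rho>})" using \<rho> by (simp add: continuous_on_def)
    moreover have "at 0 within {0..<\<rho>} = at_right 0"
      by (rule at_within_nhd[where S = "{..<\<rho>}"]) (use \<rho> in auto)
    ultimately have l1: "(f \<longlongrightarrow> f 0) (at_right 0)" by simp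
    have l2: "(f \<longlongrightarrow> 0) (at_right 0)"
    proof (rule Lim_null_comparison)
      show "eventually (\<lambda>u. norm (f u) \<le> (1 + C) * u + (\<bar>\<kappa>\<bar> + C) * u + C * u) (at_right 0)"
        unfolding eventually_at_right_field
      proof (intro exI[of _ \<epsilon>] conjI allI impI)
        fix u assume u: "0 < u" "u < \<epsilon>"
        have u1: "u \<le> 1" using u \<epsilon>\<rho> by simp
        have pw: "u\<^sup>2 \<le> u ^ 1" "u ^ 3 \<le> u ^ 1" "u ^ (k + 1) \<le> u ^ 1" "u ^ (k + 2) \<le> u ^ 1"
          using u u1 by (intro power_decreasing; simp)+
        have Cu: "C * u ^ 3 \<le> C * u ^ 1" "C * u ^ (k + 2) \<le> C * u ^ 1" "\<bar>\<kappa>\<bar> * u ^ (k + 1) \<le> \<bar>\<kappa>\<bar> * u ^ 1"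
          using pw C by (auto intro!: mult_left_mono)
        note b = bounds[OF u, of \<theta>]
        have 1: "\<bar>X u \<theta>\<bar> \<le> (1 + C) * u"
        proof -
          have "\<bar>X u \<theta>\<bar> \<le> \<bar>X u \<theta> - u\<^sup>2\<bar> + u\<^sup>2" using zero_le_power2[of u] by linarith
          also have "\<dots> \<le> C * u + u" using b Cu pw by simp
          finally show ?thesis by (simp add: algebra_simps)
        qed
        have 2: "\<bar>Y u \<theta>\<bar> \<le> (\<bar>\<kappa>\<bar> + C) * u"
        proof -
          have "\<bar>Y u \<theta>\<bar> \<le> \<bar>Y u \<theta> - \<kappa> * u ^ (k + 1)\<bar> + \<bar>\<kappa> * u ^ (k + 1)\<bar>" by linarith
          also have "\<bar>\<kappa> * u ^ (k + 1)\<bar> = \<bar>\<kappa>\<bar> * u ^ (k + 1)" using u by (simp add: abs_mult)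
          also have "\<bar>Y u \<theta> - \<kappa> * u ^ (k + 1)\<bar> + \<bar>\<kappa>\<bar> * u ^ (k + 1) \<le> C * u + \<bar>\<kappa>\<bar> * u"
            using b Cu by (intro add_mono) auto
          finally show ?thesis by (simp add: algebra_simps)
        qed
        have "norm (f u) \<le> \<bar>X u \<theta>\<bar> + norm (Y u \<theta>, S u \<theta>)"
          using norm_Pair_le[of "X u \<theta>" "(Y u \<theta>, S u \<theta>)"] by (simp add: f_def)
        also have "\<dots> \<le> \<bar>X u \<theta>\<bar> + (\<bar>Y u \<theta>\<bar> + norm (S u \<theta>))"
          using norm_Pair_le[of "Y u \<theta>" "S u \<theta>"] by simp
        also have "\<dots> \<le> (1 + C) * u + ((\<bar>\<kappa>\<bar> + C) * u + C * u)" using 1 2 b by (intro add_mono) auto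
        finally show "norm (f u) \<le> (1 + C) * u + (\<bar>\<kappa>\<bar> + C) * u + C * u" by simp
      qed (rule \<epsilon>)
      have "((\<lambda>u. (1 + C) * u + (\<bar>\<kappa>\<bar> + C) * u + C * u) \<longlongrightarrow> (1 + C) * 0 + (\<bar>\<kappa>\<bar> + C) * 0 + C * 0) (at_right 0)"
        by (intro tendsto_intros)
      then show "((\<lambda>u. (1 + C) * u + (\<bar>\<kappa>\<bar> + C) * u + C * u) \<longlongrightarrow> 0) (at_right 0)" by simp
    qed
    have "f 0 = 0" by (rule tendsto_unique[OF _ l1 l2]) simp
    then have "X 0 \<theta> = 0" "Y 0 \<theta> = 0" "S 0 \<theta> = 0" by (simp_all add: f_def zero_prod_def)
    moreover have "torus_proj (0 :: real ^ 'd) = 0" by transfer simp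
    ultimately show ?thesis using K \<rho> by simp
  qed
  show ?thesis
  proof (rule that[OF lift \<epsilon>\<rho>(1) _ zero])
    show "K (u, torus_proj t) = (X u (torus_proj t), Y u (torus_proj t), torus_proj (t + S u (torus_proj t)))"
      if "0 < u" "u < \<epsilon>" for u t
      using K that \<epsilon>\<rho>(1) by (simp add: torus_proj_add)
  qed
qed

lemma parametrization_near_torus:
  fixes K :: "real \<times> 'd::finite torus \<Rightarrow> real \<times> real \<times> 'd torus"
  assumes lift: "stable_lift k c a A H \<omega> \<kappa> r C \<epsilon> X Y S"
    and K: "\<And>u t. 0 < u \<Longrightarrow> u < \<epsilon> \<Longrightarrow> K (u, torus_proj t) = (X u t, Y u t, torus_proj (t + S u t))"
  obtains e where "e > 0" "\<And>u \<theta>. 0 < u \<Longrightarrow> u < e \<Longrightarrow> u\<^sup>2 / 2 \<le> fst (K (u, \<theta>))"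
proof (rule that)
  note l = lift[unfolded stable_lift_def]
  define e where "e = min \<epsilon> (1 / (2 * (C + 1)))"
  show "e > 0" using l by (auto simp: e_def)
  fix u and \<theta> :: "'d torus" assume u: "0 < u" "u < e"
  obtain t where t: "\<theta> = torus_proj t" by (rule torus_proj_surj)
  have C: "C \<ge> 0" using l by blast
  have ub: "u < \<epsilon>" and "u < 1 / (2 * (C + 1))" using u by (auto simp: e_def)
  then have "u * (2 * (C + 1)) < 1" using C by (subst (asm) pos_less_divide_eq) auto
  then have "C * u \<le> 1 / 2" using u by (simp add: algebra_simps)
  then have "C * u * u\<^sup>2 \<le> 1 / 2 * u\<^sup>2" by (intro mult_right_mono) auto
  moreover have "\<bar>X u t - u\<^sup>2\<bar> \<le> C * u ^ 3" using l u(1) ub by blast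
  ultimately have "\<bar>X u t - u\<^sup>2\<bar> \<le> u\<^sup>2 / 2" by (simp add: power2_eq_square power3_eq_cube mult.assoc)
  then have "- (X u t - u\<^sup>2) \<le> u\<^sup>2 / 2" by (simp only: abs_le_iff)
  then show "u\<^sup>2 / 2 \<le> fst (K (u, \<theta>))" using K[OF u(1) ub] by (simp add: t)
qed

theorem theorem2p4:
  fixes U :: "(real \<times> real) set"
    and \<Lambda> :: "(real ^ 'm) set"
    and \<omega> :: "real ^ 'd"
    and k p :: nat
    and c a :: "'d torus \<Rightarrow> real ^ 'm \<Rightarrow> real"
    and d :: "'d torus \<Rightarrow> real ^ 'm \<Rightarrow> real ^ 'd"
    and A :: "real \<Rightarrow> real \<Rightarrow> 'd torus \<Rightarrow> real ^ 'm \<Rightarrow> real"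
    and B :: "real \<Rightarrow> real \<Rightarrow> 'd torus \<Rightarrow> real ^ 'm \<Rightarrow> real ^ 'd"
    and F :: "real \<times> real \<times> 'd torus \<Rightarrow> real ^ 'm \<Rightarrow> real \<times> real \<times> 'd torus"
    and K1 K2 :: "real \<times> 'd torus \<Rightarrow> real \<times> real \<times> 'd torus"
  assumes "(0, 0) \<in> interior U"
    and "k \<ge> 2" and "p \<ge> 1"
    and "reduced_form U \<Lambda> \<omega> k p c a d A B F"
    and "2 * p > k - 1"
    and "\<forall>\<mu>\<in>\<Lambda>. torus_average (\<lambda>\<theta>. a \<theta> \<mu>) > 0"
    and "diophantine \<omega>"
    and "\<mu> \<in> \<Lambda>"
    and "stable_parametrization U \<omega> k p (\<lambda>z. F z \<mu>) \<rho>1 K1"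
    and "stable_parametrization U \<omega> k p (\<lambda>z. F z \<mu>) \<rho>2 K2"
  shows "coincide_near_torus \<rho>1 K1 \<rho>2 K2"
proof -
  note red = assms(4)[unfolded reduced_form_def]
  have k: "k \<ge> 2" and p: "p \<ge> 1" and kp: "k \<le> 2 * p" using assms(2,3,5) by auto
  define c' where "c' t = c (torus_proj t) \<mu>" for t
  define a' where "a' t = a (torus_proj t) \<mu>" for t
  define A' where "A' x y t = A x y (torus_proj t) \<mu>" for x y t
  define H where "H x y t = x ^ p *\<^sub>R d (torus_proj t) \<mu> + B x y (torus_proj t) \<mu>" for x y t
  have G: "F (x, y, torus_proj t) \<mu> = (x + c' t * y, y + a' t * x ^ k + A' x y t, torus_proj (t + \<omega> + H x y t))"
    if "(x, y) \<in> U" for x y t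
    using red that assms(8) by (simp add: c'_def a'_def A'_def H_def torus_proj_add add.assoc)
  have id: "bounded_linear (\<lambda>x :: real. x)" by (rule bounded_linear_ident)
  have c: "weighted_lipschitz (k + 1) 0 (\<lambda>x y t. c' t)"
    unfolding c'_def using red assms(8) by (intro weighted_lipschitz_angle[OF _ _ id]) auto
  have a: "weighted_lipschitz (k + 1) 0 (\<lambda>x y t. a' t)"
    unfolding a'_def using red assms(8) by (intro weighted_lipschitz_angle[OF _ _ id]) auto
  have A: "weighted_lipschitz (k + 1) (2 * k + 1) A'"
  proof -
    have 1: "real_analytic_on (\<lambda>((x, y), t, \<mu>). A x y (torus_proj t) \<mu>) (U \<times> UNIV \<times> \<Lambda>)"
      and 2: "mixed_bigo (\<lambda>x y \<theta>. A x y \<theta> \<mu>) (k - 1) (k + 1)"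
      using red assms(8) by blast+
    show ?thesis unfolding A'_def
      by (rule weighted_lipschitz_mixed_bigo[OF assms(1,8) 1 id 2]) (use k in auto)
  qed
  have H: "weighted_lipschitz (k + 1) k (\<lambda>x y t. H x y t $ i)" for i
  proof -
    have nth: "bounded_linear (\<lambda>v :: real ^ 'd. v $ i)" by (rule bounded_linear_vec_nth)
    have 1: "real_analytic_on (\<lambda>((x, y), t, \<mu>). B x y (torus_proj t) \<mu>) (U \<times> UNIV \<times> \<Lambda>)"
      and 2: "mixed_bigo (\<lambda>x y \<theta>. B x y \<theta> \<mu>) (p - 1) (p + 1)"
      and 3: "real_analytic_on (\<lambda>(t, \<mu>). d (torus_proj t) \<mu>) (UNIV \<times> \<Lambda>)"
      using red assms(8) by blast+
    have B: "weighted_lipschitz (k + 1) (2 * p) (\<lambda>x y t. B x y (torus_proj t) \<mu> $ i)"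
      by (rule weighted_lipschitz_mixed_bigo[OF assms(1,8) 1 nth 2]) (use k p in auto)
    have "weighted_lipschitz (k + 1) (2 * p) (\<lambda>x y t. x ^ p * d (torus_proj t) \<mu> $ i)"
      using weighted_lipschitz_mult[OF weighted_lipschitz_power_x weighted_lipschitz_angle[OF 3 assms(8) nth]] by simp
    from weighted_lipschitz_lower[OF weighted_lipschitz_add[OF this B] kp] show ?thesis
      by (simp add: H_def)
  qed
  obtain \<kappa>1 r1 C1 \<epsilon>1 X1 Y1 S1 where L1: "stable_lift k c' a' A' H \<omega> \<kappa>1 r1 C1 \<epsilon>1 X1 Y1 S1" "\<epsilon>1 \<le> \<rho>1"
    and K1: "\<And>u t. 0 < u \<Longrightarrow> u < \<epsilon>1 \<Longrightarrow> K1 (u, torus_proj t) = (X1 u t, Y1 u t, torus_proj (t + S1 u t))"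
      "\<And>\<theta>. K1 (0, \<theta>) = (0, 0, \<theta>)"
    by (rule stable_parametrization_lift[OF k assms(5) G c H assms(9)], assumption, rule that)
  obtain \<kappa>2 r2 C2 \<epsilon>2 X2 Y2 S2 where L2: "stable_lift k c' a' A' H \<omega> \<kappa>2 r2 C2 \<epsilon>2 X2 Y2 S2" "\<epsilon>2 \<le> \<rho>2"
    and K2: "\<And>u t. 0 < u \<Longrightarrow> u < \<epsilon>2 \<Longrightarrow> K2 (u, torus_proj t) = (X2 u t, Y2 u t, torus_proj (t + S2 u t))"
      "\<And>\<theta>. K2 (0, \<theta>) = (0, 0, \<theta>)"
    by (rule stable_parametrization_lift[OF k assms(5) G c H assms(10)], assumption, rule that)
  have meet: "\<exists>e>0. \<forall>u \<theta>. 0 < u \<longrightarrow> u < e \<longrightarrow> u\<^sup>2 / 2 \<le> fst (K (u, \<theta>)) \<and>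
      (\<exists>v \<theta>'. 0 < v \<and> v \<le> 2 * u \<and> K' (v, \<theta>') = K (u, \<theta>))"
    if L: "stable_lift k c' a' A' H \<omega> \<kappa> r C \<epsilon> X Y S" and L': "stable_lift k c' a' A' H \<omega> \<kappa>' r' C' \<epsilon>' X' Y' S'"
      and K: "\<And>u t. 0 < u \<Longrightarrow> u < \<epsilon> \<Longrightarrow> K (u, torus_proj t) = (X u t, Y u t, torus_proj (t + S u t))"
      and K': "\<And>u t. 0 < u \<Longrightarrow> u < \<epsilon>' \<Longrightarrow> K' (u, torus_proj t) = (X' u t, Y' u t, torus_proj (t + S' u t))"
    for \<kappa> r C \<epsilon> X Y S \<kappa>' r' C' \<epsilon>' X' Y' S' and K K' :: "real \<times> 'd torus \<Rightarrow> real \<times> real \<times> 'd torus"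
  proof -
    obtain e where e: "e > 0" "\<And>u t. 0 < u \<Longrightarrow> u < e \<Longrightarrow>
      \<exists>v t'. 0 < v \<and> v \<le> 2 * u \<and> v < \<epsilon>' \<and> X' v t' = X u t \<and> Y' v t' = Y u t \<and> t' + S' v t' = t + S u t"
      using stable_lifts_coincide[OF k c a A H L L'] by blast
    obtain e' where e': "e' > 0" "\<And>u \<theta>. 0 < u \<Longrightarrow> u < e' \<Longrightarrow> u\<^sup>2 / 2 \<le> fst (K (u, \<theta>))"
      using parametrization_near_torus[OF L K] by blast
    have \<epsilon>: "\<epsilon> > 0" using L by (simp add: stable_lift_def)
    have "\<exists>v \<theta>'. 0 < v \<and> v \<le> 2 * u \<and> K' (v, \<theta>') = K (u, \<theta>)" if u: "0 < u" "u < min e \<epsilon>" for u \<theta>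
    proof -
      obtain t where t: "\<theta> = torus_proj t" by (rule torus_proj_surj)
      obtain v t' where v: "0 < v" "v \<le> 2 * u" "v < \<epsilon>'" and eq: "X' v t' = X u t" "Y' v t' = Y u t" "t' + S' v t' = t + S u t"
        using e(2)[of u t] u by auto
      have "K' (v, torus_proj t') = K (u, \<theta>)" using K'[OF v(1,3), of t'] K[of u t] u eq t by simp
      then show ?thesis using v by blast
    qed
    then show ?thesis using e(1) e' \<epsilon> by (intro exI[of _ "min e' (min e \<epsilon>)"]) auto
  qed
  obtain e1 where e1: "e1 > 0" and m1: "\<And>u \<theta>. 0 < u \<Longrightarrow> u < e1 \<Longrightarrow> u\<^sup>2 / 2 \<le> fst (K1 (u, \<theta>)) \<and>
      (\<exists>v \<theta>'. 0 < v \<and> v \<le> 2 * u \<and> K2 (v, \<theta>') = K1 (u, \<theta>))"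
    using meet[OF L1(1) L2(1) K1(1) K2(1)] by blast
  obtain e2 where e2: "e2 > 0" and m2: "\<And>u \<theta>. 0 < u \<Longrightarrow> u < e2 \<Longrightarrow> u\<^sup>2 / 2 \<le> fst (K2 (u, \<theta>)) \<and>
      (\<exists>v \<theta>'. 0 < v \<and> v \<le> 2 * u \<and> K1 (v, \<theta>') = K2 (u, \<theta>))"
    using meet[OF L2(1) L1(1) K2(1) K1(1)] by blast
  \<comment> \<open>Since \<open>x \<ge> u\<^sup>2 / 2\<close>, points with small \<open>x\<close> have small parameters on both manifolds.\<close>
  have incl: "K ` ({0..<s} \<times> UNIV) \<inter> {z. fst z < s'\<^sup>2 / 8} \<subseteq> K' ` ({0..<s'} \<times> UNIV)"
    if m: "\<And>u \<theta>. 0 < u \<Longrightarrow> u < s \<Longrightarrow> u\<^sup>2 / 2 \<le> fst (K (u, \<theta>)) \<and>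
      (\<exists>v \<theta>'. 0 < v \<and> v \<le> 2 * u \<and> K' (v, \<theta>') = K (u, \<theta>))"
      and z: "\<And>\<theta>. K (0, \<theta>) = K' (0, \<theta>)" and s': "0 < s'"
    for s s' and K K' :: "real \<times> 'd torus \<Rightarrow> real \<times> real \<times> 'd torus"
  proof
    fix w assume "w \<in> K ` ({0..<s} \<times> UNIV) \<inter> {z. fst z < s'\<^sup>2 / 8}"
    then obtain u \<theta> where u: "0 \<le> u" "u < s" and w: "w = K (u, \<theta>)" "fst w < s'\<^sup>2 / 8" by auto
    show "w \<in> K' ` ({0..<s'} \<times> UNIV)"
    proof (cases "u = 0")
      case True
      then have "w = K' (0, \<theta>)" using w z by simp
      then show ?thesis using s' by (intro image_eqI[of _ _ "(0, \<theta>)"]) auto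
    next
      case False
      then have u0: "0 < u" using u by simp
      have "u\<^sup>2 / 2 \<le> fst w" using m[OF u0 u(2), of \<theta>] w(1) by blast
      then have "u\<^sup>2 < (s' / 2)\<^sup>2" using w(2) by (simp add: power_divide)
      then have us: "u < s' / 2" using s' by (intro power_less_imp_less_base[of u 2 "s' / 2"]) auto
      obtain v \<theta>' where v: "0 < v" "v \<le> 2 * u" "K' (v, \<theta>') = K (u, \<theta>)" using m[OF u0 u(2), of \<theta>] by blast
      have "v \<in> {0..<s'}" using v us by auto
      then show ?thesis using v(3) w(1) by (intro image_eqI[of _ _ "(v, \<theta>')"]) auto
    qed
  qed
  show ?thesis
    unfolding coincide_near_torus_def
  proof (rule exI[of _ "min e1 e2"], intro conjI allI impI)
    show "0 < min e1 e2" using e1 e2 by simp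
    fix s1 s2 assume s1: "0 < s1 \<and> s1 \<le> min (min e1 e2) \<rho>1" and s2: "0 < s2 \<and> s2 \<le> min (min e1 e2) \<rho>2"
    define V where "V = {z :: real \<times> real \<times> 'd torus. fst z < (min s1 s2)\<^sup>2 / 8}"
    have "open V" unfolding V_def by (intro open_Collect_less continuous_intros)
    moreover have "{(0, 0, \<theta>) | \<theta>. True} \<subseteq> V" using s1 s2 by (auto simp: V_def)
    moreover have "K1 ` ({0..<s1} \<times> UNIV) \<inter> V = K2 ` ({0..<s2} \<times> UNIV) \<inter> V"
    proof -
      have "(min s1 s2)\<^sup>2 \<le> s1\<^sup>2" "(min s1 s2)\<^sup>2 \<le> s2\<^sup>2" using s1 s2 by (auto intro!: power_mono)
      then have V: "V \<subseteq> {z. fst z < s1\<^sup>2 / 8}" "V \<subseteq> {z. fst z < s2\<^sup>2 / 8}" by (auto simp: V_def)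
      have "K1 ` ({0..<s1} \<times> UNIV) \<inter> {z. fst z < s2\<^sup>2 / 8} \<subseteq> K2 ` ({0..<s2} \<times> UNIV)"
        by (rule incl) (use m1 s1 s2 K1(2) K2(2) in auto)
      moreover have "K2 ` ({0..<s2} \<times> UNIV) \<inter> {z. fst z < s1\<^sup>2 / 8} \<subseteq> K1 ` ({0..<s1} \<times> UNIV)"
        by (rule incl) (use m2 s1 s2 K1(2) K2(2) in auto)
      ultimately show ?thesis using V by blast
    qed
    ultimately show "\<exists>V. open V \<and> {(0, 0, \<theta>) | \<theta>. True} \<subseteq> V \<and>
        K1 ` ({0..<s1} \<times> UNIV) \<inter> V = K2 ` ({0..<s2} \<times> UNIV) \<inter> V" by blast
  qed
qed

end
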